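(* Let $\Gamma$ be a nonelementary discrete subgroup of $\mathrm{Sp}(2,1)$ whose trace field is contained in $\mathbb R$. Then $\Gamma$ stabilizes a totally geodesic submanifold of $\mathbf H^2_{\mathbb H}$ which is isometric to either $\mathbf H^2_{\mathbb R}$ or $\mathbf H^1_{\mathbb C}$.
   Context: $\mathbb H$ denotes the quaternions. $\mathrm{Sp}(2,1)=\{A\in\mathrm{GL}(3,\mathbb H): A^*I_{2,1}A=I_{2,1}\}$, $I_{2,1}=\mathrm{diag}(1,1,-1)$, acting (on the left on column vectors) by isometries on quaternionic hyperbolic plane $\mathbf H^2_{\mathbb H}$, the set of quaternionic lines $v\mathbb H$ with $\langle v,v\rangle=v^*I_{2,1}v<0$, with its Bergman metric. Nonelementary means the limit set in $\partial\mathbf H^2_{\mathbb H}$ has more than two points. The trace of a matrix is the sum of its diagonal entries; the trace field of $\Gamma$ is the skew field generated over $\mathbb Q$ by the traces of its elements. *)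

theory Defs
  imports "HOL-Analysis.Analysis" "HOL-Library.Numeral_Type"
begin

section \<open>Quaternions, modelled as real^4 with components 0 (real part), 1 (i), 2 (j), 3 (k)\<close>

type_synonym quat = "real ^ 4"

definition qmul :: "quat \<Rightarrow> quat \<Rightarrow> quat" where
  "qmul a b = (\<chi> i.
     if i = 0 then a$0*b$0 - a$1*b$1 - a$2*b$2 - a$3*b$3
     else if i = 1 then a$0*b$1 + a$1*b$0 + a$2*b$3 - a$3*b$2
     else if i = 2 then a$0*b$2 - a$1*b$3 + a$2*b$0 + a$3*b$1
     else a$0*b$3 + a$1*b$2 - a$2*b$1 + a$3*b$0)"

definition qcnj :: "quat \<Rightarrow> quat" where
  "qcnj a = (\<chi> i. if i = 0 then a$0 else - (a$i))"

definition qreal :: "real \<Rightarrow> quat" where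
  "qreal r = (\<chi> i. if i = 0 then r else 0)"

definition qinv :: "quat \<Rightarrow> quat" where
  "qinv a = (1 / (norm a)\<^sup>2) *\<^sub>R qcnj a"

type_synonym qvec = "quat ^ 3"
type_synonym qmat = "quat ^ 3 ^ 3"

definition qmat_mult :: "qmat \<Rightarrow> qmat \<Rightarrow> qmat" where
  "qmat_mult A B = (\<chi> i j. \<Sum>k\<in>UNIV. qmul (A$i$k) (B$k$j))"

definition qmat_vec :: "qmat \<Rightarrow> qvec \<Rightarrow> qvec" where
  "qmat_vec A v = (\<chi> i. \<Sum>k\<in>UNIV. qmul (A$i$k) (v$k))"

definition qmat_adj :: "qmat \<Rightarrow> qmat" where
  "qmat_adj A = (\<chi> i j. qcnj (A$j$i))"

definition qmat_id :: qmat where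
  "qmat_id = (\<chi> i j. if i = j then qreal 1 else 0)"

text \<open>I_{2,1} = diag(1,1,-1); the index 2 of type 3 is the third coordinate.\<close>
definition I21 :: qmat where
  "I21 = (\<chi> i j. if i = j then (if i = 2 then qreal (-1) else qreal 1) else 0)"

definition qmat_trace :: "qmat \<Rightarrow> quat" where
  "qmat_trace A = (\<Sum>i\<in>UNIV. A$i$i)"

definition GL3H :: "qmat set" where
  "GL3H = {A. \<exists>B. qmat_mult A B = qmat_id \<and> qmat_mult B A = qmat_id}"

definition Sp21 :: "qmat set" where
  "Sp21 = {A \<in> GL3H. qmat_mult (qmat_adj A) (qmat_mult I21 A) = I21}"

definition is_subgroup_Sp21 :: "qmat set \<Rightarrow> bool" where
  "is_subgroup_Sp21 G \<longleftrightarrow> G \<subseteq> Sp21 \<and> qmat_id \<in> G \<and>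
     (\<forall>A\<in>G. \<forall>B\<in>G. qmat_mult A B \<in> G) \<and>
     (\<forall>A\<in>G. \<exists>B\<in>G. qmat_mult A B = qmat_id \<and> qmat_mult B A = qmat_id)"

text \<open>Discreteness w.r.t. the topology of GL(3,H) as a subspace of H^{3x3} = R^36.\<close>
definition discrete_subgroup_Sp21 :: "qmat set \<Rightarrow> bool" where
  "discrete_subgroup_Sp21 G \<longleftrightarrow> is_subgroup_Sp21 G \<and> discrete G"

definition sub_skew_field :: "quat set \<Rightarrow> bool" where
  "sub_skew_field K \<longleftrightarrow> 0 \<in> K \<and> qreal 1 \<in> K \<and>
     (\<forall>a\<in>K. \<forall>b\<in>K. a + b \<in> K \<and> qmul a b \<in> K) \<and>
     (\<forall>a\<in>K. - a \<in> K) \<and> (\<forall>a\<in>K. a \<noteq> 0 \<longrightarrow> qinv a \<in> K)"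

definition trace_field :: "qmat set \<Rightarrow> quat set" where
  "trace_field G = \<Inter>{K. sub_skew_field K \<and> qmat_trace ` G \<subseteq> K}"

definition qscal :: "qvec \<Rightarrow> quat \<Rightarrow> qvec" where
  "qscal v l = (\<chi> i. qmul (v$i) l)"

text \<open>Hermitian form <v,w> = v^* I_{2,1} w\<close>
definition herm :: "qvec \<Rightarrow> qvec \<Rightarrow> quat" where
  "herm v w = qmul (qcnj (v$0)) (w$0) + qmul (qcnj (v$1)) (w$1) - qmul (qcnj (v$2)) (w$2)"

definition qline :: "qvec \<Rightarrow> qvec set" where
  "qline v = range (qscal v)"

definition HH2 :: "qvec set set" where
  "HH2 = {qline v | v. herm v v $ 0 < 0}"

definition bdry_HH2 :: "qvec set set" where
  "bdry_HH2 = {qline v | v. v \<noteq> 0 \<and> herm v v = 0}"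

definition qact :: "qmat \<Rightarrow> qvec set \<Rightarrow> qvec set" where
  "qact A L = qmat_vec A ` L"

text \<open>Bergman metric: cosh^2(d/2) = |<v,w>|^2 / (<v,v><w,w>).\<close>
definition hypdist_of :: "real \<Rightarrow> real" where
  "hypdist_of c = 2 * arcosh (sqrt c)"

definition rep :: "'v::zero set \<Rightarrow> 'v" where
  "rep L = (SOME v. v \<in> L \<and> v \<noteq> 0)"

definition distHH :: "qvec set \<Rightarrow> qvec set \<Rightarrow> real" where
  "distHH L M = (let v = rep L; w = rep M in
     hypdist_of ((norm (herm v w))\<^sup>2 / ((herm v v $ 0) * (herm w w $ 0))))"

text \<open>Convergence of a sequence of lines in the (quotient) topology of projective space.\<close>
definition lines_tendsto :: "(nat \<Rightarrow> qvec set) \<Rightarrow> qvec set \<Rightarrow> bool" where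
  "lines_tendsto X L \<longleftrightarrow> (\<exists>u v. (\<forall>n. u n \<in> X n) \<and> v \<in> L \<and> v \<noteq> 0 \<and> u \<longlonglongrightarrow> v)"

definition limit_set :: "qmat set \<Rightarrow> qvec set set" where
  "limit_set G = {\<xi> \<in> bdry_HH2. \<exists>x\<in>HH2. \<exists>g :: nat \<Rightarrow> qmat.
      (\<forall>n. g n \<in> G) \<and> inj g \<and> lines_tendsto (\<lambda>n. qact (g n) x) \<xi>}"

definition nonelementary :: "qmat set \<Rightarrow> bool" where
  "nonelementary G \<longleftrightarrow> (\<exists>a b c. a \<in> limit_set G \<and> b \<in> limit_set G \<and> c \<in> limit_set G \<and>
      a \<noteq> b \<and> a \<noteq> c \<and> b \<noteq> c)"

text \<open>Totally geodesic: contains the (unique) geodesic segment between any two of its points.\<close>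
definition totally_geodesic :: "qvec set set \<Rightarrow> bool" where
  "totally_geodesic M \<longleftrightarrow> M \<subseteq> HH2 \<and>
     (\<forall>x\<in>M. \<forall>y\<in>M. \<forall>z\<in>HH2. distHH x z + distHH z y = distHH x y \<longrightarrow> z \<in> M)"

definition rform :: "real^3 \<Rightarrow> real^3 \<Rightarrow> real" where
  "rform v w = v$0 * w$0 + v$1 * w$1 - v$2 * w$2"

definition HR2 :: "(real^3) set set" where
  "HR2 = {range (\<lambda>c. c *\<^sub>R v) | v. rform v v < 0}"

definition distHR :: "(real^3) set \<Rightarrow> (real^3) set \<Rightarrow> real" where
  "distHR L M = (let v = rep L; w = rep M in
     hypdist_of ((rform v w)\<^sup>2 / (rform v v * rform w w)))"

definition cform :: "complex^2 \<Rightarrow> complex^2 \<Rightarrow> complex" where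
  "cform v w = cnj (v$0) * w$0 - cnj (v$1) * w$1"

definition HC1 :: "(complex^2) set set" where
  "HC1 = {range (\<lambda>c. v * (\<chi> i. c)) | v. Re (cform v v) < 0}"

definition distHC :: "(complex^2) set \<Rightarrow> (complex^2) set \<Rightarrow> real" where
  "distHC L M = (let v = rep L; w = rep M in
     hypdist_of ((cmod (cform v w))\<^sup>2 / (Re (cform v v) * Re (cform w w))))"

definition isometric_to :: "'a set \<Rightarrow> ('a \<Rightarrow> 'a \<Rightarrow> real) \<Rightarrow> 'b set \<Rightarrow> ('b \<Rightarrow> 'b \<Rightarrow> real) \<Rightarrow> bool" where
  "isometric_to A dA B dB \<longleftrightarrow> (\<exists>f. bij_betw f A B \<and> (\<forall>x\<in>A. \<forall>y\<in>A. dB (f x) (f y) = dA x y))"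

end

(*
  Let A be the real span of Gamma, an algebra closed under the adjoint of the Hermitian form, on which
  the trace is real. Rescaled divergent sequences in Gamma converge to rank-one operators w |-> x<y,w>
  in A with x, y isotropic, and the lines xH that occur are the limit points. Since Gamma is discrete
  with at least three limit points it fixes no isotropic line, so for any two limit vectors x, y some
  operator x d <y, . > with d /= 0 lies in A. Fix limit vectors x1, x2 with <x1,x2> = 1. The set D of
  all d with x1 d <x2, . > in A is a real subalgebra of H, hence R, a copy of C, or H.
  For quaternions q (as left multiplications), reality of the trace on A says Re <y, q x> = 0 whenever
  q is imaginary and x<y, . > lies in A. This excludes D = H, the spinorial case where A restricts to
  x1 H + x2 H as SL(2,C), and D = C for irreducible Gamma; the last two because the relation ij = k
  between left multiplications fails. What remains is an invariant complex plane x1 C + x2 C, or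
  a real 3-space on which the form is real.
*)
theory Submission
  imports Defs
begin

section \<open>Quaternions and quaternionic matrices\<close>

text \<open>The trace of a quaternionic matrix is not invariant under conjugation, so the group
  cannot first be moved into a convenient position: the frame of limit vectors sits in the given
  coordinates in an unknown way. Only the real part of a product is cyclic. The maps x |-> q x on
  columns commute with right scalars, hence are H-linear operators, and reality of the trace says
  that those with q = i, j, k are orthogonal to the whole algebra for the real trace pairing. When D
  is a copy of C, this places their entries in the frame in one of the two halves of H, commuting or
  anticommuting with D, while computing k as the product of i and j places them in the other half.
  The set D records only the operators x1 d <x2, . >. The coefficients of x1 e1 <x1, . > and x2 e2
  <x2, . > are additional data, tied to D only through products such as
  \<open>e1 \<odot> e2\<close>. Deciding whether they lie in D, commute with it or anticommute with
  it is what separates the cases.\<close>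

lemma UNIV4: "(UNIV::4 set) = {0,1,2,3}"
proof -
  have "(4::4) = 0" by simp
  then show ?thesis using UNIV_4 by auto
qed

lemma UNIV3: "(UNIV::3 set) = {0,1,2}"
proof -
  have "(3::3) = 0" by simp
  then show ?thesis using UNIV_3 by auto
qed

lemma all4: "(\<forall>i::4. P i) \<longleftrightarrow> P 0 \<and> P 1 \<and> P 2 \<and> P 3"
  using UNIV4 by (metis UNIV_I insertE singletonD)

lemma all3: "(\<forall>i::3. P i) \<longleftrightarrow> P 0 \<and> P 1 \<and> P 2"
  using UNIV3 by (metis UNIV_I insertE singletonD)

lemma sum4: "sum f (UNIV::4 set) = f 0 + f 1 + f 2 + f 3"
  unfolding UNIV4 by (simp add: add.assoc)

lemma sum3: "sum f (UNIV::3 set) = f 0 + f 1 + f 2"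
  unfolding UNIV3 by (simp add: add.assoc)

lemma quat_eq_iff: "(a::quat) = b \<longleftrightarrow> a$0 = b$0 \<and> a$1 = b$1 \<and> a$2 = b$2 \<and> a$3 = b$3"
  by (simp add: vec_eq_iff all4)

lemma qvec_eq_iff: "(x::qvec) = y \<longleftrightarrow> (\<forall>i. x$i = y$i)"
  by (rule vec_eq_iff)

lemma qmat_eq_iff: "(A::qmat) = B \<longleftrightarrow> (\<forall>i j. A$i$j = B$i$j)"
  by (simp add: vec_eq_iff)

lemma qmul_nth [simp]:
  "qmul a b $ 0 = a$0*b$0 - a$1*b$1 - a$2*b$2 - a$3*b$3"
  "qmul a b $ 1 = a$0*b$1 + a$1*b$0 + a$2*b$3 - a$3*b$2"
  "qmul a b $ 2 = a$0*b$2 - a$1*b$3 + a$2*b$0 + a$3*b$1"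
  "qmul a b $ 3 = a$0*b$3 + a$1*b$2 - a$2*b$1 + a$3*b$0"
  by (simp_all add: qmul_def)

lemma qcnj_nth [simp]: "qcnj a $ 0 = a$0" "qcnj a $ 1 = - a$1" "qcnj a $ 2 = - a$2" "qcnj a $ 3 = - a$3"
  by (simp_all add: qcnj_def)

lemma qreal_nth [simp]: "qreal r $ 0 = r" "qreal r $ 1 = 0" "qreal r $ 2 = 0" "qreal r $ 3 = 0"
  by (simp_all add: qreal_def)

lemma norm_quat_sq: "(norm (a::quat))\<^sup>2 = (a$0)\<^sup>2 + (a$1)\<^sup>2 + (a$2)\<^sup>2 + (a$3)\<^sup>2"
  by (simp add: norm_vec_def L2_set_def sum4 sum_nonneg)

text \<open>Euler's four-square identity, a polynomial identity in eight real variables; both norms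
  are nonnegative, so square roots may be taken.\<close>

lemma norm_qmul: "norm (qmul a b) = norm a * norm b"
proof -
  have "(norm (qmul a b))\<^sup>2 = (norm a * norm b)\<^sup>2"
    unfolding power_mult_distrib norm_quat_sq qmul_nth by algebra
  then show ?thesis by (simp add: power2_eq_iff_nonneg)
qed

lemma bounded_bilinear_qmul: "bounded_bilinear qmul"
proof
  show "\<exists>K. \<forall>a b. norm (qmul a b) \<le> norm a * norm b * K"
    by (rule exI[of _ 1]) (simp add: norm_qmul)
qed (simp_all add: quat_eq_iff algebra_simps)

interpretation qmul: bounded_bilinear qmul by (rule bounded_bilinear_qmul)

notation qmul (infixl "\<odot>" 70)
notation qscal (infixl "\<triangleleft>" 75)
notation qmat_vec (infixr "\<triangleright>" 76)
notation qmat_mult (infixl "\<otimes>" 77)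

lemma qmul_assoc: "a \<odot> b \<odot> c = a \<odot> (b \<odot> c)"
  by (simp add: quat_eq_iff algebra_simps)

lemma qmul_qreal [simp]: "qreal r \<odot> x = r *\<^sub>R x" "x \<odot> qreal r = r *\<^sub>R x"
  by (simp_all add: quat_eq_iff)

lemma qcnj_simps [simp]: "qcnj (qcnj a) = a" "qcnj (a + b) = qcnj a + qcnj b" "qcnj (a - b) = qcnj a - qcnj b"
  "qcnj (- a) = - qcnj a" "qcnj (r *\<^sub>R a) = r *\<^sub>R qcnj a" "qcnj 0 = 0" "qcnj (qreal r) = qreal r"
  by (simp_all add: quat_eq_iff)

lemma qcnj_qmul [simp]: "qcnj (a \<odot> b) = qcnj b \<odot> qcnj a"
  by (simp add: quat_eq_iff algebra_simps)

lemma qcnj_mult_self: "qcnj a \<odot> a = qreal ((norm a)\<^sup>2)" "a \<odot> qcnj a = qreal ((norm a)\<^sup>2)"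
  unfolding norm_quat_sq by (simp_all add: quat_eq_iff power2_eq_square algebra_simps)

lemma norm_qcnj [simp]: "norm (qcnj a) = norm a"
proof -
  have "(norm (qcnj a))\<^sup>2 = (norm a)\<^sup>2" by (simp add: norm_quat_sq)
  then show ?thesis by (simp add: power2_eq_iff_nonneg)
qed

lemma qcnj_eq_0 [simp]: "qcnj a = 0 \<longleftrightarrow> a = 0"
  by (metis norm_eq_zero norm_qcnj)

lemma qmul_eq_0 [simp]: "a \<odot> b = 0 \<longleftrightarrow> a = 0 \<or> b = 0"
  by (metis norm_qmul mult_eq_0_iff norm_eq_zero)

lemma qinv_right: "a \<noteq> 0 \<Longrightarrow> a \<odot> qinv a = qreal 1"
  by (simp add: qinv_def qmul.scaleR_right qcnj_mult_self) (simp add: quat_eq_iff)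

lemma qinv_left: "a \<noteq> 0 \<Longrightarrow> qinv a \<odot> a = qreal 1"
  by (simp add: qinv_def qmul.scaleR_left qcnj_mult_self) (simp add: quat_eq_iff)

lemma qinv_eq_0 [simp]: "qinv a = 0 \<longleftrightarrow> a = 0"
  by (auto simp: qinv_def)

lemma norm_qreal [simp]: "norm (qreal r) = \<bar>r\<bar>"
proof -
  have "(norm (qreal r))\<^sup>2 = \<bar>r\<bar>\<^sup>2" by (simp add: norm_quat_sq)
  then show ?thesis by (metis abs_ge_zero norm_ge_zero power2_eq_iff_nonneg)
qed

lemma qreal_simps [simp]: "qreal 0 = 0" "qreal a = qreal b \<longleftrightarrow> a = b" "qreal a + qreal b = qreal (a + b)"
   "- qreal a = qreal (- a)" "r *\<^sub>R qreal a = qreal (r * a)" "qreal a - qreal b = qreal (a - b)"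
   "qreal a = 0 \<longleftrightarrow> a = 0"
  by (simp_all add: quat_eq_iff)

lemma norm_qinv: "norm (qinv a) = inverse (norm a)"
  by (cases "a = 0") (simp_all add: qinv_def power2_eq_square field_simps)

text \<open>The diagonal of \<open>I21\<close> as real signs, so that the form and its adjoint
  become uniform sums over the index type.\<close>

definition sg :: "3 \<Rightarrow> real" where "sg i = (if i = 2 then - 1 else 1)"

lemma sg_simps [simp]: "sg 0 = 1" "sg 1 = 1" "sg 2 = -1" "sg i * sg i = 1" "sg i * (sg i * x) = x"
  "sg i * sg j * (sg i * sg j) = 1"
  by (auto simp: sg_def)

section \<open>The indefinite Hermitian form, its adjoint and rank-one operators\<close>

lemma herm_sum: "herm v w = (\<Sum>i\<in>UNIV. sg i *\<^sub>R (qcnj (v$i) \<odot> w$i))"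
  by (simp add: herm_def sum3)

lemma bilinear_herm: "bilinear herm"
  unfolding bilinear_def
  by (auto intro!: linearI simp: herm_def qmul.add_left qmul.add_right qmul.scaleR_left qmul.scaleR_right algebra_simps)

interpretation herm: bounded_bilinear herm
  using bilinear_herm bilinear_conv_bounded_bilinear by blast

lemma herm_cnj: "qcnj (herm v w) = herm w v"
  by (simp add: herm_def)

lemma herm_scal [simp]: "herm v (w \<triangleleft> l) = herm v w \<odot> l" "herm (v \<triangleleft> l) w = qcnj l \<odot> herm v w"
  by (simp_all add: herm_def qscal_def qmul_assoc qmul.add_left qmul.add_right qmul.diff_left qmul.diff_right)

lemma herm_self: "herm v v = qreal ((norm (v$0))\<^sup>2 + (norm (v$1))\<^sup>2 - (norm (v$2))\<^sup>2)"
  by (simp add: herm_def qcnj_mult_self)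

lemma qscal_nth [simp]: "(v \<triangleleft> l) $ i = v $ i \<odot> l" by (simp add: qscal_def)

lemma bilinear_qscal: "bilinear qscal"
  unfolding bilinear_def
  by (auto intro!: linearI simp: qvec_eq_iff qmul.add_left qmul.add_right qmul.scaleR_left qmul.scaleR_right)

interpretation qscal: bounded_bilinear qscal
  using bilinear_qscal bilinear_conv_bounded_bilinear by blast

lemma qscal_assoc: "v \<triangleleft> a \<triangleleft> b = v \<triangleleft> (a \<odot> b)"
  by (simp add: qvec_eq_iff qmul_assoc)

lemma qscal_qreal [simp]: "v \<triangleleft> qreal r = r *\<^sub>R v"
  by (simp add: qvec_eq_iff)

lemma norm_qscal: "norm (v \<triangleleft> l) = norm v * norm l"
  by (simp add: norm_vec_def[of v] norm_vec_def[of "v \<triangleleft> l"] norm_qmul L2_set_left_distrib)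

lemma qscal_eq_0 [simp]: "v \<triangleleft> l = 0 \<longleftrightarrow> v = 0 \<or> l = 0"
  by (metis norm_qscal mult_eq_0_iff norm_eq_zero)

lemma bilinear_qmat_vec: "bilinear qmat_vec"
  unfolding bilinear_def
  by (auto intro!: linearI simp: qvec_eq_iff qmat_vec_def qmul.add_left qmul.add_right qmul.scaleR_left qmul.scaleR_right sum.distrib scaleR_sum_right)

interpretation qmat_vec: bounded_bilinear qmat_vec
  using bilinear_qmat_vec bilinear_conv_bounded_bilinear by blast

lemma qmat_vec_scal [simp]: "A \<triangleright> (v \<triangleleft> l) = (A \<triangleright> v) \<triangleleft> l"
  by (simp add: qvec_eq_iff qmat_vec_def qmul_assoc qmul.sum_left)

lemma qmat_vec_assoc: "(A \<otimes> B) \<triangleright> v = A \<triangleright> B \<triangleright> v"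
  apply (simp add: qvec_eq_iff qmat_vec_def qmat_mult_def qmul_assoc qmul.sum_left qmul.sum_right)
  by (subst sum.swap) simp

lemma qmat_vec_axis: "(A \<triangleright> axis j (qreal 1)) $ i = A $ i $ j"
proof -
  have "A$i$k \<odot> (if k = j then qreal 1 else 0) = (if k = j then A$i$k else 0)" for k
    by (simp add: qmul.zero_right)
  then show ?thesis by (simp add: qmat_vec_def axis_def)
qed

lemma qmat_eqI: "(\<And>v. A \<triangleright> v = B \<triangleright> v) \<Longrightarrow> A = B"
  by (simp add: qmat_eq_iff) (metis qmat_vec_axis)

lemma bilinear_qmat_mult: "bilinear qmat_mult"
  unfolding bilinear_def
  by (auto intro!: linearI qmat_eqI simp: qmat_vec_assoc qmat_vec.add_left qmat_vec.add_right qmat_vec.scaleR_left qmat_vec.scaleR_right)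

interpretation qmat_mult: bounded_bilinear qmat_mult
  using bilinear_qmat_mult bilinear_conv_bounded_bilinear by blast

lemma qmat_id_vec [simp]: "qmat_id \<triangleright> v = v"
proof -
  have "(if i = k then qreal 1 else 0) \<odot> v$k = (if i = k then v$k else 0)" for i k
    by (simp add: qmul.zero_left)
  then show ?thesis by (simp add: qvec_eq_iff qmat_vec_def qmat_id_def)
qed

lemma qmat_mult_assoc: "A \<otimes> B \<otimes> C = A \<otimes> (B \<otimes> C)"
  by (rule qmat_eqI) (simp add: qmat_vec_assoc)

lemma qmat_id_mult [simp]: "qmat_id \<otimes> A = A" "A \<otimes> qmat_id = A"
  by (auto intro!: qmat_eqI simp: qmat_vec_assoc)

text \<open>The conjugate transpose conjugated by \<open>I21\<close>, that is, the adjoint for the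
  indefinite form; on \<open>Sp21\<close> it is the inverse.\<close>

definition qdag :: "qmat \<Rightarrow> qmat" where
  "qdag A = (\<chi> i j. (sg i * sg j) *\<^sub>R qcnj (A$j$i))"

lemma linear_qdag: "linear qdag"
  by (auto intro!: linearI simp: qdag_def qmat_eq_iff algebra_simps)

lemma qcnj_sum: "qcnj (sum f S) = (\<Sum>i\<in>S. qcnj (f i))"
  by (induction S rule: infinite_finite_induct) auto

lemma herm_qdag: "herm (A \<triangleright> v) w = herm v (qdag A \<triangleright> w)"
  apply (simp add: herm_sum qmat_vec_def qdag_def qcnj_sum qmul.sum_left qmul.sum_right scaleR_sum_right
     qmul.scaleR_left qmul.scaleR_right qmul_assoc)
  by (subst sum.swap) (simp add: mult.commute)

lemma herm_nondeg: "(\<And>v. herm v x = herm v y) \<Longrightarrow> x = y"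
proof -
  assume a: "\<And>v. herm v x = herm v y"
  have "x $ i = y $ i" for i
  proof -
    have "herm (axis i (qreal 1)) z = sg i *\<^sub>R z $ i" for z
    proof -
      have "sg k *\<^sub>R (qcnj (axis i (qreal 1) $ k) \<odot> z $ k) = (if k = i then sg i *\<^sub>R z$i else 0)" for k
        by (simp add: axis_def qmul.zero_left)
      then show ?thesis by (simp add: herm_sum)
    qed
    then show ?thesis using a[of "axis i (qreal 1)"] by (simp add: sg_def split: if_splits)
  qed
  then show ?thesis by (simp add: qvec_eq_iff)
qed

lemma qdag_qdag [simp]: "qdag (qdag A) = A"
  by (simp add: qdag_def qmat_eq_iff mult.commute)

text \<open>The defining equation of \<open>Sp21\<close>, multiplied by \<open>I21\<close>, yields a
  left inverse only; the two-sided inverse supplied by \<open>GL3H\<close> has to coincide with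
  it.\<close>

lemma Sp21_qdag:
  assumes "A \<in> Sp21"
  shows "qdag A \<otimes> A = qmat_id" "A \<otimes> qdag A = qmat_id"
proof -
  have e: "qmat_mult (qmat_adj A) (qmat_mult I21 A) = I21" and "A \<in> GL3H" using assms by (auto simp: Sp21_def)
  then obtain B where B: "A \<otimes> B = qmat_id" "B \<otimes> A = qmat_id" by (auto simp: GL3H_def)
  have i: "I21 \<otimes> A = (\<chi> k j. sg k *\<^sub>R A$k$j)"
  proof -
    have "I21 $ i $ k = (if i = k then qreal (sg i) else 0)" for i k by (simp add: I21_def sg_def)
    then have "I21 $ i $ k \<odot> A$k$j = (if i = k then sg i *\<^sub>R A$i$j else 0)" for i j k
      by (simp add: qmul.zero_left)
    then show ?thesis by (simp add: qmat_mult_def qmat_eq_iff)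
  qed
  have "qdag A \<otimes> A = (\<chi> i j. sg i *\<^sub>R (qmat_mult (qmat_adj A) (qmat_mult I21 A)) $ i $ j)"
    unfolding i by (simp add: qmat_mult_def qdag_def qmat_adj_def scaleR_sum_right qmul.scaleR_left qmul.scaleR_right)
  also have "\<dots> = qmat_id" unfolding e by (simp add: I21_def qmat_id_def sg_def qmat_eq_iff)
  finally show 1: "qdag A \<otimes> A = qmat_id" .
  have "qdag A = B" using 1 B by (metis qmat_mult_assoc qmat_id_mult)
  then show "A \<otimes> qdag A = qmat_id" using B by simp
qed

lemma Sp21_herm [simp]: "A \<in> Sp21 \<Longrightarrow> herm (A \<triangleright> v) (A \<triangleright> w) = herm v w"
  by (simp add: herm_qdag flip: qmat_vec_assoc) (simp add: Sp21_qdag)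

text \<open>The operator w |-> x <y, w> as a matrix: x times the conjugate transpose of y times
  \<open>I21\<close>, whence the sign \<open>sg j\<close>.\<close>

definition outer :: "qvec \<Rightarrow> qvec \<Rightarrow> qmat" where
  "outer x y = (\<chi> i j. sg j *\<^sub>R (x$i \<odot> qcnj (y$j)))"

lemma outer_vec [simp]: "outer x y \<triangleright> w = x \<triangleleft> herm y w"
  by (simp add: outer_def qmat_vec_def herm_sum qvec_eq_iff qmul.sum_right qmul.scaleR_left qmul.scaleR_right qmul_assoc)

lemma qmat_mult_outer: "A \<otimes> outer x y = outer (A \<triangleright> x) y" "outer x y \<otimes> A = outer x (qdag A \<triangleright> y)"
  by (auto intro!: qmat_eqI simp: qmat_vec_assoc herm_qdag)

lemma outer_scal: "outer x (y \<triangleleft> l) = outer (x \<triangleleft> qcnj l) y"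
  by (auto intro!: qmat_eqI simp: qscal_assoc)

lemma outer_outer: "outer x y \<otimes> outer z w = outer (x \<triangleleft> herm y z) w"
  by (auto intro!: qmat_eqI simp: qmat_vec_assoc qscal_assoc)

lemma qdag_outer [simp]: "qdag (outer x y) = outer y x"
  by (simp add: qdag_def outer_def qmat_eq_iff)

text \<open>Since it commutes with right scalars, this is an H-linear operator, although not itself
  a right scaling. These operators are the test elements for the trace.\<close>

definition lmul :: "quat \<Rightarrow> qvec \<Rightarrow> qvec" where "lmul q x = (\<chi> i. q \<odot> x$i)"

lemma Re_qmul_commute: "(a \<odot> b) $ 0 = (b \<odot> a) $ 0" by simp

text \<open>Factors of a summand can be rotated only under the real part. Inserting q before that
  part is taken gives access to every component of the trace.\<close>

lemma Re_trace_outer: "(q \<odot> qmat_trace (outer x y)) $ 0 = herm y (lmul q x) $ 0"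
proof -
  have "(q \<odot> (x$i \<odot> qcnj (y$i))) $ 0 = (qcnj (y$i) \<odot> (q \<odot> x$i)) $ 0" for i
    using Re_qmul_commute[of "q \<odot> x$i"] by (simp only: qmul_assoc)
  then show ?thesis
    by (simp only: qmat_trace_def outer_def herm_sum lmul_def vec_lambda_beta qmul.sum_right sum_component
        qmul.scaleR_right vector_scaleR_component)
qed

lemma lmul_scal: "lmul q (x \<triangleleft> l) = lmul q x \<triangleleft> l"
  by (simp add: lmul_def qvec_eq_iff qmul_assoc)

lemma lmul_lmul: "lmul p (lmul q x) = lmul (p \<odot> q) x"
  by (simp add: lmul_def qvec_eq_iff qmul_assoc)

lemma lmul_eq_0: "lmul q x = 0 \<longleftrightarrow> q = 0 \<or> x = 0"
  by (auto simp: lmul_def qvec_eq_iff)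

lemma herm_lmul: "herm (lmul q x) y = herm x (lmul (qcnj q) y)"
  by (simp add: herm_def lmul_def qmul_assoc)

section \<open>Isotropic vectors, discreteness and limit points\<close>

lemma qvec_eq_0_iff: "(x::qvec) = 0 \<longleftrightarrow> x$0 = 0 \<and> x$1 = 0 \<and> x$2 = 0"
  by (simp add: qvec_eq_iff all3)

lemma norm_qvec_sq: "(norm (x::qvec))\<^sup>2 = (norm (x$0))\<^sup>2 + (norm (x$1))\<^sup>2 + (norm (x$2))\<^sup>2"
  by (simp add: norm_vec_def[of x] L2_set_def sum3 sum_nonneg)

lemma herm_self_qreal: "herm v v = qreal (herm v v $ 0)"
  by (simp add: herm_self)

lemma herm_self_eq_0: "herm v v = 0 \<longleftrightarrow> herm v v $ 0 = 0"
  by (metis herm_self_qreal qreal_simps(1) qreal_nth(1))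

lemma herm_eq_0_commute: "herm v w = 0 \<longleftrightarrow> herm w v = 0"
  by (metis herm_cnj qcnj_eq_0)

lemma norm_herm_commute: "norm (herm v w) = norm (herm w v)"
  by (metis herm_cnj norm_qcnj)

lemma exists_herm_dual:
  assumes "x \<noteq> 0" shows "\<exists>z. herm z x = qreal 1"
proof -
  obtain v where v: "herm v x \<noteq> 0" using herm_nondeg[of x 0] assms by (auto simp: herm.zero_right)
  have "herm (v \<triangleleft> qcnj (qinv (herm v x))) x = qreal 1" using v by (simp add: qinv_left)
  then show ?thesis by blast
qed

text \<open>Quantitative positivity on the orthogonal complement of a negative vector. The factor
  depends on y only through its norm and its form value, so the bound is uniform over images of y
  under isometries as long as they stay bounded.\<close>

lemma herm_neg_perp:
  assumes "herm y y $ 0 < 0" "herm y x = 0"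
  shows "(norm x)\<^sup>2 \<le> 2 * (norm y)\<^sup>2 / (- (herm y y $ 0)) * (herm x x $ 0)"
proof -
  define c where "c = - (herm y y $ 0)"
  define r where "r = (norm (y$0))\<^sup>2 + (norm (y$1))\<^sup>2"
  define s where "s = (norm (x$0))\<^sup>2 + (norm (x$1))\<^sup>2"
  define Y where "Y = (norm (y$2))\<^sup>2"
  define X where "X = (norm (x$2))\<^sup>2"
  have c: "c > 0" and Y: "Y = r + c" using assms by (auto simp: c_def herm_self r_def Y_def)
  have r0: "r \<ge> 0" "s \<ge> 0" "X \<ge> 0" by (auto simp: r_def s_def X_def)
  \<comment> \<open>Orthogonality isolates the third coordinates; Cauchy-Schwarz in the two positive
    directions then bounds their product.\<close>
  have "qcnj (y$2) \<odot> x$2 = qcnj (y$0) \<odot> x$0 + qcnj (y$1) \<odot> x$1"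
    using assms(2) by (simp add: herm_def)
  then have "norm (y$2) * norm (x$2) \<le> norm (y$0) * norm (x$0) + norm (y$1) * norm (x$1)"
    by (metis norm_qmul norm_qcnj norm_triangle_ineq)
  then have "(norm (y$2) * norm (x$2))\<^sup>2 \<le> (norm (y$0) * norm (x$0) + norm (y$1) * norm (x$1))\<^sup>2"
    by (intro power_mono) auto
  also have "\<dots> \<le> r * s"
  proof -
    have "r * s - (norm (y$0) * norm (x$0) + norm (y$1) * norm (x$1))\<^sup>2 = (norm (y$0) * norm (x$1) - norm (y$1) * norm (x$0))\<^sup>2"
      unfolding r_def s_def by algebra
    then show ?thesis by (smt (verit) zero_le_power2)
  qed
  finally have k: "Y * X \<le> r * s" by (simp add: Y_def X_def power_mult_distrib)
  have hx: "herm x x $ 0 = s - X" by (simp add: herm_self s_def X_def)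
  have "Y > 0" using Y c r0 by auto
  \<comment> \<open>Substituting r = Y - c in Y X \<le> r s turns Cauchy-Schwarz into a lower bound
    for the form value s - X.\<close>
  have Q: "c * s \<le> Y * (s - X)" using k Y by (simp add: algebra_simps)
  have "s - X \<ge> 0" using Q c r0 \<open>Y > 0\<close> by (smt (verit) mult_nonneg_nonneg zero_le_mult_iff)
  have "(norm x)\<^sup>2 \<le> 2 * s" using \<open>s - X \<ge> 0\<close> by (simp add: norm_qvec_sq s_def X_def)
  also have "\<dots> \<le> 2 * (Y * (s - X) / c)" using Q c by (simp add: field_simps)
  also have "\<dots> \<le> 2 * ((norm y)\<^sup>2 * (s - X) / c)"
    using c \<open>s - X \<ge> 0\<close> by (intro mult_left_mono divide_right_mono mult_right_mono) (auto simp: norm_qvec_sq Y_def)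
  finally show ?thesis unfolding hx c_def[symmetric] by simp
qed

lemma herm_neg_perp_nonneg:
  assumes "herm y y $ 0 < 0" "herm y x = 0"
  shows "herm x x $ 0 \<ge> 0" "herm x x $ 0 = 0 \<Longrightarrow> x = 0"
proof -
  have y: "norm y \<noteq> 0" using assms(1) by (auto simp: herm.zero_left)
  have p: "2 * (norm y)\<^sup>2 / (- (herm y y $ 0)) > 0" using assms(1) y by (intro divide_pos_pos) auto
  have "0 \<le> 2 * (norm y)\<^sup>2 / (- (herm y y $ 0)) * (herm x x $ 0)"
    using herm_neg_perp[OF assms] by (smt (verit) zero_le_power2)
  then show "herm x x $ 0 \<ge> 0" using p by (smt (verit) mult_pos_neg)
  show "herm x x $ 0 = 0 \<Longrightarrow> x = 0" using herm_neg_perp[OF assms] by simp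
qed

text \<open>There is only one negative direction: a multiple of x cancels the third coordinate of y,
  and the remainder is isotropic in the positive definite part, hence zero.\<close>

lemma isotropic_perp_parallel:
  assumes "herm x x = 0" "herm y y = 0" "herm x y = 0" "x \<noteq> 0"
  shows "\<exists>l. y = x \<triangleleft> l"
proof -
  have x2: "x$2 \<noteq> 0"
  proof
    assume "x$2 = 0"
    then have "(norm (x$0))\<^sup>2 + (norm (x$1))\<^sup>2 = 0" using assms(1) by (simp add: herm_self)
    then show False using \<open>x$2 = 0\<close> assms(4) by (simp add: qvec_eq_0_iff add_nonneg_eq_0_iff)
  qed
  define l where "l = qinv (x$2) \<odot> y$2"
  define z where "z = y - x \<triangleleft> l"
  have "z$2 = 0" using x2 by (simp add: z_def l_def qinv_right flip: qmul_assoc)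
  have "herm y x = 0" using assms(3) herm_eq_0_commute by blast
  then have "herm z z = 0" using assms by (simp add: z_def herm.diff_left herm.diff_right qmul.zero_left qmul.zero_right)
  then have "(norm (z$0))\<^sup>2 + (norm (z$1))\<^sup>2 = 0" using \<open>z$2 = 0\<close> by (simp add: herm_self)
  then have "z = 0" using \<open>z$2 = 0\<close> by (simp add: qvec_eq_0_iff add_nonneg_eq_0_iff)
  then show ?thesis by (auto simp: z_def)
qed

lemma qline_scal: "l \<noteq> 0 \<Longrightarrow> qline (v \<triangleleft> l) = qline v"
proof -
  assume l: "l \<noteq> 0"
  have "v \<triangleleft> m = v \<triangleleft> l \<triangleleft> (qinv l \<odot> m)" for m
    using l by (simp add: qscal_assoc qinv_right flip: qmul_assoc)
  then show ?thesis by (auto simp: qline_def qscal_assoc)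
qed

lemma qline_eq_iff: "w \<noteq> 0 \<Longrightarrow> qline v = qline w \<longleftrightarrow> (\<exists>l. w = v \<triangleleft> l)"
proof
  assume "w \<noteq> 0" "qline v = qline w"
  have "w \<in> qline w" unfolding qline_def by (rule range_eqI[of _ _ "qreal 1"]) simp
  then show "\<exists>l. w = v \<triangleleft> l" using \<open>qline v = qline w\<close> by (auto simp: qline_def)
next
  assume "w \<noteq> 0" "\<exists>l. w = v \<triangleleft> l"
  then show "qline v = qline w" using qline_scal by (metis qscal_eq_0)
qed

lemma qact_qline: "qact g (qline v) = qline (g \<triangleright> v)"
  by (auto simp: qact_def qline_def image_image)

lemma qmat_norm_le: "norm (A::qmat) \<le> (\<Sum>i\<in>UNIV. \<Sum>j\<in>UNIV. norm (A$i$j))"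
proof -
  have "norm A \<le> (\<Sum>i\<in>UNIV. norm (A$i))" unfolding norm_vec_def[of A] by (rule L2_set_le_sum) auto
  also have "\<dots> \<le> (\<Sum>i\<in>UNIV. \<Sum>j\<in>UNIV. norm (A$i$j))"
  proof (rule sum_mono)
    fix i show "norm (A$i) \<le> (\<Sum>j\<in>UNIV. norm (A$i$j))"
      unfolding norm_vec_def[of "A$i"] by (rule L2_set_le_sum) auto
  qed
  finally show ?thesis .
qed

section \<open>Bounded subsets of a discrete group\<close>

lemma qmat_pointwise_bounded:
  assumes "\<And>w. \<exists>B. \<forall>A\<in>S. norm (A \<triangleright> w) \<le> B"
  shows "bounded S"
proof -
  obtain B where B: "\<And>w A. A \<in> S \<Longrightarrow> norm (A \<triangleright> w) \<le> B w" using assms by metis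
  have "norm A \<le> (\<Sum>i\<in>(UNIV::3 set). \<Sum>j\<in>UNIV. B (axis j (qreal 1)))" if "A \<in> S" for A
  proof -
    have "norm (A$i$j) \<le> B (axis j (qreal 1))" for i j
      using B[OF that, of "axis j (qreal 1)"] Finite_Cartesian_Product.norm_nth_le[of "A \<triangleright> axis j (qreal 1)" i]
      by (simp add: qmat_vec_axis)
    then show ?thesis using qmat_norm_le[of A] by (smt (verit) sum_mono)
  qed
  then show ?thesis unfolding bounded_iff by blast
qed

lemma islimpt_two_points:
  fixes x :: "'a::metric_space"
  assumes "x islimpt S" "e > 0"
  shows "\<exists>g\<in>S. \<exists>h\<in>S. g \<noteq> h \<and> dist g h < e"
proof -
  obtain g where g: "g \<in> S" "g \<noteq> x" "dist g x < e/2"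
    using assms by (meson half_gt_zero islimpt_approachable)
  obtain h where h: "h \<in> S" "h \<noteq> x" "dist h x < min (e/2) (dist g x)"
    using assms(1) g by (metis islimpt_approachable half_gt_zero min_less_iff_conj zero_less_dist_iff assms(2))
  have "dist g h < e" using g h by (smt (verit) dist_commute dist_triangle_half_r)
  moreover have "g \<noteq> h" using h by auto
  ultimately show ?thesis using g h by blast
qed

lemma subgroup_qdag:
  assumes "is_subgroup_Sp21 G" "A \<in> G" shows "qdag A \<in> G"
proof -
  obtain B where B: "B \<in> G" "A \<otimes> B = qmat_id" "B \<otimes> A = qmat_id" and "A \<in> Sp21"
    using assms unfolding is_subgroup_Sp21_def by blast
  have "qdag A = B" using Sp21_qdag[OF \<open>A \<in> Sp21\<close>] B by (metis qmat_mult_assoc qmat_id_mult)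
  then show ?thesis using B by simp
qed

lemma bounded_linear_qdag: "bounded_linear qdag"
  using linear_qdag linear_conv_bounded_linear by blast

text \<open>Discreteness isolates the points of G but does not say that G is closed, so accumulation
  at a matrix outside G must be excluded as well. Two close elements g, h of S make
  \<open>qdag g \<otimes> h\<close> close to the identity, and it is the identity that is
  isolated.\<close>

lemma discrete_bounded_finite:
  assumes "discrete_subgroup_Sp21 G" "S \<subseteq> G" "bounded S"
  shows "finite S"
proof (rule ccontr)
  assume "infinite S"
  then obtain x where x: "x islimpt S" using assms(3) bounded_infinite_imp_islimpt by blast
  have G: "is_subgroup_Sp21 G" "discrete G" using assms(1) by (auto simp: discrete_subgroup_Sp21_def)
  have "qmat_id \<in> G" using G by (auto simp: is_subgroup_Sp21_def)
  then obtain e where e: "e > 0" "\<And>y. y \<in> G \<Longrightarrow> dist qmat_id y < e \<Longrightarrow> y = qmat_id"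
    using G(2) by (meson discreteD isolated_in_dist_Ex_iff)
  obtain K where K: "K > 0" "\<And>A B. norm (A \<otimes> B) \<le> norm A * norm B * K" using qmat_mult.pos_bounded by blast
  obtain K' where K': "K' > 0" "\<And>A. norm (qdag A) \<le> norm A * K'" using bounded_linear.pos_bounded[OF bounded_linear_qdag] by blast
  obtain B where B: "B > 0" "\<And>A. A \<in> S \<Longrightarrow> norm A \<le> B" using assms(3) bounded_pos by metis
  have p: "B * K' * K > 0" using K K' B by simp
  \<comment> \<open>B bounds the norm of g, K' is the operator bound of \<open>qdag\<close> and K
    that of the matrix product; together they control
    \<open>qdag g \<otimes> (h - g)\<close>.\<close>
  then obtain g h where gh: "g \<in> S" "h \<in> S" "g \<noteq> h" "dist g h < e / (B * K' * K)"
    using islimpt_two_points[OF x, of "e / (B * K' * K)"] e(1) by auto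
  have gG: "g \<in> G" "h \<in> G" "qdag g \<in> G" "g \<in> Sp21" using gh assms G subgroup_qdag by (auto simp: is_subgroup_Sp21_def)
  have "norm (qdag g \<otimes> (h - g)) \<le> norm (qdag g) * norm (h - g) * K" by (rule K)
  also have "\<dots> \<le> (B * K') * norm (h - g) * K"
    using K'(2)[of g] B(2)[OF gh(1)] K(1) K'(1)
    by (intro mult_right_mono) (auto intro: order_trans mult_right_mono)
  also have "\<dots> < e" using gh(4) p by (simp add: dist_norm norm_minus_commute field_simps)
  finally have "dist qmat_id (qdag g \<otimes> h) < e"
    using Sp21_qdag(1)[OF gG(4)] by (simp add: qmat_mult.diff_right dist_norm norm_minus_commute)
  moreover have "qdag g \<otimes> h \<in> G" using gG G by (auto simp: is_subgroup_Sp21_def)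
  ultimately have "qdag g \<otimes> h = qmat_id" using e by blast
  then have "h = g" using Sp21_qdag(2)[OF gG(4)] by (metis qmat_mult_assoc qmat_id_mult)
  then show False using gh by simp
qed

section \<open>Limits of rescaled group elements and the limit vectors\<close>

locale discrete_group =
  fixes G :: "qmat set"
  assumes disc: "discrete_subgroup_Sp21 G"
begin

lemma grp: "is_subgroup_Sp21 G" using disc by (simp add: discrete_subgroup_Sp21_def)

lemma G_Sp [simp]: "A \<in> G \<Longrightarrow> A \<in> Sp21" using grp by (auto simp: is_subgroup_Sp21_def)

lemma G_id [simp]: "qmat_id \<in> G" using grp by (auto simp: is_subgroup_Sp21_def)

lemma G_mult [simp]: "A \<in> G \<Longrightarrow> B \<in> G \<Longrightarrow> A \<otimes> B \<in> G" using grp by (auto simp: is_subgroup_Sp21_def)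

lemma G_dag [simp]: "A \<in> G \<Longrightarrow> qdag A \<in> G" using grp by (rule subgroup_qdag)

lemma G_dag_vec [simp]: "A \<in> G \<Longrightarrow> qdag A \<triangleright> A \<triangleright> v = v" "A \<in> G \<Longrightarrow> A \<triangleright> qdag A \<triangleright> v = v"
  using Sp21_qdag by (metis G_Sp qmat_vec_assoc qmat_id_vec)+

text \<open>For $c_n \to 0$ the images are isotropic, because \<open>g n\<close> preserves the form.\<close>

definition rescaled_limits :: "qmat set" where
  "rescaled_limits = {T. T \<noteq> 0 \<and> (\<exists>g c. (\<forall>n. g n \<in> G) \<and> c \<longlonglongrightarrow> 0 \<and> (\<lambda>n. c n *\<^sub>R g n) \<longlonglongrightarrow> T)}"

lemma rescaled_limits_I: "T \<noteq> 0 \<Longrightarrow> (\<And>n. g n \<in> G) \<Longrightarrow> c \<longlonglongrightarrow> 0 \<Longrightarrow> (\<lambda>n. c n *\<^sub>R g n) \<longlonglongrightarrow> T \<Longrightarrow> T \<in> rescaled_limits"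
  unfolding rescaled_limits_def by blast

text \<open>A linear subspace of a finite-dimensional space is closed, so limits of real multiples
  of group elements do not leave the span.\<close>

lemma rescaled_limits_span: "T \<in> rescaled_limits \<Longrightarrow> T \<in> span G"
proof -
  assume "T \<in> rescaled_limits"
  then obtain g c where g: "\<And>n. g n \<in> G" "(\<lambda>n. c n *\<^sub>R g n) \<longlonglongrightarrow> T" unfolding rescaled_limits_def by blast
  have "closed (span G)" by (rule closed_subspace) simp
  then show ?thesis using g by (meson closed_sequentially span_base span_scale)
qed

lemma rescaled_limits_dag: "T \<in> rescaled_limits \<Longrightarrow> qdag T \<in> rescaled_limits"
proof -
  assume "T \<in> rescaled_limits"
  then obtain g c where g: "\<And>n. g n \<in> G" "c \<longlonglongrightarrow> 0" "(\<lambda>n. c n *\<^sub>R g n) \<longlonglongrightarrow> T" "T \<noteq> 0" unfolding rescaled_limits_def by blast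
  have "(\<lambda>n. c n *\<^sub>R qdag (g n)) \<longlonglongrightarrow> qdag T" using bounded_linear.tendsto[OF bounded_linear_qdag g(3)] by (simp add: linear_cmul[OF linear_qdag])
  moreover have "qdag T \<noteq> 0" using g(4) by (metis qdag_qdag linear_0[OF linear_qdag])
  ultimately show ?thesis using g by (intro rescaled_limits_I[of _ "\<lambda>n. qdag (g n)" c]) auto
qed

lemma rescaled_limits_mult: "T \<in> rescaled_limits \<Longrightarrow> h \<in> G \<Longrightarrow> h \<otimes> T \<in> rescaled_limits"
proof -
  assume "T \<in> rescaled_limits" and h: "h \<in> G"
  then obtain g c where g: "\<And>n. g n \<in> G" "c \<longlonglongrightarrow> 0" "(\<lambda>n. c n *\<^sub>R g n) \<longlonglongrightarrow> T" "T \<noteq> 0" unfolding rescaled_limits_def by blast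
  have "(\<lambda>n. c n *\<^sub>R (h \<otimes> g n)) \<longlonglongrightarrow> h \<otimes> T" using qmat_mult.tendsto[OF tendsto_const g(3)] by (simp add: qmat_mult.scaleR_right)
  moreover have "h \<otimes> T \<noteq> 0" using g(4) Sp21_qdag(1)[OF G_Sp[OF h]] by (metis qmat_id_mult(1) qmat_mult.zero_right qmat_mult_assoc)
  ultimately show ?thesis using g h by (intro rescaled_limits_I[of _ "\<lambda>n. h \<otimes> g n" c]) auto
qed

lemma rescaled_limits_herm: "T \<in> rescaled_limits \<Longrightarrow> herm (T \<triangleright> v) (T \<triangleright> w) = 0"
proof -
  assume "T \<in> rescaled_limits"
  then obtain g c where g: "\<And>n. g n \<in> G" "c \<longlonglongrightarrow> 0" "(\<lambda>n. c n *\<^sub>R g n) \<longlonglongrightarrow> T" unfolding rescaled_limits_def by blast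
  have "(\<lambda>n. herm ((c n *\<^sub>R g n) \<triangleright> v) ((c n *\<^sub>R g n) \<triangleright> w)) \<longlonglongrightarrow> herm (T \<triangleright> v) (T \<triangleright> w)"
    by (intro herm.tendsto qmat_vec.tendsto g tendsto_const)
  moreover have "(\<lambda>n. herm ((c n *\<^sub>R g n) \<triangleright> v) ((c n *\<^sub>R g n) \<triangleright> w)) = (\<lambda>n. c n *\<^sub>R c n *\<^sub>R herm v w)"
    using g(1) by (simp add: qmat_vec.scaleR_left herm.scaleR_left herm.scaleR_right)
  moreover have "(\<lambda>n. c n *\<^sub>R c n *\<^sub>R herm v w) \<longlonglongrightarrow> 0 *\<^sub>R 0 *\<^sub>R herm v w"
    by (intro tendsto_scaleR g tendsto_const)
  ultimately show ?thesis using LIMSEQ_unique by fastforce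
qed

text \<open>The image of T is totally isotropic, hence a single line, which gives x. The adjoint of
  T is again a rescaled limit, so the same argument shows y to be isotropic.\<close>

lemma rescaled_limits_outer:
  assumes "T \<in> rescaled_limits"
  obtains x y where "x \<noteq> 0" "y \<noteq> 0" "T = outer x y" "herm x x = 0" "herm y y = 0"
proof -
  have "T \<noteq> 0" using assms by (auto simp: rescaled_limits_def)
  then obtain w where w: "T \<triangleright> w \<noteq> 0" by (metis qmat_eqI qmat_vec.zero_left)
  define x where "x = T \<triangleright> w"
  have x: "herm x x = 0" "x \<noteq> 0" using rescaled_limits_herm[OF assms] w by (auto simp: x_def)
  obtain z where z: "herm z x = qreal 1" using exists_herm_dual[OF x(2)] by blast
  \<comment> \<open>Pairing with the vector z dual to x reads off the coefficient l in T v = x l, so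
    the coefficient is <y, v>.\<close>
  define y where "y = qdag T \<triangleright> z"
  have Tv: "T \<triangleright> v = x \<triangleleft> herm y v" for v
  proof -
    obtain l where l: "T \<triangleright> v = x \<triangleleft> l"
      using isotropic_perp_parallel[of x "T \<triangleright> v"] rescaled_limits_herm[OF assms] x by (auto simp: x_def)
    have "herm y v = herm z (T \<triangleright> v)" by (simp add: y_def herm_qdag)
    then show ?thesis using l z by simp
  qed
  have T: "T = outer x y" by (rule qmat_eqI) (simp add: Tv)
  have "y \<noteq> 0" using T w by (auto simp: herm.zero_left qscal.zero_right)
  obtain v where v: "herm v x = qreal 1" using exists_herm_dual x by blast
  then have v': "herm x v = qreal 1" by (metis herm_cnj qcnj_simps(7))
  have "herm (qdag T \<triangleright> v) (qdag T \<triangleright> v) = 0" using rescaled_limits_herm[OF rescaled_limits_dag[OF assms]] .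
  then have "herm y y = 0" unfolding T by (simp add: v')
  then show ?thesis using that T x \<open>y \<noteq> 0\<close> by blast
qed

text \<open>By discreteness an injective sequence meets each norm bound at finitely many indices
  only, so its norms tend to infinity. The normalized matrices subconverge on the unit sphere, and
  the scaling factors, the inverse norms, tend to zero.\<close>

lemma rescaled_limits_sequence:
  fixes g :: "nat \<Rightarrow> qmat"
  assumes "\<And>n. g n \<in> G" "inj g"
  obtains r c T where "strict_mono r" "c \<longlonglongrightarrow> 0" "(\<lambda>n. c n *\<^sub>R g (r n)) \<longlonglongrightarrow> T" "T \<in> rescaled_limits" "\<And>n. c n \<ge> 0"
proof -
  have f: "finite {n. norm (g n) \<le> B}" for B
  proof -
    have "finite (g ` {n. norm (g n) \<le> B})"
      by (rule discrete_bounded_finite[OF disc]) (use assms in \<open>auto simp: bounded_iff\<close>)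
    then show ?thesis using assms(2) by (meson finite_imageD inj_on_subset subset_UNIV)
  qed
  have top: "filterlim (\<lambda>n. norm (g n)) at_top sequentially"
    unfolding filterlim_at_top
  proof
    fix B :: real
    have "\<forall>\<^sub>F n in cofinite. \<not> (norm (g n) \<le> B)" using f[of B] by (simp add: eventually_cofinite)
    then show "\<forall>\<^sub>F n in sequentially. B \<le> norm (g n)"
      by (simp add: cofinite_eq_sequentially) (auto elim: eventually_mono)
  qed
  have nz: "g n \<noteq> 0" for n
  proof
    assume "g n = 0"
    then have "qmat_id \<triangleright> axis 0 (qreal 1) = (0::qvec)"
      using Sp21_qdag(1)[OF G_Sp[OF assms(1)[of n]]] by (metis qmat_mult.zero_right qmat_vec.zero_left)
    then show False by (simp add: qvec_eq_iff axis_def) (metis qreal_simps(7) zero_neq_one)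
  qed
  define s where "s n = (1 / norm (g n)) *\<^sub>R g n" for n
  have "s n \<in> sphere 0 1" for n using nz by (simp add: s_def)
  then obtain T r where T: "T \<in> sphere 0 1" "strict_mono r" "(s \<circ> r) \<longlonglongrightarrow> T"
    using compact_sphere[of "0::qmat" 1] unfolding compact_def by metis
  have "(\<lambda>n. 1 / norm (g n)) \<longlonglongrightarrow> 0"
    using top by (intro tendsto_divide_0[OF tendsto_const] filterlim_at_top_imp_at_infinity)
  then have c: "(\<lambda>n. 1 / norm (g (r n))) \<longlonglongrightarrow> 0"
    using LIMSEQ_subseq_LIMSEQ[OF _ T(2)] unfolding comp_def by blast
  have l: "(\<lambda>n. (1 / norm (g (r n))) *\<^sub>R g (r n)) \<longlonglongrightarrow> T" using T(3) by (simp add: s_def comp_def)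
  have "T \<noteq> 0" using T(1) by auto
  then have "T \<in> rescaled_limits" using assms(1) c l by (intro rescaled_limits_I[of T "\<lambda>n. g (r n)"]) auto
  then show ?thesis using that[OF T(2) c l] by simp
qed

definition limit_vecs :: "qvec set" where
  "limit_vecs = {x. x \<noteq> 0 \<and> herm x x = 0 \<and> (\<exists>y. y \<noteq> 0 \<and> herm y y = 0 \<and> outer x y \<in> rescaled_limits)}"

text \<open>Representatives u n = g n x0 l n converge to an isotropic v, and comparing form values
  forces l n to zero. The pairing of c n g n x0 with u n is c n <x0, x0> l n, so in the limit T x0
  is orthogonal to v. As T x0 is a nonzero multiple of x, the vectors x and v span the same
  line.\<close>

lemma limit_set_limit_vecs:
  assumes "L \<in> limit_set G" shows "\<exists>x\<in>limit_vecs. L = qline x"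
proof -
  obtain v0 X g where v0: "L = qline v0" "v0 \<noteq> 0" "herm v0 v0 = 0" and X: "X \<in> HH2"
    and g: "\<And>n. g n \<in> G" "inj g" "lines_tendsto (\<lambda>n. qact (g n) X) L"
    using assms unfolding limit_set_def bdry_HH2_def by blast
  obtain x0 where x0: "X = qline x0" "herm x0 x0 $ 0 < 0" using X by (auto simp: HH2_def)
  obtain u v where u: "\<And>n. u n \<in> qact (g n) X" and v: "v \<in> L" "v \<noteq> 0" and uv: "u \<longlonglongrightarrow> v"
    using g(3) unfolding lines_tendsto_def by blast
  have "\<forall>n. \<exists>l. u n = (g n \<triangleright> x0) \<triangleleft> l" using u unfolding x0(1) qact_qline by (auto simp: qline_def)
  then obtain l where l: "\<And>n. u n = (g n \<triangleright> x0) \<triangleleft> l n" by metis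
  obtain m where m: "v = v0 \<triangleleft> m" using v(1) v0 by (auto simp: qline_def)
  have vv: "herm v v = 0" using v0 m by (simp add: qmul.zero_left qmul.zero_right)
  have Lv: "L = qline v" using v0 v m qline_scal by auto
  obtain r c T where T: "strict_mono r" "c \<longlonglongrightarrow> 0" "(\<lambda>n. c n *\<^sub>R g (r n)) \<longlonglongrightarrow> T" "T \<in> rescaled_limits"
    by (rule rescaled_limits_sequence[OF g(1,2)])
  obtain x y where xy: "x \<noteq> 0" "y \<noteq> 0" "T = outer x y" "herm x x = 0" "herm y y = 0"
    by (rule rescaled_limits_outer[OF T(4)])
  have a: "herm x0 x0 = qreal (herm x0 x0 $ 0)" by (rule herm_self_qreal)
  have A: "(\<lambda>n. herm (u n) (u n)) \<longlonglongrightarrow> 0" using herm.tendsto[OF uv uv] vv by simp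
  have h: "herm (u n) (u n) = qreal ((herm x0 x0 $ 0) * (norm (l n))\<^sup>2)" for n
    using g(1)[of n] by (simp add: l) (subst (1) a, simp add: qmul.scaleR_right qmul.scaleR_left qcnj_mult_self)
  have e: "norm (herm (u n) (u n)) = \<bar>herm x0 x0 $ 0\<bar> * (norm (l n))\<^sup>2" for n
    unfolding h by (simp add: abs_mult)
  have "(\<lambda>n. \<bar>herm x0 x0 $ 0\<bar> * (norm (l n))\<^sup>2) \<longlonglongrightarrow> 0"
    using tendsto_norm_zero[OF A] by (simp only: e)
  then have "(\<lambda>n. (1/\<bar>herm x0 x0 $ 0\<bar>) * (\<bar>herm x0 x0 $ 0\<bar> * (norm (l n))\<^sup>2)) \<longlonglongrightarrow> 0"
    by (rule tendsto_mult_right_zero)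
  then have "(\<lambda>n. (norm (l n))\<^sup>2) \<longlonglongrightarrow> 0" using x0(2) by simp
  then have l0: "l \<longlonglongrightarrow> 0"
    using tendsto_real_sqrt[of "\<lambda>n. (norm (l n))\<^sup>2" 0] tendsto_norm_zero_cancel by auto
  have l1: "(\<lambda>n. herm ((c n *\<^sub>R g (r n)) \<triangleright> x0) (u (r n))) \<longlonglongrightarrow> herm (T \<triangleright> x0) v"
    using LIMSEQ_subseq_LIMSEQ[OF uv T(1)] unfolding comp_def
    by (intro herm.tendsto qmat_vec.tendsto T tendsto_const)
  have l2: "herm ((c n *\<^sub>R g (r n)) \<triangleright> x0) (u (r n)) = c n *\<^sub>R (herm x0 x0 \<odot> l (r n))" for n
    using g(1)[of "r n"] by (simp add: l qmat_vec.scaleR_left herm.scaleR_left qmul.scaleR_left)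
  have l3: "(\<lambda>n. c n *\<^sub>R (herm x0 x0 \<odot> l (r n))) \<longlonglongrightarrow> 0 *\<^sub>R (herm x0 x0 \<odot> 0)"
    using LIMSEQ_subseq_LIMSEQ[OF l0 T(1)] unfolding comp_def
    by (intro tendsto_scaleR qmul.tendsto T tendsto_const)
  have Tv: "herm (T \<triangleright> x0) v = 0" using LIMSEQ_unique[OF l1[unfolded l2] l3] by simp
  have "herm y x0 \<noteq> 0"
    using herm_neg_perp_nonneg(2)[OF x0(2), of y] xy by (metis herm_eq_0_commute herm_self_eq_0)
  then have "herm x v = 0" using Tv xy(3) by simp
  then obtain k where "v = x \<triangleleft> k" using isotropic_perp_parallel xy vv by blast
  then have "L = qline x" using Lv v(2) qline_scal by auto
  moreover have "x \<in> limit_vecs" using xy T(4) by (auto simp: limit_vecs_def)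
  ultimately show ?thesis by blast
qed

end

section \<open>No invariant isotropic line\<close>

lemma herm_isotropic_trans:
  assumes "herm y y = 0" "herm x x = 0" "herm x y = 0" "herm y z = 0" "y \<noteq> 0"
  shows "herm x z = 0"
proof -
  have "herm y x = 0" using assms by (simp add: herm_eq_0_commute)
  then obtain l where "x = y \<triangleleft> l" using isotropic_perp_parallel assms by blast
  then show ?thesis using assms by (simp add: qmul.zero_right)
qed

text \<open>For isotropic x the equation \<open>herm x (A \<triangleright> x) = 0\<close> says that
  A preserves the line of x; invariance of a line is expressed in this form below because it passes
  to limits.\<close>

lemma isotropic_image:
  assumes "A \<in> Sp21" "herm x x = 0" "x \<noteq> 0" "herm x (A \<triangleright> x) = 0"
  obtains c where "A \<triangleright> x = x \<triangleleft> c" "c \<noteq> 0" "qdag A \<triangleright> x = x \<triangleleft> qinv c"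
proof -
  have "herm (A \<triangleright> x) (A \<triangleright> x) = 0" using assms by simp
  then obtain c where c: "A \<triangleright> x = x \<triangleleft> c" using isotropic_perp_parallel assms by blast
  have d: "qdag A \<triangleright> A \<triangleright> x = x" using Sp21_qdag(1)[OF assms(1)] by (metis qmat_vec_assoc qmat_id_vec)
  have "A \<triangleright> x \<noteq> 0" using d assms(3) by (metis qmat_vec.zero_right)
  then have "c \<noteq> 0" using c by (auto simp: qscal.zero_right)
  have "(qdag A \<triangleright> x) \<triangleleft> c \<triangleleft> qinv c = x \<triangleleft> qinv c" using d c by simp
  then have "qdag A \<triangleright> x = x \<triangleleft> qinv c" using \<open>c \<noteq> 0\<close> by (simp add: qscal_assoc qinv_right)
  then show ?thesis using that c \<open>c \<noteq> 0\<close> by blast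
qed

lemma hyperbolic_decomp:
  assumes "herm x x = 0" "herm y y = 0" "herm x y \<noteq> 0"
  obtains d z r where "w = x \<triangleleft> d + y \<triangleleft> z + r" "herm x r = 0" "herm y r = 0"
proof -
  define d where "d = qinv (herm y x) \<odot> herm y w"
  define z where "z = qinv (herm x y) \<odot> herm x w"
  define r where "r = w - x \<triangleleft> d - y \<triangleleft> z"
  have n: "herm y x \<noteq> 0" using assms(3) herm_eq_0_commute by blast
  have "herm x r = 0" "herm y r = 0"
    using assms n by (simp_all add: r_def herm.diff_right z_def d_def qmul.zero_left qinv_right flip: qmul_assoc)
  then show ?thesis using that[of d z r] by (simp add: r_def)
qed

text \<open>Properness of the action. Split w into a multiple of y and a vector x orthogonal to y:
  the form values at A y and A x do not depend on A, so the bound on A y controls A x as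
  well.\<close>

lemma Sp21_pointwise_bounded:
  assumes "S \<subseteq> Sp21" "herm y y $ 0 < 0" "\<And>A. A \<in> S \<Longrightarrow> norm (A \<triangleright> y) \<le> R"
  shows "bounded S"
proof (rule qmat_pointwise_bounded)
  fix w
  define t where "t = qinv (herm y y) \<odot> herm y w"
  define x where "x = w - y \<triangleleft> t"
  define c where "c = - (herm y y $ 0)"
  have "herm y y \<noteq> 0" using assms(2) by auto
  then have yx: "herm y x = 0" by (simp add: x_def t_def herm.diff_right qinv_right flip: qmul_assoc)
  have xx: "herm x x $ 0 \<ge> 0" using herm_neg_perp_nonneg[OF assms(2) yx] by simp
  have c: "c > 0" using assms(2) by (simp add: c_def)
  have "norm (A \<triangleright> w) \<le> R * norm t + sqrt (2 * R\<^sup>2 / c * (herm x x $ 0))" if A: "A \<in> S" for A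
  proof -
    have AS: "A \<in> Sp21" using A assms by auto
    have "w = y \<triangleleft> t + x" by (simp add: x_def)
    then have "norm (A \<triangleright> w) \<le> norm (A \<triangleright> y) * norm t + norm (A \<triangleright> x)"
      by (metis norm_triangle_ineq qmat_vec.add_right qmat_vec_scal norm_qscal)
    moreover have "norm (A \<triangleright> y) * norm t \<le> R * norm t" using assms(3)[OF A] by (simp add: mult_right_mono)
    moreover have "norm (A \<triangleright> x) \<le> sqrt (2 * R\<^sup>2 / c * (herm x x $ 0))"
    proof (rule real_le_rsqrt)
      have "(norm (A \<triangleright> x))\<^sup>2 \<le> 2 * (norm (A \<triangleright> y))\<^sup>2 / c * (herm x x $ 0)"
        using herm_neg_perp[of "A \<triangleright> y" "A \<triangleright> x"] AS assms(2) yx by (simp add: c_def)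
      also have "\<dots> \<le> 2 * R\<^sup>2 / c * (herm x x $ 0)"
        using assms(3)[OF A] c xx by (intro mult_right_mono divide_right_mono mult_left_mono power_mono) auto
      finally show "(norm (A \<triangleright> x))\<^sup>2 \<le> 2 * R\<^sup>2 / c * (herm x x $ 0)" .
    qed
    ultimately show ?thesis by linarith
  qed
  then show "\<exists>B. \<forall>A\<in>S. norm (A \<triangleright> w) \<le> B" by blast
qed

section \<open>Elements that fix an isotropic line and contract it\<close>

primrec qpow :: "qmat \<Rightarrow> nat \<Rightarrow> qmat" where
  "qpow A 0 = qmat_id" | "qpow A (Suc n) = A \<otimes> qpow A n"

lemma qpow_add: "qpow A (m + n) = qpow A m \<otimes> qpow A n"
  by (induction m) (auto simp: qmat_mult_assoc)

lemma qpow_commute: "qpow A n \<otimes> A = A \<otimes> qpow A n"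
  by (induction n) (auto simp: qmat_mult_assoc)

lemma qpow_eigen:
  assumes "A \<triangleright> x = x \<triangleleft> c"
  shows "\<exists>d. qpow A n \<triangleright> x = x \<triangleleft> d \<and> norm d = norm c ^ n"
proof (induction n)
  case 0
  have "qpow A 0 \<triangleright> x = x \<triangleleft> qreal 1" by simp
  then show ?case using norm_qreal[of 1] by (metis abs_one power_0)
next
  case (Suc n)
  then obtain d where "qpow A n \<triangleright> x = x \<triangleleft> d" "norm d = norm c ^ n" by blast
  then have "qpow A (Suc n) \<triangleright> x = x \<triangleleft> (c \<odot> d)" "norm (c \<odot> d) = norm c ^ Suc n"
    using assms by (simp_all add: qmat_vec_assoc qscal_assoc norm_qmul)
  then show ?case by blast
qed

context discrete_group begin

lemma G_qpow [simp]: "A \<in> G \<Longrightarrow> qpow A n \<in> G"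
  by (induction n) auto

lemma rescaled_limits_fixed_line:
  assumes "outer x y \<in> rescaled_limits" "\<And>g. g \<in> G \<Longrightarrow> herm e (g \<triangleright> e) = 0"
  shows "herm x e = 0 \<or> herm y e = 0"
proof -
  obtain g c where g: "\<And>n. g n \<in> G" "c \<longlonglongrightarrow> 0" "(\<lambda>n. c n *\<^sub>R g n) \<longlonglongrightarrow> outer x y"
    using assms(1) unfolding rescaled_limits_def by blast
  have "(\<lambda>n. herm e ((c n *\<^sub>R g n) \<triangleright> e)) \<longlonglongrightarrow> herm e (outer x y \<triangleright> e)"
    by (intro herm.tendsto qmat_vec.tendsto g tendsto_const)
  then have "(\<lambda>n. 0) \<longlonglongrightarrow> herm e (outer x y \<triangleright> e)"
    using assms(2) g(1) by (simp add: qmat_vec.scaleR_left herm.scaleR_right)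
  then have "herm e (outer x y \<triangleright> e) = 0" by (simp add: LIMSEQ_const_iff)
  then show ?thesis by (simp add: herm_eq_0_commute)
qed

lemma limit_vanishes:
  assumes "(\<lambda>n. c n *\<^sub>R g n) \<longlonglongrightarrow> T" "c \<longlonglongrightarrow> (0::real)" "\<And>n. norm (g n \<triangleright> e) \<le> B"
  shows "T \<triangleright> e = 0"
proof -
  have l: "(\<lambda>n. (c n *\<^sub>R g n) \<triangleright> e) \<longlonglongrightarrow> T \<triangleright> e" by (intro qmat_vec.tendsto assms tendsto_const)
  have "(\<lambda>n. \<bar>c n\<bar> * B) \<longlonglongrightarrow> \<bar>0\<bar> * B" by (intro tendsto_intros assms)
  then have cB: "(\<lambda>n. \<bar>c n\<bar> * B) \<longlonglongrightarrow> 0" by simp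
  have le: "norm ((c n *\<^sub>R g n) \<triangleright> e) \<le> \<bar>c n\<bar> * B" for n
    using assms(3)[of n] by (simp add: qmat_vec.scaleR_left mult_left_mono)
  have "(\<lambda>n. (c n *\<^sub>R g n) \<triangleright> e) \<longlonglongrightarrow> 0"
    by (rule Lim_null_comparison[OF always_eventually[OF allI[OF le]] cB])
  then show ?thesis by (rule LIMSEQ_unique[OF l])
qed

text \<open>The adjoint limit operator does not kill e, although the scaling factors tend to zero;
  hence some element of the sequence stretches e, and its inverse contracts e.\<close>

lemma exists_contracting:
  assumes e: "e \<noteq> 0" "herm e e = 0" and fix_e: "\<And>g. g \<in> G \<Longrightarrow> herm e (g \<triangleright> e) = 0"
    and x: "x \<in> limit_vecs" "herm x e \<noteq> 0"
  obtains g ch where "g \<in> G" "g \<triangleright> e = e \<triangleleft> ch" "norm ch < 1" "ch \<noteq> 0"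
proof -
  obtain y where y: "y \<noteq> 0" "herm y y = 0" "outer x y \<in> rescaled_limits" using x by (auto simp: limit_vecs_def)
  have T: "outer y x \<in> rescaled_limits" using rescaled_limits_dag[OF y(3)] by simp
  then obtain g c where g: "\<And>n. g n \<in> G" "c \<longlonglongrightarrow> 0" "(\<lambda>n. c n *\<^sub>R g n) \<longlonglongrightarrow> outer y x"
    unfolding rescaled_limits_def by blast
  have "outer y x \<triangleright> e \<noteq> 0" using y x by simp
  then obtain n where n: "norm (g n \<triangleright> e) > norm e" using limit_vanishes[OF g(3,2), of e "norm e"] by (meson not_le)
  obtain d where d: "g n \<triangleright> e = e \<triangleleft> d" "d \<noteq> 0" "qdag (g n) \<triangleright> e = e \<triangleleft> qinv d"
    by (rule isotropic_image[OF G_Sp[OF g(1)] e(2,1) fix_e[OF g(1)]])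
  have "norm d > 1" using n d(1) e(1) by (simp add: norm_qscal)
  then have "norm (qinv d) < 1" by (simp add: norm_qinv inverse_less_1_iff)
  then show ?thesis using that[of "qdag (g n)" "qinv d"] d g(1) by simp
qed

text \<open>The powers of g shrink e strictly, so they are distinct and have a rescaled limit T =
  \<open>outer al be\<close>. T kills e, which puts \<open>be\<close> on the line of e; T commutes
  with g, which makes \<open>al\<close> an eigenvector. The adjoint of g stretches the line of e,
  and this gives the norm of the eigenvalue a. Thus \<open>al\<close> spans the other fixed line of
  g.\<close>

lemma exists_attracting:
  assumes e: "e \<noteq> 0" "herm e e = 0" and g: "g \<in> G" "g \<triangleright> e = e \<triangleleft> ch" "norm ch < 1" "ch \<noteq> 0"
  obtains a al where "al \<noteq> 0" "herm al al = 0" "g \<triangleright> al = al \<triangleleft> a" "norm a > 1" "herm al e \<noteq> 0"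
proof -
  have P: "\<exists>d. qpow g n \<triangleright> e = e \<triangleleft> d \<and> norm d = norm ch ^ n" for n by (rule qpow_eigen[OF g(2)])
  then have Pn: "norm (qpow g n \<triangleright> e) = norm e * norm ch ^ n" for n by (metis norm_qscal)
  have injg: "inj (qpow g)"
  proof (rule injI)
    fix k l assume "qpow g k = qpow g l"
    then have "norm ch ^ k = norm ch ^ l" using Pn[of k] Pn[of l] e(1) by simp
    then show "k = l" using g(3,4) by (metis linorder_neqE_nat power_strict_decreasing zero_less_norm_iff less_irrefl)
  qed
  obtain r c T where T: "strict_mono r" "c \<longlonglongrightarrow> 0" "(\<lambda>n. c n *\<^sub>R qpow g (r n)) \<longlonglongrightarrow> T" "T \<in> rescaled_limits"
    by (rule rescaled_limits_sequence[OF G_qpow[OF g(1)] injg])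
  obtain al be where ab: "al \<noteq> 0" "be \<noteq> 0" "T = outer al be" "herm al al = 0" "herm be be = 0"
    by (rule rescaled_limits_outer[OF T(4)])
  have "T \<triangleright> e = 0"
  proof (rule limit_vanishes[OF T(3,2)])
    show "norm (qpow g (r n) \<triangleright> e) \<le> norm e" for n
      unfolding Pn using g(3) by (simp add: mult_left_le power_le_one)
  qed
  then have be: "herm be e = 0" using ab by simp
  have "(\<lambda>n. (c n *\<^sub>R qpow g (r n)) \<otimes> g) \<longlonglongrightarrow> T \<otimes> g" "(\<lambda>n. g \<otimes> (c n *\<^sub>R qpow g (r n))) \<longlonglongrightarrow> g \<otimes> T"
    by (intro qmat_mult.tendsto T tendsto_const)+
  then have comm: "T \<otimes> g = g \<otimes> T"
    by (simp add: qmat_mult.scaleR_left qmat_mult.scaleR_right qpow_commute LIMSEQ_unique)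
  obtain w where w: "herm be w = qreal 1"
    using exists_herm_dual[OF ab(2)] by (metis herm_cnj qcnj_simps(7))
  define a where "a = herm be (g \<triangleright> w)"
  have "(g \<otimes> T) \<triangleright> w = (T \<otimes> g) \<triangleright> w" using comm by simp
  then have ga: "g \<triangleright> al = al \<triangleleft> a" using w by (simp add: qmat_vec_assoc ab a_def)
  have eb: "herm e be = 0" using be herm_eq_0_commute by blast
  obtain s where s: "be = e \<triangleleft> s" using isotropic_perp_parallel[OF e(2) ab(5) eb e(1)] by blast
  have "qdag g \<triangleright> g \<triangleright> e = e" using g(1) by simp
  then have "(qdag g \<triangleright> e) \<triangleleft> ch \<triangleleft> qinv ch = e \<triangleleft> qinv ch" using g(2) by simp
  then have de: "qdag g \<triangleright> e = e \<triangleleft> qinv ch" using g(4) by (simp add: qscal_assoc qinv_right)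
  have "a = herm (qdag g \<triangleright> be) w" unfolding a_def by (metis herm_qdag qdag_qdag)
  then have "norm a = norm (qinv ch) * norm (herm (e \<triangleleft> s) w)" using de s by (simp add: norm_qmul qmul_assoc)
  then have na: "norm a = inverse (norm ch)" using w s norm_qreal[of 1] by (simp add: norm_qinv del: herm_scal)
  then have a1: "norm a > 1" using g(3,4) by (simp add: one_less_inverse_iff)
  have "herm al e \<noteq> 0"
  proof
    assume "herm al e = 0"
    then have "herm e al = 0" using herm_eq_0_commute by blast
    then obtain t where t: "al = e \<triangleleft> t" using isotropic_perp_parallel[OF e(2) ab(4) _ e(1)] by blast
    have "norm (g \<triangleright> al) = norm ch * norm al" using g(2) t by (simp add: qscal_assoc norm_qscal norm_qmul)
    moreover have "norm (g \<triangleright> al) = norm a * norm al" using ga by (simp add: norm_qscal)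
    ultimately show False using ab(1) a1 g(3) by simp
  qed
  then show ?thesis using that[of al a] ab ga a1 by blast
qed

text \<open>The conjugates $g^k h g^{-k}$ stay bounded, so by discreteness two of them agree and some power of
  \<open>g\<close> commutes with \<open>h\<close>, which therefore preserves the expanding line of \<open>g\<close>.\<close>

lemma attracting_fixed:
  assumes e: "e \<noteq> 0" "herm e e = 0" and fix_e: "\<And>g. g \<in> G \<Longrightarrow> herm e (g \<triangleright> e) = 0"
    and g: "g \<in> G" "g \<triangleright> e = e \<triangleleft> ch" "norm ch < 1" "ch \<noteq> 0"
    and al: "al \<noteq> 0" "herm al al = 0" "g \<triangleright> al = al \<triangleleft> a" "norm a > 1" "herm al e \<noteq> 0"
    and h: "h \<in> G"
  shows "herm al (h \<triangleright> al) = 0"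
proof -
  define P where "P = qpow g"
  have PG [simp]: "P n \<in> G" for n using g(1) by (simp add: P_def)
  \<comment> \<open>The sign makes \<open>al + e'\<close> a vector of form value -2, at which
    boundedness of isometries can be tested.\<close>
  define e' where "e' = e \<triangleleft> (- qinv (herm al e))"
  have ae': "herm al e' = qreal (-1)" using al(5) unfolding e'_def by (simp add: qinv_right qmul.minus_right)
  have e'a: "herm e' al = qreal (-1)" using ae' by (metis herm_cnj qcnj_simps(7))
  have e'e': "herm e' e' = 0" using e(2) by (simp add: e'_def qmul.zero_left qmul.zero_right)
  obtain dh where dh: "h \<triangleright> e = e \<triangleleft> dh" "dh \<noteq> 0" "qdag h \<triangleright> e = e \<triangleleft> qinv dh"
    by (rule isotropic_image[OF G_Sp[OF h] e(2,1) fix_e[OF h]])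
  define f where "f k = P k \<otimes> h \<otimes> qdag (P k)" for k
  have fG: "f k \<in> G" for k using h by (simp add: f_def)
  have Pe: "\<exists>d. P n \<triangleright> e = e \<triangleleft> d \<and> norm d = norm ch ^ n" for n unfolding P_def by (rule qpow_eigen[OF g(2)])
  have Pa: "\<exists>d. P n \<triangleright> al = al \<triangleleft> d \<and> norm d = norm a ^ n" for n unfolding P_def by (rule qpow_eigen[OF al(3)])
  have fe: "norm (f k \<triangleright> e) = norm e * norm dh" for k
  proof -
    obtain d where d: "P k \<triangleright> e = e \<triangleleft> d" "norm d = norm ch ^ k" using Pe by blast
    have "d \<noteq> 0" using d(2) g(4) by (metis norm_eq_zero power_not_zero)
    have "qdag (P k) \<triangleright> P k \<triangleright> e = e" by simp
    then have "(qdag (P k) \<triangleright> e) \<triangleleft> d \<triangleleft> qinv d = e \<triangleleft> qinv d" using d(1) by simp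
    then have "qdag (P k) \<triangleright> e = e \<triangleleft> qinv d" using \<open>d \<noteq> 0\<close> by (simp add: qscal_assoc qinv_right)
    then have "f k \<triangleright> e = e \<triangleleft> (d \<odot> dh \<odot> qinv d)"
      using d dh by (simp add: f_def qmat_vec_assoc qscal_assoc qmul_assoc)
    then show ?thesis using \<open>d \<noteq> 0\<close> by (simp add: norm_qscal norm_qmul norm_qinv)
  qed
  then have fe': "norm (f k \<triangleright> e') = norm e' * norm dh" for k by (simp add: e'_def norm_qscal)
  define y where "y = al + e'"
  have yy: "herm y y $ 0 < 0" using al(2) e'e' ae' e'a by (simp add: y_def herm.add_left herm.add_right)
  obtain d z r where r: "h \<triangleright> al = al \<triangleleft> d + e' \<triangleleft> z + r" "herm al r = 0" "herm e' r = 0"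
    using hyperbolic_decomp[OF al(2) e'e'] ae' by (metis qreal_simps(7) neg_equal_0_iff_equal zero_neq_one)
  have yr: "herm y r = 0" using r by (simp add: y_def herm.add_left)
  define R where "R = sqrt (2 * (norm y)\<^sup>2 / (- (herm y y $ 0)) * (herm r r $ 0))"
  \<comment> \<open>\<open>P k\<close> preserves the lines of \<open>al\<close> and e, hence their
    common orthogonal complement, where the form is positive.\<close>
  have Pr: "norm (P k \<triangleright> r) \<le> R" for k
    unfolding R_def
  proof (rule real_le_rsqrt)
    obtain d1 where d1: "P k \<triangleright> e = e \<triangleleft> d1" "norm d1 = norm ch ^ k" using Pe by blast
    have d10: "d1 \<noteq> 0" using d1(2) g(4) by (metis norm_eq_zero power_not_zero)
    obtain d2 where d2: "P k \<triangleright> al = al \<triangleleft> d2" "norm d2 = norm a ^ k" using Pa by blast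
    have d20: "d2 \<noteq> 0" using d2(2) al(4) by (metis norm_eq_zero power_not_zero not_one_less_zero)
    have "herm (P k \<triangleright> al) (P k \<triangleright> r) = 0" using r(2) by simp
    then have 1: "herm al (P k \<triangleright> r) = 0" using d2 d20 by simp
    have "herm e r = 0" using r(3) al(5) by (simp add: e'_def)
    then have "herm (P k \<triangleright> e) (P k \<triangleright> r) = 0" by simp
    then have "herm e (P k \<triangleright> r) = 0" using d1 d10 by simp
    then have 2: "herm e' (P k \<triangleright> r) = 0" by (simp add: e'_def qmul.zero_right)
    have "herm y (P k \<triangleright> r) = 0" using 1 2 by (simp add: y_def herm.add_left)
    then show "(norm (P k \<triangleright> r))\<^sup>2 \<le> 2 * (norm y)\<^sup>2 / (- (herm y y $ 0)) * (herm r r $ 0)"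
      using herm_neg_perp[OF yy] by fastforce
  qed
  \<comment> \<open>The adjoint of \<open>P k\<close> divides \<open>al\<close> by the expanding
    factor. After h, applying \<open>P k\<close> restores the \<open>al\<close> component to its old
    size, does not expand the e' component and keeps the r component bounded; no term grows with
    k.\<close>
  have fa: "norm (f k \<triangleright> al) \<le> norm al * norm d + norm e' * norm z + R" for k
  proof -
    obtain d1 where d1: "P k \<triangleright> e = e \<triangleleft> d1" "norm d1 = norm ch ^ k" using Pe by blast
    obtain d2 where d2: "P k \<triangleright> al = al \<triangleleft> d2" "norm d2 = norm a ^ k" using Pa by blast
    have n2: "norm d2 \<ge> 1" unfolding d2(2) using al(4) by (simp add: one_le_power)
    then have d20: "d2 \<noteq> 0" by auto
    have n1: "norm d1 \<le> 1" unfolding d1(2) using g(3) by (simp add: power_le_one)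
    have "qdag (P k) \<triangleright> P k \<triangleright> al = al" by simp
    then have "(qdag (P k) \<triangleright> al) \<triangleleft> d2 \<triangleleft> qinv d2 = al \<triangleleft> qinv d2" using d2(1) by simp
    then have da: "qdag (P k) \<triangleright> al = al \<triangleleft> qinv d2" using d20 by (simp add: qscal_assoc qinv_right)
    have "norm (P k \<triangleright> e') = norm e' * norm d1"
      using d1(1) by (simp add: e'_def norm_qscal norm_qmul qscal_assoc)
    then have Pe': "norm (P k \<triangleright> e') \<le> norm e'" using n1 by (simp add: mult_left_le)
    have i: "norm (qinv d2) \<le> 1" using n2 by (simp add: norm_qinv inverse_le_1_iff)
    have "f k \<triangleright> al = al \<triangleleft> (d2 \<odot> d \<odot> qinv d2) + (P k \<triangleright> e') \<triangleleft> (z \<odot> qinv d2) + (P k \<triangleright> r) \<triangleleft> qinv d2"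
      by (simp add: f_def qmat_vec_assoc da r(1) qmat_vec.add_right d2(1) qscal_assoc qscal.add_left qmul_assoc)
    then have "norm (f k \<triangleright> al) \<le> norm (al \<triangleleft> (d2 \<odot> d \<odot> qinv d2)) + norm ((P k \<triangleright> e') \<triangleleft> (z \<odot> qinv d2)) + norm ((P k \<triangleright> r) \<triangleleft> qinv d2)"
      by (metis norm_triangle_le norm_triangle_ineq add_mono order_refl)
    moreover have "norm (al \<triangleleft> (d2 \<odot> d \<odot> qinv d2)) = norm al * norm d"
      using d20 by (simp add: norm_qscal norm_qmul norm_qinv)
    moreover have "norm ((P k \<triangleright> e') \<triangleleft> (z \<odot> qinv d2)) \<le> norm e' * norm z"
    proof -
      have "norm (P k \<triangleright> e') * (norm z * norm (qinv d2)) \<le> norm e' * (norm z * 1)"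
        using Pe' i by (intro mult_mono mult_left_mono) auto
      then show ?thesis by (simp add: norm_qscal norm_qmul)
    qed
    moreover have "norm ((P k \<triangleright> r) \<triangleleft> qinv d2) \<le> R"
    proof -
      have "norm (P k \<triangleright> r) * norm (qinv d2) \<le> R * 1"
        using Pr[of k] i by (intro mult_mono) (auto intro: order_trans[OF norm_ge_zero])
      then show ?thesis by (simp add: norm_qscal)
    qed
    ultimately show ?thesis by linarith
  qed
  have "norm (f k \<triangleright> y) \<le> norm al * norm d + norm e' * norm z + R + norm e' * norm dh" for k
    using fa[of k] fe'[of k] norm_triangle_ineq[of "f k \<triangleright> al" "f k \<triangleright> e'"] unfolding y_def qmat_vec.add_right by linarith
  then have "bounded (range f)" using fG yy by (intro Sp21_pointwise_bounded) auto
  then have "finite (range f)" using discrete_bounded_finite[OF disc] fG by blast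
  then have "\<not> inj f" using finite_imageD infinite_UNIV_nat by blast
  then obtain k l where kl: "k < l" "f k = f l" unfolding inj_def by (metis linorder_neqE_nat)
  define m where "m = l - k"
  have m: "m > 0" "l = k + m" using kl by (auto simp: m_def)
  have "h \<triangleright> P m \<triangleright> al = P m \<triangleright> h \<triangleright> al"
  proof -
    have Pl: "P l \<triangleright> v = P k \<triangleright> P m \<triangleright> v" for v by (simp add: P_def m qpow_add qmat_vec_assoc)
    have "f k \<triangleright> P k \<triangleright> P m \<triangleright> al = f l \<triangleright> P l \<triangleright> al" using kl Pl by simp
    then have "P k \<triangleright> h \<triangleright> P m \<triangleright> al = P k \<triangleright> P m \<triangleright> h \<triangleright> al"
      by (simp add: f_def qmat_vec_assoc) (simp add: Pl)
    then show ?thesis by (metis PG G_dag_vec(1))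
  qed
  moreover obtain d2 where d2: "P m \<triangleright> al = al \<triangleleft> d2" "norm d2 = norm a ^ m" using Pa by blast
  \<comment> \<open>Invariance under \<open>P m\<close> multiplies the norm of <al, h al> by the
    square of \<open>norm d2\<close>, which exceeds 1, without changing it.\<close>
  ultimately have "herm al (h \<triangleright> al) = qcnj d2 \<odot> herm al (h \<triangleright> al) \<odot> d2"
    using Sp21_herm[OF G_Sp[OF PG], of m al "h \<triangleright> al"] by (simp add: qmul_assoc) (metis herm_scal(1) qmat_vec_scal herm_scal(2) qmul_assoc)
  then have "norm (herm al (h \<triangleright> al)) = norm (herm al (h \<triangleright> al)) * (norm d2)\<^sup>2"
    by (metis norm_qmul norm_qcnj mult.commute mult.assoc power2_eq_square)
  moreover have "norm d2 > 1" unfolding d2(2) using al(4) m(1) by simp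
  ultimately show ?thesis by (smt (verit) mult_cancel_left1 norm_eq_zero one_less_power pos2)
qed

text \<open>An invariant line e would come with a second invariant line \<open>al\<close>.
  Evaluating a limit operator x <y, . > on both shows that x lies on one of them, since otherwise y
  would be orthogonal to both. Two lines cannot accommodate three distinct limit points.\<close>

lemma no_fixed_isotropic:
  assumes L: "x1 \<in> limit_vecs" "x2 \<in> limit_vecs" "x3 \<in> limit_vecs" "herm x1 x2 \<noteq> 0" "herm x1 x3 \<noteq> 0" "herm x2 x3 \<noteq> 0"
    and e: "e \<noteq> 0" "herm e e = 0"
  shows "\<exists>g\<in>G. herm e (g \<triangleright> e) \<noteq> 0"
proof (rule ccontr)
  assume "\<not> ?thesis"
  then have fix_e: "\<And>g. g \<in> G \<Longrightarrow> herm e (g \<triangleright> e) = 0" by blast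
  have Li: "\<And>x. x \<in> limit_vecs \<Longrightarrow> x \<noteq> 0 \<and> herm x x = 0" by (auto simp: limit_vecs_def)
  have tr: "herm x z = 0 \<Longrightarrow> herm y z = 0 \<Longrightarrow> herm z z = 0 \<Longrightarrow> z \<noteq> 0 \<Longrightarrow> x \<in> limit_vecs \<Longrightarrow> y \<in> limit_vecs \<Longrightarrow> herm x y = 0" for x y z
    using herm_isotropic_trans[of z x y] Li herm_eq_0_commute by blast
  obtain x where x: "x \<in> limit_vecs" "herm x e \<noteq> 0" using tr[OF _ _ e(2,1), of x1 x2] L by blast
  obtain g ch where g: "g \<in> G" "g \<triangleright> e = e \<triangleleft> ch" "norm ch < 1" "ch \<noteq> 0"
    using exists_contracting[OF e fix_e x] by metis
  obtain al a where al: "al \<noteq> 0" "herm al al = 0" "g \<triangleright> al = al \<triangleleft> a" "norm a > 1" "herm al e \<noteq> 0"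
    using exists_attracting[OF e g] by metis
  have fix_al: "\<And>h. h \<in> G \<Longrightarrow> herm al (h \<triangleright> al) = 0" using attracting_fixed[OF e fix_e g al] by blast
  have two: "herm x al = 0 \<or> herm x e = 0" if xL: "x \<in> limit_vecs" for x
  proof (rule ccontr)
    assume n: "\<not> ?thesis"
    obtain y where y: "y \<noteq> 0" "herm y y = 0" "outer x y \<in> rescaled_limits" using xL by (auto simp: limit_vecs_def)
    have "herm y al = 0" "herm y e = 0"
      using rescaled_limits_fixed_line[OF y(3) fix_al] rescaled_limits_fixed_line[OF y(3) fix_e] n by auto
    then show False using herm_isotropic_trans[of y al e] y al herm_eq_0_commute by blast
  qed
  show False using two[OF L(1)] two[OF L(2)] two[OF L(3)] tr[OF _ _ e(2,1)] tr[OF _ _ al(2,1)] L by meson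
qed

section \<open>The real algebra spanned by the group\<close>

lemma span_mult: "A \<in> span G \<Longrightarrow> B \<in> span G \<Longrightarrow> A \<otimes> B \<in> span G"
proof (induction A rule: span_induct_alt)
  case base
  then show ?case by (simp add: qmat_mult.zero_left span_zero)
next
  case (step c A1 A2)
  from step(3) have "A1 \<otimes> B \<in> span G"
  proof (induction B rule: span_induct_alt)
    case base
    then show ?case by (simp add: qmat_mult.zero_right span_zero)
  next
    case (step d B1 B2)
    then show ?case using \<open>A1 \<in> G\<close>
      by (simp add: qmat_mult.add_right qmat_mult.scaleR_right span_add span_scale span_base)
  qed
  then show ?case using step by (simp add: qmat_mult.add_left qmat_mult.scaleR_left span_add span_scale)
qed

lemma span_dag: "A \<in> span G \<Longrightarrow> qdag A \<in> span G"
proof (induction A rule: span_induct_alt)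
  case base
  then show ?case by (simp add: linear_0[OF linear_qdag] span_zero)
next
  case (step c A1 A2)
  then show ?case by (simp add: linear_add[OF linear_qdag] linear_cmul[OF linear_qdag] span_add span_scale span_base)
qed

text \<open>Compose x <x', . > with g and with the adjoint y' <y, . > of a second limit operator:
  the coefficient is <x', g y'>. If it vanished for all g, the identity would put x' and y' on one
  line, and that line would be invariant.\<close>

lemma limit_vecs_transition:
  assumes L: "x1 \<in> limit_vecs" "x2 \<in> limit_vecs" "x3 \<in> limit_vecs" "herm x1 x2 \<noteq> 0" "herm x1 x3 \<noteq> 0" "herm x2 x3 \<noteq> 0"
    and "x \<in> limit_vecs" "y \<in> limit_vecs"
  shows "\<exists>d. d \<noteq> 0 \<and> outer (x \<triangleleft> d) y \<in> span G"
proof -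
  obtain x' where x': "x' \<noteq> 0" "herm x' x' = 0" "outer x x' \<in> rescaled_limits" using \<open>x \<in> limit_vecs\<close> by (auto simp: limit_vecs_def)
  obtain y' where y': "y' \<noteq> 0" "herm y' y' = 0" "outer y y' \<in> rescaled_limits" using \<open>y \<in> limit_vecs\<close> by (auto simp: limit_vecs_def)
  have "\<exists>g\<in>G. herm x' (g \<triangleright> y') \<noteq> 0"
  proof (rule ccontr)
    assume "\<not> ?thesis"
    then have n: "\<And>g. g \<in> G \<Longrightarrow> herm x' (g \<triangleright> y') = 0" by blast
    have "herm x' y' = 0" using n[OF G_id] by simp
    then obtain l where l: "y' = x' \<triangleleft> l" using isotropic_perp_parallel x' y' by blast
    then have "l \<noteq> 0" using y' by auto
    have "herm y' (g \<triangleright> y') = 0" if "g \<in> G" for g using n[OF that] l by (simp add: qmul.zero_right)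
    then show False using no_fixed_isotropic[OF L y'(1,2)] by blast
  qed
  then obtain g where g: "g \<in> G" "herm x' (g \<triangleright> y') \<noteq> 0" by blast
  have "outer x x' \<otimes> g \<otimes> qdag (outer y y') \<in> span G"
    using x' y' g by (intro span_mult span_dag rescaled_limits_span span_base)
  moreover have "outer x x' \<otimes> g \<otimes> qdag (outer y y') = outer (x \<triangleleft> herm x' (g \<triangleright> y')) y"
    by (rule qmat_eqI) (simp add: qmat_vec_assoc qscal_assoc qmul_assoc)
  ultimately show ?thesis using g(2) by metis
qed

end

section \<open>Real subalgebras of the quaternions and the trace condition\<close>

lemmas qmul_bilin = qmul.add_left qmul.add_right qmul.diff_left qmul.diff_right qmul.minus_left qmul.minus_right
  qmul.scaleR_left qmul.scaleR_right qmul.zero_left qmul.zero_right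

text \<open>For an imaginary unit \<open>u\<close>, \<open>cent u\<close> is the copy $\mathbb{R} + \mathbb{R}u$ of the complex numbers and \<open>anti u\<close> its orthogonal complement.\<close>

definition cent :: "quat \<Rightarrow> quat set" where "cent u = {x. x \<odot> u = u \<odot> x}"

definition anti :: "quat \<Rightarrow> quat set" where "anti u = {x. x \<odot> u = - (u \<odot> x)}"

definition imag_unit :: "quat \<Rightarrow> bool" where "imag_unit u \<longleftrightarrow> u $ 0 = 0 \<and> norm u = 1"

lemma qcnj_imag: "u $ 0 = 0 \<Longrightarrow> qcnj u = - u" by (simp add: quat_eq_iff)

lemma imag_unit_sq: "imag_unit u \<Longrightarrow> u \<odot> u = qreal (-1)"
  using qcnj_mult_self(1)[of u] by (simp add: imag_unit_def qcnj_imag qmul_bilin) (metis minus_minus qreal_simps(4))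

lemma imag_unit_sq2: "imag_unit u \<Longrightarrow> u \<odot> (u \<odot> x) = - x"
  using imag_unit_sq[of u] by (simp flip: qmul_assoc)

lemma imag_unit_nz: "imag_unit u \<Longrightarrow> u \<noteq> 0" by (auto simp: imag_unit_def)

lemma cent_basic:
  "a \<in> cent u \<Longrightarrow> b \<in> cent u \<Longrightarrow> a + b \<in> cent u"
  "a \<in> cent u \<Longrightarrow> b \<in> cent u \<Longrightarrow> a - b \<in> cent u"
  "a \<in> cent u \<Longrightarrow> - a \<in> cent u"
  "a \<in> cent u \<Longrightarrow> r *\<^sub>R a \<in> cent u"
  "qreal r \<in> cent u" "0 \<in> cent u" "u \<in> cent u"
  by (simp_all add: cent_def qmul_bilin)

lemma anti_basic:
  "a \<in> anti u \<Longrightarrow> b \<in> anti u \<Longrightarrow> a + b \<in> anti u"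
  "a \<in> anti u \<Longrightarrow> - a \<in> anti u"
  by (simp_all add: anti_def qmul_bilin)

lemma cent_cent: "a \<in> cent u \<Longrightarrow> b \<in> cent u \<Longrightarrow> a \<odot> b \<in> cent u"
  unfolding cent_def mem_Collect_eq by (metis qmul_assoc)

lemma cent_anti: "a \<in> cent u \<Longrightarrow> b \<in> anti u \<Longrightarrow> a \<odot> b \<in> anti u"
  unfolding cent_def anti_def mem_Collect_eq by (metis qmul_assoc qmul.minus_right)

lemma anti_cent: "a \<in> anti u \<Longrightarrow> b \<in> cent u \<Longrightarrow> a \<odot> b \<in> anti u"
  unfolding cent_def anti_def mem_Collect_eq by (metis qmul_assoc qmul.minus_left)

lemma anti_anti: "a \<in> anti u \<Longrightarrow> b \<in> anti u \<Longrightarrow> a \<odot> b \<in> cent u"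
  unfolding cent_def anti_def mem_Collect_eq by (metis qmul_assoc qmul.minus_left qmul.minus_right minus_minus)

lemma cent_cnj: "u $ 0 = 0 \<Longrightarrow> a \<in> cent u \<Longrightarrow> qcnj a \<in> cent u"
proof -
  assume u: "u $ 0 = 0" and "a \<in> cent u"
  then have "qcnj (a \<odot> u) = qcnj (u \<odot> a)" by (simp add: cent_def)
  then show ?thesis using qcnj_imag[OF u] by (simp add: cent_def qmul_bilin)
qed

lemma anti_cnj: "u $ 0 = 0 \<Longrightarrow> a \<in> anti u \<Longrightarrow> qcnj a \<in> anti u"
proof -
  assume u: "u $ 0 = 0" and "a \<in> anti u"
  then have "qcnj (a \<odot> u) = qcnj (- (u \<odot> a))" by (simp add: anti_def)
  then show ?thesis using qcnj_imag[OF u] by (simp add: anti_def qmul_bilin)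
qed

lemma cent_inv: "u $ 0 = 0 \<Longrightarrow> a \<in> cent u \<Longrightarrow> qinv a \<in> cent u"
  by (simp add: qinv_def cent_basic cent_cnj)

lemma anti_inv: "u $ 0 = 0 \<Longrightarrow> a \<in> anti u \<Longrightarrow> qinv a \<in> anti u"
  using anti_cnj[of u a] by (simp add: qinv_def anti_def qmul_bilin)

lemma cent_anti_disjoint: "u \<noteq> 0 \<Longrightarrow> x \<in> cent u \<Longrightarrow> x \<in> anti u \<Longrightarrow> x = 0"
proof -
  assume u: "u \<noteq> 0" "x \<in> cent u" "x \<in> anti u"
  then have "u \<odot> x = - (u \<odot> x)" by (simp add: cent_def anti_def)
  then have "u \<odot> x = 0" by (simp add: eq_neg_iff_add_eq_0 flip: scaleR_2)
  then show ?thesis using u by simp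
qed

lemma anti_Re:
  assumes u: "imag_unit u" "x \<in> anti u" shows "x $ 0 = 0"
proof -
  have n: "(u$1)\<^sup>2 + (u$2)\<^sup>2 + (u$3)\<^sup>2 = 1" and u0: "u$0 = 0"
    using u(1) norm_quat_sq[of u] by (auto simp: imag_unit_def)
  have "x \<odot> u + u \<odot> x = 0" using u(2) by (simp add: anti_def)
  then have "x$0 * u$1 = 0" "x$0 * u$2 = 0" "x$0 * u$3 = 0"
    using u0 by (simp_all add: quat_eq_iff algebra_simps)
  then show ?thesis using n by auto
qed

lemma antiI:
  assumes u: "imag_unit u" and "x $ 0 = 0" "(x \<odot> u) $ 0 = 0" shows "x \<in> anti u"
  using assms by (simp add: anti_def imag_unit_def quat_eq_iff algebra_simps)

lemma Re_zero: "(\<And>d. (h \<odot> d) $ 0 = 0) \<Longrightarrow> h = 0"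
  by (metis norm_eq_zero qcnj_mult_self(2) qreal_nth(1) power_eq_0_iff)

lemma cent_form:
  assumes u: "imag_unit u" "x \<in> cent u" shows "x = qreal (x$0) + (- ((x \<odot> u) $ 0)) *\<^sub>R u"
proof -
  have n: "(u$1)\<^sup>2 + (u$2)\<^sup>2 + (u$3)\<^sup>2 = 1" and u0: "u$0 = 0"
    using u(1) norm_quat_sq[of u] by (auto simp: imag_unit_def)
  define y where "y = x - qreal (x$0) - (- ((x \<odot> u) $ 0)) *\<^sub>R u"
  have "y \<in> cent u" using u(2) by (auto simp: y_def intro!: cent_basic)
  moreover have "y \<in> anti u"
  proof (rule antiI[OF u(1)])
    show "y $ 0 = 0" using u0 by (simp add: y_def)
    have "(y \<odot> u) $ 0 = (x \<odot> u) $ 0 - (x$0) * u$0 + ((x \<odot> u) $ 0) * ((u \<odot> u) $ 0)"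
      unfolding y_def by (simp only: qmul_bilin qmul_qreal vector_minus_component vector_scaleR_component) (simp add: algebra_simps)
    then show "(y \<odot> u) $ 0 = 0" using imag_unit_sq[OF u(1)] u0 by simp
  qed
  ultimately have "y = 0" using cent_anti_disjoint imag_unit_nz u by blast
  then show ?thesis unfolding y_def by (subst eq_iff_diff_eq_0) (simp del: qmul_nth add: algebra_simps)
qed

text \<open>The quadratic equation of d puts its squared norm, hence all reals, into D. A nonreal
  element provides u and all of \<open>cent u\<close>; an element outside has a nonzero component f
  in \<open>anti u\<close>, and \<open>anti u\<close> consists of the multiples of f by
  \<open>cent u\<close>, so D is everything.\<close>

lemma subalgebra_cases:
  assumes sub: "subspace D" and mul: "\<And>a b. a \<in> D \<Longrightarrow> b \<in> D \<Longrightarrow> a \<odot> b \<in> D" and nz: "d \<in> D" "d \<noteq> 0"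
  shows "qreal 1 \<in> D" "D = range qreal \<or> D = UNIV \<or> (\<exists>u. imag_unit u \<and> D = cent u)"
proof -
  have sq: "d \<odot> d = (2 * d$0) *\<^sub>R d - qreal ((norm d)\<^sup>2)" for d
    unfolding norm_quat_sq by (simp add: quat_eq_iff power2_eq_square algebra_simps)
  have "qreal ((norm d)\<^sup>2) = (2 * d$0) *\<^sub>R d - d \<odot> d" using sq[of d] by (simp add: algebra_simps)
  also have "\<dots> \<in> D" using nz mul sub by (intro subspace_diff subspace_scale) auto
  finally have "(1 / (norm d)\<^sup>2) *\<^sub>R qreal ((norm d)\<^sup>2) \<in> D" using sub subspace_scale by blast
  then show one: "qreal 1 \<in> D" using nz by simp
  have R: "qreal r \<in> D" for r using subspace_scale[OF sub one, of r] by simp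
  show "D = range qreal \<or> D = UNIV \<or> (\<exists>u. imag_unit u \<and> D = cent u)"
  proof (cases "D \<subseteq> range qreal")
    case True
    then show ?thesis using R by auto
  next
    case False
    then obtain d where d: "d \<in> D" "d \<notin> range qreal" by blast
    define v where "v = d - qreal (d$0)"
    have v: "v \<in> D" "v \<noteq> 0" "v $ 0 = 0" using d R sub by (auto simp: v_def subspace_diff)
    define u where "u = (1 / norm v) *\<^sub>R v"
    have u: "imag_unit u" "u \<in> D" using v sub by (auto simp: u_def imag_unit_def subspace_scale)
    have c: "cent u \<subseteq> D" using cent_form[OF u(1)] R u(2) sub by (metis subsetI subspace_add subspace_scale)
    show ?thesis
    proof (cases "D \<subseteq> cent u")
      case True
      then show ?thesis using c u by blast
    next
      case False
      then obtain e where e: "e \<in> D" "e \<notin> cent u" by blast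
      \<comment> \<open>Since u squares to -1, these are twice the projections of x to the commuting
        and to the anticommuting half.\<close>
      have split: "x - u \<odot> x \<odot> u \<in> cent u" "x + u \<odot> x \<odot> u \<in> anti u" for x
        using imag_unit_sq[OF u(1)] imag_unit_sq2[OF u(1)] by (simp_all add: cent_def anti_def qmul_bilin qmul_assoc)
      define f where "f = e + u \<odot> e \<odot> u"
      have fa: "f \<in> anti u" using split by (simp add: f_def)
      have fD: "f \<in> D" using e u mul sub by (simp add: f_def subspace_add)
      have "f \<noteq> 0"
      proof
        assume "f = 0"
        then have "e = - (u \<odot> e \<odot> u)" by (simp add: f_def eq_neg_iff_add_eq_0)
        then have "e - u \<odot> e \<odot> u = 2 *\<^sub>R e" by (metis diff_conv_add_uminus scaleR_2)
        then have "e = (1/2) *\<^sub>R (e - u \<odot> e \<odot> u)" by simp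
        then show False using e split(1)[of e] cent_basic(4) by metis
      qed
      have "x \<in> D" for x
      proof -
        define y where "y = x + u \<odot> x \<odot> u"
        have "y \<odot> qinv f \<in> cent u" 
          unfolding y_def using u(1) by (intro anti_anti split(2) anti_inv fa) (simp add: imag_unit_def)
        then have "y \<odot> qinv f \<odot> f \<in> D" using c fD mul by blast
        then have yD: "y \<in> D" using \<open>f \<noteq> 0\<close> by (simp add: qmul_assoc qinv_left)
        have "(x - u \<odot> x \<odot> u) + y = 2 *\<^sub>R x" by (simp add: y_def scaleR_2)
        then have "x = (1/2) *\<^sub>R ((x - u \<odot> x \<odot> u) + y)" by simp
        moreover have "(1/2) *\<^sub>R ((x - u \<odot> x \<odot> u) + y) \<in> D"
          using split(1)[of x] c yD sub by (intro subspace_scale subspace_add) auto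
        ultimately show "x \<in> D" by metis
      qed
      then show ?thesis by blast
    qed
  qed
qed

definition qi :: quat where "qi = axis 1 1"

definition qj :: quat where "qj = axis 2 1"

definition qk :: quat where "qk = axis 3 1"

lemma ijk: "qi \<odot> qj = qk" "qi $ 0 = 0" "qj $ 0 = 0" "qk $ 0 = 0" "qk \<noteq> 0"
  by (simp_all add: qi_def qj_def qk_def quat_eq_iff axis_def)

lemma imag_unit_qi: "imag_unit qi"
  using ijk(2) by (simp add: imag_unit_def) (simp add: qi_def)

section \<open>Hyperbolic planes and complete frames\<close>

lemma hyp_plane_perp:
  assumes x: "herm x1 x1 = 0" "herm x2 x2 = 0" "herm x1 x2 = qreal 1"
    and v: "herm x1 v = 0" "herm x2 v = 0"
  shows "herm v v $ 0 \<ge> 0" "herm v v $ 0 = 0 \<Longrightarrow> v = 0"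
proof -
  have "herm x2 x1 = qreal 1" using x(3) by (metis herm_cnj qcnj_simps(7))
  \<comment> \<open>The difference of the isotropic pair has form value -2, which reduces positivity
    to the complement of one negative vector.\<close>
  then have n: "herm (x1 - x2) (x1 - x2) $ 0 < 0" using x by (simp add: herm.diff_left herm.diff_right)
  have p: "herm (x1 - x2) v = 0" using v by (simp add: herm.diff_left)
  show "herm v v $ 0 \<ge> 0" "herm v v $ 0 = 0 \<Longrightarrow> v = 0" using herm_neg_perp_nonneg[OF n p] by auto
qed

lemma hyp_plane_residual:
  fixes p :: qvec
  assumes x: "herm x1 x1 = 0" "herm x2 x2 = 0" "herm x1 x2 = qreal 1"
  defines "v \<equiv> p - x1 \<triangleleft> herm x2 p - x2 \<triangleleft> herm x1 p"
  shows "herm x1 v = 0" "herm x2 v = 0"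
    "herm v v $ 0 = herm p p $ 0 - 2 * ((qcnj (herm x2 p) \<odot> herm x1 p) $ 0)"
proof -
  have x21: "herm x2 x1 = qreal 1" using x(3) by (metis herm_cnj qcnj_simps(7))
  show p: "herm x1 v = 0" "herm x2 v = 0" using x x21 by (simp_all add: v_def herm.diff_right qmul_bilin)
  have "herm v v = herm p v" using p by (simp add: v_def herm.diff_left qmul_bilin)
  also have "\<dots> = herm p p - herm p x1 \<odot> herm x2 p - herm p x2 \<odot> herm x1 p"
    by (simp add: v_def herm.diff_right)
  also have "\<dots> = herm p p - qcnj (herm x1 p) \<odot> herm x2 p - qcnj (herm x2 p) \<odot> herm x1 p"
    by (simp add: herm_cnj)
  finally show "herm v v $ 0 = herm p p $ 0 - 2 * ((qcnj (herm x2 p) \<odot> herm x1 p) $ 0)" by simp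
qed

text \<open>For isotropic p the form value of the residual is -2 times the real part in the
  hypothesis. This turns real-part conditions coming from the trace into membership in the plane
  spanned by x1 and x2.\<close>

lemma hyp_plane_isotropic:
  assumes x: "herm x1 x1 = 0" "herm x2 x2 = 0" "herm x1 x2 = qreal 1"
    and p: "herm p p = 0" "(qcnj (herm x2 p) \<odot> herm x1 p) $ 0 = 0"
  shows "p = x1 \<triangleleft> herm x2 p + x2 \<triangleleft> herm x1 p"
proof -
  define v where "v = p - x1 \<triangleleft> herm x2 p - x2 \<triangleleft> herm x1 p"
  note r = hyp_plane_residual[OF x, of p, folded v_def]
  have "v = 0" using hyp_plane_perp(2)[OF x r(1,2)] r(3) p by simp
  then show ?thesis by (simp add: v_def algebra_simps)
qed

text \<open>A nonzero residual would be a fourth independent direction and embed a real space of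
  dimension 16 into one of dimension 12.\<close>

lemma hyp_basis_complete:
  assumes x: "herm x1 x1 = 0" "herm x2 x2 = 0" "herm x1 x2 = qreal 1"
    and w: "herm x1 w = 0" "herm x2 w = 0" "herm w w = qreal 1"
  shows "p = x1 \<triangleleft> herm x2 p + x2 \<triangleleft> herm x1 p + w \<triangleleft> herm w p"
proof -
  have x21: "herm x2 x1 = qreal 1" using x(3) by (metis herm_cnj qcnj_simps(7))
  have w': "herm w x1 = 0" "herm w x2 = 0" using w by (simp_all add: herm_eq_0_commute)
  define r where "r = p - (x1 \<triangleleft> herm x2 p + x2 \<triangleleft> herm x1 p + w \<triangleleft> herm w p)"
  have r: "herm x1 r = 0" "herm x2 r = 0" "herm w r = 0"
    using x x21 w w' by (simp_all add: r_def herm.diff_right herm.add_right qmul_bilin)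
  have r': "herm r x1 = 0" "herm r x2 = 0" "herm r w = 0" using r by (simp_all add: herm_eq_0_commute)
  have "r = 0"
  proof (rule ccontr)
    assume "r \<noteq> 0"
    then have rr: "herm r r \<noteq> 0" using hyp_plane_perp[OF x r(1,2)] by (metis zero_index)
    define L where "L y = x1 \<triangleleft> (y$0) + x2 \<triangleleft> (y$1) + w \<triangleleft> (y$2) + r \<triangleleft> (y$3)" for y :: "quat^4"
    have lin: "linear L"
      by (auto intro!: linearI simp: L_def qscal.add_right qscal.scaleR_right algebra_simps)
    have "inj L"
    proof (subst linear_injective_0[OF lin], intro allI impI)
      fix y assume y: "L y = 0"
      have "herm x2 (L y) = y$0" "herm x1 (L y) = y$1" "herm w (L y) = y$2" "herm r (L y) = herm r r \<odot> y$3"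
        using x x21 w w' r r' by (simp_all add: L_def herm.add_right qmul_bilin)
      then have "y$0 = 0 \<and> y$1 = 0 \<and> y$2 = 0 \<and> y$3 = 0" using y rr by (simp add: herm.zero_right)
      then show "y = 0" by (simp add: vec_eq_iff[of y] all4)
    qed
    then have "dim (range L) = dim (UNIV :: (quat^4) set)"
      by (intro dim_image_eq[OF lin]) (simp add: inj_on_subset)
    then have "DIM(quat^4) \<le> DIM(qvec)" by (metis dim_UNIV dim_subset_UNIV)
    then show False by simp
  qed
  then show ?thesis by (simp add: r_def)
qed

section \<open>The trace condition on the spanned algebra\<close>

locale real_trace_group = discrete_group +
  assumes real_trace: "\<And>g. g \<in> G \<Longrightarrow> qmat_trace g \<in> range qreal"
begin

abbreviation "alg \<equiv> span G"

lemma alg_trace: "A \<in> alg \<Longrightarrow> qmat_trace A \<in> range qreal"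
proof (induction A rule: span_induct_alt)
  case base
  have "qmat_trace 0 = qreal 0" by (simp add: qmat_trace_def)
  then show ?case by blast
next
  case (step c g A)
  obtain a b where "qmat_trace g = qreal a" "qmat_trace A = qreal b" using step real_trace[of g] by blast
  moreover have "qmat_trace (c *\<^sub>R g + A) = c *\<^sub>R qmat_trace g + qmat_trace A"
    by (simp add: qmat_trace_def sum3 algebra_simps)
  ultimately have "qmat_trace (c *\<^sub>R g + A) = qreal (c * a + b)" by simp
  then show ?case by blast
qed

text \<open>The only use of the trace hypothesis.\<close>

lemma trace_perp: "outer x y \<in> alg \<Longrightarrow> q $ 0 = 0 \<Longrightarrow> herm y (lmul q x) $ 0 = 0"
proof -
  assume o: "outer x y \<in> alg" and q: "q $ 0 = 0"
  obtain r where "qmat_trace (outer x y) = qreal r" using alg_trace[OF o] by blast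
  then show ?thesis using Re_trace_outer[of q x y] q by simp
qed

lemma alg_outer_mult: "outer (x \<triangleleft> a) y \<in> alg \<Longrightarrow> outer (z \<triangleleft> b) w \<in> alg \<Longrightarrow> outer (x \<triangleleft> (a \<odot> herm y z \<odot> b)) w \<in> alg"
  using span_mult[of "outer (x \<triangleleft> a) y" "outer (z \<triangleleft> b) w"] by (simp add: outer_outer qscal_assoc qmul_assoc)

lemma alg_outer_dag: "outer (x \<triangleleft> a) y \<in> alg \<Longrightarrow> outer (y \<triangleleft> qcnj a) x \<in> alg"
  using span_dag[of "outer (x \<triangleleft> a) y"] by (simp add: outer_scal)

lemma alg_outer_dag1: "outer x y \<in> alg \<Longrightarrow> outer y x \<in> alg"
  using span_dag[of "outer x y"] by simp

lemma alg_outer_G: "outer (x \<triangleleft> a) y \<in> alg \<Longrightarrow> g \<in> G \<Longrightarrow> outer (z \<triangleleft> b) w \<in> alg \<Longrightarrow> outer (x \<triangleleft> (a \<odot> herm y (g \<triangleright> z) \<odot> b)) w \<in> alg"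
proof -
  assume a: "outer (x \<triangleleft> a) y \<in> alg" "g \<in> G" "outer (z \<triangleleft> b) w \<in> alg"
  have "outer (x \<triangleleft> a) y \<otimes> (g \<otimes> outer (z \<triangleleft> b) w) \<in> alg"
    using a by (intro span_mult span_base[of g]) auto
  then show ?thesis by (simp add: qmat_mult_outer(1) outer_outer qscal_assoc qmul_assoc)
qed

end

section \<open>The invariant real or complex form\<close>

context discrete_group begin

lemma limit_vecs_isotropic: "x \<in> limit_vecs \<Longrightarrow> x \<noteq> 0" "x \<in> limit_vecs \<Longrightarrow> herm x x = 0"
  by (auto simp: limit_vecs_def)

lemma limit_vecs_scal: "x \<in> limit_vecs \<Longrightarrow> s \<noteq> 0 \<Longrightarrow> x \<triangleleft> s \<in> limit_vecs"
proof -
  assume x: "x \<in> limit_vecs" and s: "s \<noteq> 0"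
  then obtain y where y: "y \<noteq> 0" "herm y y = 0" "outer x y \<in> rescaled_limits" by (auto simp: limit_vecs_def)
  have "outer (x \<triangleleft> s) (y \<triangleleft> qcnj (qinv s)) = outer x y"
    using s by (simp add: outer_scal qscal_assoc qinv_right)
  moreover have "y \<triangleleft> qcnj (qinv s) \<noteq> 0" using y s by simp
  ultimately show ?thesis using x s y unfolding limit_vecs_def
    by (auto simp: qmul_bilin intro!: exI[of _ "y \<triangleleft> qcnj (qinv s)"])
qed

lemma limit_vecs_G: "x \<in> limit_vecs \<Longrightarrow> g \<in> G \<Longrightarrow> g \<triangleright> x \<in> limit_vecs"
proof -
  assume x: "x \<in> limit_vecs" and g: "g \<in> G"
  then obtain y where y: "y \<noteq> 0" "herm y y = 0" "outer x y \<in> rescaled_limits" by (auto simp: limit_vecs_def)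
  have "outer (g \<triangleright> x) y \<in> rescaled_limits" using rescaled_limits_mult[OF y(3) g] by (simp add: qmat_mult_outer)
  moreover have "g \<triangleright> x \<noteq> 0"
    using G_dag_vec(1)[OF g, of x] limit_vecs_isotropic(1)[OF x] by (metis qmat_vec.zero_right)
  ultimately show ?thesis using x y g by (auto simp: limit_vecs_def)
qed
end

text \<open>The normalized pair x1, x2 makes composition of operators x1 d <x2, . > the product of
  quaternions. The coefficients e1 and e2, which \<open>trans\<close> provides for equal arguments,
  need not lie in D and are therefore carried along.\<close>

locale frame = real_trace_group +
  fixes x1 x2 :: qvec and e1 e2 :: quat
  assumes xL: "x1 \<in> limit_vecs" "x2 \<in> limit_vecs"
    and x12: "herm x1 x2 = qreal 1"
    and trans: "\<And>x y. x \<in> limit_vecs \<Longrightarrow> y \<in> limit_vecs \<Longrightarrow> \<exists>d. d \<noteq> 0 \<and> outer (x \<triangleleft> d) y \<in> alg"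
    and e: "e1 \<noteq> 0" "outer (x1 \<triangleleft> e1) x1 \<in> alg" "e2 \<noteq> 0" "outer (x2 \<triangleleft> e2) x2 \<in> alg"
begin

lemma x21: "herm x2 x1 = qreal 1" using x12 by (metis herm_cnj qcnj_simps(7))

lemma x11: "herm x1 x1 = 0" and x22: "herm x2 x2 = 0" using xL limit_vecs_isotropic by auto

lemma x1_nz: "x1 \<noteq> 0" and x2_nz: "x2 \<noteq> 0" using xL limit_vecs_isotropic by auto

lemmas hyp = x11 x22 x12

definition D :: "quat set" where "D = {d. outer (x1 \<triangleleft> d) x2 \<in> alg}"

lemma outer_add_scal: "outer (x \<triangleleft> (a + b)) y = outer (x \<triangleleft> a) y + outer (x \<triangleleft> b) y"
  "outer (x \<triangleleft> (r *\<^sub>R a)) y = r *\<^sub>R outer (x \<triangleleft> a) y"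
  by (rule qmat_eqI; simp add: qmat_vec.add_left qmat_vec.scaleR_left qscal.add_right qscal.add_left qscal.scaleR_right qscal.scaleR_left)+

lemma D_subspace: "subspace D"
  unfolding subspace_def D_def
proof (intro conjI allI impI ballI; (simp only: mem_Collect_eq)?)
  have "outer (x1 \<triangleleft> 0) x2 = 0" by (rule qmat_eqI) (simp add: qscal.zero_right qscal.zero_left qmat_vec.zero_left)
  then show "outer (x1 \<triangleleft> 0) x2 \<in> alg" by (simp add: span_zero)
qed (simp_all add: outer_add_scal span_add span_scale)

lemma D_mult: "a \<in> D \<Longrightarrow> b \<in> D \<Longrightarrow> a \<odot> b \<in> D"
  using alg_outer_mult[of x1 a x2 x1 b x2] by (simp add: D_def x21)

lemma D_nz: "\<exists>d\<in>D. d \<noteq> 0" using trans[OF xL] unfolding D_def by blast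

lemma D_one: "qreal 1 \<in> D"
proof -
  obtain d where d: "d \<in> D" "d \<noteq> 0" using D_nz by blast
  show ?thesis by (rule subalgebra_cases(1)[OF D_subspace _ d]) (rule D_mult)
qed

lemma D_cases: "D = range qreal \<or> D = UNIV \<or> (\<exists>u. imag_unit u \<and> D = cent u)"
proof -
  obtain d where d: "d \<in> D" "d \<noteq> 0" using D_nz by blast
  show ?thesis by (rule subalgebra_cases(2)[OF D_subspace _ d]) (rule D_mult)
qed

text \<open>The adjoint sends x1 d <x2, . > to an operator x2 d' <x1, . >, so it does not give
  closure under conjugation directly; the classification of D does.\<close>

lemma D_cnj:
  assumes d: "d \<in> D" shows "qcnj d \<in> D"
proof -
  consider "D = range qreal" | "D = UNIV" | u where "imag_unit u" "D = cent u" using D_cases by blast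
  then show ?thesis
  proof cases
    case 1
    then obtain r where "d = qreal r" using d by blast
    then have "qcnj d = d" by simp
    then show ?thesis using d by simp
  next
    case 2
    then show ?thesis by simp
  next
    case 3
    then show ?thesis using d by (simp add: imag_unit_def cent_cnj)
  qed
qed

lemma D_qreal: "qreal r \<in> D"
  using subspace_scale[OF D_subspace D_one, of r] by simp

lemma o12: "d \<in> D \<Longrightarrow> outer (x1 \<triangleleft> d) x2 \<in> alg" by (simp add: D_def)

lemma o21: "d \<in> D \<Longrightarrow> outer (x2 \<triangleleft> d) x1 \<in> alg"
  using alg_outer_dag[OF o12[OF D_cnj]] by simp

lemma o11: "d \<in> D \<Longrightarrow> outer (x1 \<triangleleft> (e1 \<odot> d)) x1 \<in> alg"
  using alg_outer_mult[OF e(2) o21[of d]] by (simp add: x12)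

lemma o22: "d \<in> D \<Longrightarrow> outer (x2 \<triangleleft> (e2 \<odot> d)) x2 \<in> alg"
  using alg_outer_mult[OF e(4) o12[of d]] by (simp add: x21)

text \<open>Operators x1 e1 <x1, . > and x2 e2 <x2, . > compose to an operator of the kind recorded
  by D, because <x1, x2> = 1. These products are the available constraints on e1 and e2.\<close>

lemma e12: "e1 \<odot> e2 \<in> D"
  using alg_outer_mult[OF e(2,4)] by (simp add: x12 D_def)

lemma e1de2: "d \<in> D \<Longrightarrow> e1 \<odot> d \<odot> e2 \<in> D"
  using alg_outer_mult[OF o11 e(4)] by (simp add: x12 D_def)

lemma e1cnj: "qcnj e1 \<odot> e2 \<in> D"
  using alg_outer_mult[OF alg_outer_dag[OF e(2)] e(4)] by (simp add: x12 D_def)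

text \<open>The trace condition on the four kinds of operators: the entries of \<open>lmul q\<close>
  in the frame are orthogonal to D, where <x1, q x1> and <x2, q x2> must first be multiplied by e1
  and e2.\<close>

lemma t12: "q $ 0 = 0 \<Longrightarrow> d \<in> D \<Longrightarrow> (herm x2 (lmul q x1) \<odot> d) $ 0 = 0"
  using trace_perp[OF o12, of d q] by (simp add: lmul_scal del: qmul_nth)

lemma t21: "q $ 0 = 0 \<Longrightarrow> d \<in> D \<Longrightarrow> (herm x1 (lmul q x2) \<odot> d) $ 0 = 0"
  using trace_perp[OF o21, of d q] by (simp add: lmul_scal del: qmul_nth)

lemma t11: "q $ 0 = 0 \<Longrightarrow> d \<in> D \<Longrightarrow> (herm x1 (lmul q x1) \<odot> e1 \<odot> d) $ 0 = 0"
  using trace_perp[OF o11, of d q] by (simp add: lmul_scal qmul_assoc del: qmul_nth)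

lemma t22: "q $ 0 = 0 \<Longrightarrow> d \<in> D \<Longrightarrow> (herm x2 (lmul q x2) \<odot> e2 \<odot> d) $ 0 = 0"
  using trace_perp[OF o22, of d q] by (simp add: lmul_scal qmul_assoc del: qmul_nth)

lemma lmul_isotropic: "herm x x = 0 \<Longrightarrow> herm (lmul q x) (lmul q x) = 0"
proof -
  assume "herm x x = 0"
  moreover have "lmul (qreal r) x = r *\<^sub>R x" for r by (simp add: lmul_def qvec_eq_iff)
  ultimately show ?thesis by (simp add: herm_lmul lmul_lmul qcnj_mult_self herm.scaleR_right)
qed

text \<open>Orthogonality to all of H kills both <x1, k x1> and <x2, k x1>. The first makes k x1 a
  right multiple of x1, the second makes that multiple zero, but k is invertible.\<close>

lemma D_not_UNIV: "D \<noteq> UNIV"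
proof
  assume D: "D = UNIV"
  have 1: "herm x2 (lmul qk x1) = 0" using t12[OF ijk(4)] D by (intro Re_zero) auto
  have "herm x1 (lmul qk x1) \<odot> e1 = 0" using t11[OF ijk(4)] D by (intro Re_zero) auto
  then have 2: "herm x1 (lmul qk x1) = 0" using e by simp
  obtain l where l: "lmul qk x1 = x1 \<triangleleft> l"
    using isotropic_perp_parallel[OF x11 lmul_isotropic[OF x11] 2 x1_nz] by blast
  then have "l = 0" using 1 x21 by simp
  then have "lmul qk x1 = 0" using l by simp
  then show False using x1_nz ijk(5) lmul_eq_0 by blast
qed

section \<open>Position of \<open>e1\<close> and \<open>e2\<close> relative to D\<close>

lemma anti_perp:
  assumes "imag_unit u" "D = cent u" "\<And>d. d \<in> D \<Longrightarrow> (h \<odot> d) $ 0 = 0"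
  shows "h \<in> anti u"
proof (rule antiI[OF assms(1)])
  show "h $ 0 = 0" using assms(3)[of "qreal 1"] D_one by simp
  show "(h \<odot> u) $ 0 = 0" using assms(2) by (intro assms(3)) (simp add: cent_basic)
qed

text \<open>The conjugate v of u by e1 lies in the commutative field \<open>cent u\<close>, being
  the quotient of e1 u e2 by e1 e2. It squares to -1 there, so it is u or -u.\<close>

lemma e1_dichotomy:
  assumes u: "imag_unit u" and D: "D = cent u"
  shows "e1 \<in> cent u \<or> e1 \<in> anti u"
proof -
  have u0: "u $ 0 = 0" using u by (simp add: imag_unit_def)
  define v where "v = e1 \<odot> u \<odot> qinv e1"
  have "v \<odot> (e1 \<odot> e2) = e1 \<odot> u \<odot> e2"
    using e(1) by (simp add: v_def qmul_assoc) (simp add: qinv_left flip: qmul_assoc)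
  then have "v = e1 \<odot> u \<odot> e2 \<odot> qinv (e1 \<odot> e2)" using e by (metis qinv_right qmul_assoc qmul_eq_0 qmul_qreal(2) scaleR_one)
  moreover have "e1 \<odot> u \<odot> e2 \<in> cent u" using e1de2[of u] D by (simp add: cent_basic)
  ultimately have vc: "v \<in> cent u" using e12 D by (auto intro!: cent_cent cent_inv u0)
  have "v \<odot> v = e1 \<odot> (u \<odot> (qinv e1 \<odot> e1) \<odot> u) \<odot> qinv e1" by (simp add: v_def qmul_assoc)
  also have "\<dots> = - qreal 1" using e(1) imag_unit_sq[OF u] by (simp add: qinv_left qinv_right qmul_bilin)
  finally have vv: "v \<odot> v = u \<odot> u" using imag_unit_sq[OF u] by simp
  have "(v - u) \<odot> (v + u) = 0" using vc vv by (simp add: qmul_bilin cent_def)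
  then have "v = u \<or> v = - u" by (auto simp: eq_neg_iff_add_eq_0)
  moreover have "v \<odot> e1 = e1 \<odot> u" using e(1) by (simp add: v_def qmul_assoc qinv_left)
  ultimately show ?thesis by (auto simp: cent_def anti_def qmul_bilin)
qed

lemma plane_herm: "herm (x1 \<triangleleft> a + x2 \<triangleleft> b) (x1 \<triangleleft> c + x2 \<triangleleft> d) = qcnj a \<odot> d + qcnj b \<odot> c"
  by (simp add: herm.add_left herm.add_right x11 x22 x12 x21 qmul_bilin)

text \<open>The spinorial case: here \<open>alg\<close> would act on $x_1\mathbb{H} + x_2\mathbb{H}$ through $\mathrm{SL}(2,\mathbb{C})$.\<close>

lemma not_anti:
  assumes u: "imag_unit u" and D: "D = cent u"
  shows "e1 \<notin> anti u"
proof
  assume e1: "e1 \<in> anti u"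
  have u0: "u $ 0 = 0" using u by (simp add: imag_unit_def)
  have i1: "qinv e1 \<in> anti u" using e1 u0 anti_inv by blast
  have "e2 = qinv e1 \<odot> (e1 \<odot> e2)" using e(1) by (simp add: qinv_left flip: qmul_assoc)
  moreover have "qinv e1 \<odot> (e1 \<odot> e2) \<in> anti u" using anti_cent[OF i1] e12 D by blast
  ultimately have e2: "e2 \<in> anti u" by metis
  \<comment> \<open>Cancelling the anticommuting e1 moves the entry from \<open>anti u\<close> to
    \<open>cent u\<close>.\<close>
  have h1: "herm x1 (lmul q x1) \<in> cent u" if "q $ 0 = 0" for q
  proof -
    have "herm x1 (lmul q x1) \<odot> e1 \<in> anti u" using t11[OF that] by (intro anti_perp u D)
    then have "herm x1 (lmul q x1) \<odot> e1 \<odot> qinv e1 \<in> cent u" using i1 by (rule anti_anti)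
    then show ?thesis using e(1) by (simp add: qmul_assoc qinv_right)
  qed
  have h2: "herm x2 (lmul q x2) \<in> cent u" if "q $ 0 = 0" for q
  proof -
    have "herm x2 (lmul q x2) \<odot> e2 \<in> anti u" using t22[OF that] by (intro anti_perp u D)
    then have "herm x2 (lmul q x2) \<odot> e2 \<odot> qinv e2 \<in> cent u" using anti_inv[OF u0 e2] by (rule anti_anti)
    then show ?thesis using e(3) by (simp add: qmul_assoc qinv_right)
  qed
  have h12: "herm x2 (lmul q x1) \<in> anti u" if "q $ 0 = 0" for q using t12[OF that] by (intro anti_perp u D)
  have h21: "herm x1 (lmul q x2) \<in> anti u" if "q $ 0 = 0" for q using t21[OF that] by (intro anti_perp u D)
  \<comment> \<open>The two coordinates have opposite parity, so their product is imaginary and q x1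
    stays in the plane.\<close>
  have d1: "lmul q x1 = x1 \<triangleleft> herm x2 (lmul q x1) + x2 \<triangleleft> herm x1 (lmul q x1)" if q: "q $ 0 = 0" for q
    using anti_Re[OF u anti_cent[OF anti_cnj[OF u0 h12[OF q]] h1[OF q]]]
    by (intro hyp_plane_isotropic hyp lmul_isotropic x11)
  have d2: "lmul q x2 = x1 \<triangleleft> herm x2 (lmul q x2) + x2 \<triangleleft> herm x1 (lmul q x2)" if q: "q $ 0 = 0" for q
    using anti_Re[OF u cent_anti[OF cent_cnj[OF u0 h2[OF q]] h21[OF q]]]
    by (intro hyp_plane_isotropic hyp lmul_isotropic x22)
  have k: "herm x (lmul qk x1) = - herm (lmul qi x) (lmul qj x1)" for x
  proof -
    have "lmul qk x1 = lmul qi (lmul qj x1)" by (simp add: lmul_lmul ijk)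
    moreover have "lmul (- qi) z = - lmul qi z" for z by (simp add: lmul_def qvec_eq_iff qmul_bilin)
    ultimately show ?thesis by (simp add: herm_lmul qcnj_imag ijk herm.minus_right)
  qed
  \<comment> \<open>Computed as i after j, this entry is a sum of products of equal parity, hence
    commutes with u; the trace condition makes it anticommute. For <x1, k x1> the two parities are
    exchanged, with the same conflict.\<close>
  have "herm x2 (lmul qk x1) \<in> cent u"
  proof -
    have "herm (lmul qi x2) (lmul qj x1) = qcnj (herm x2 (lmul qi x2)) \<odot> herm x1 (lmul qj x1)
        + qcnj (herm x1 (lmul qi x2)) \<odot> herm x2 (lmul qj x1)"
      using arg_cong2[where f = herm, OF d2[OF ijk(2)] d1[OF ijk(3)]] unfolding plane_herm .
    then have "herm (lmul qi x2) (lmul qj x1) \<in> cent u"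
      using cent_basic(1)[OF cent_cent[OF cent_cnj[OF u0 h2[OF ijk(2)]] h1[OF ijk(3)]]
        anti_anti[OF anti_cnj[OF u0 h21[OF ijk(2)]] h12[OF ijk(3)]]] by metis
    then show ?thesis unfolding k by (rule cent_basic(3))
  qed
  then have z1: "herm x2 (lmul qk x1) = 0" using h12[OF ijk(4)] cent_anti_disjoint imag_unit_nz[OF u] by blast
  have "herm x1 (lmul qk x1) \<in> anti u"
  proof -
    have "herm (lmul qi x1) (lmul qj x1) = qcnj (herm x2 (lmul qi x1)) \<odot> herm x1 (lmul qj x1)
        + qcnj (herm x1 (lmul qi x1)) \<odot> herm x2 (lmul qj x1)"
      using arg_cong2[where f = herm, OF d1[OF ijk(2)] d1[OF ijk(3)]] unfolding plane_herm .
    then have "herm (lmul qi x1) (lmul qj x1) \<in> anti u"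
      using anti_basic(1)[OF anti_cent[OF anti_cnj[OF u0 h12[OF ijk(2)]] h1[OF ijk(3)]]
        cent_anti[OF cent_cnj[OF u0 h1[OF ijk(2)]] h12[OF ijk(3)]]] by metis
    then show ?thesis unfolding k by (rule anti_basic(2))
  qed
  then have z2: "herm x1 (lmul qk x1) = 0" using h1[OF ijk(4)] cent_anti_disjoint imag_unit_nz[OF u] by blast
  have "lmul qk x1 = 0" using d1[OF ijk(4)] unfolding z1 z2 by (simp add: qscal.zero_right)
  then show False using x1_nz ijk(5) lmul_eq_0 by blast
qed

lemma e1_cent: "imag_unit u \<Longrightarrow> D = cent u \<Longrightarrow> e1 \<in> cent u"
  using e1_dichotomy not_anti by blast

text \<open>A suitable right multiple of x has a transition operator to x1 with coefficient 1;
  composing its adjoint with the known operators places both coordinates of x in D, one of them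
  after multiplication by e2.\<close>

lemma limit_vecs_normalized:
  assumes "x \<in> limit_vecs"
  obtains s where "s \<noteq> 0" "outer (x \<triangleleft> s) x1 \<in> alg" "herm (x \<triangleleft> s) x1 \<in> D" "herm (x \<triangleleft> s) x2 \<odot> e2 \<in> D"
proof -
  obtain s where s: "s \<noteq> 0" "outer (x \<triangleleft> s) x1 \<in> alg" using trans[OF assms xL(1)] by blast
  have o: "outer (x1 \<triangleleft> qreal 1) (x \<triangleleft> s) \<in> alg" using alg_outer_dag1[OF s(2)] by simp
  have "herm (x \<triangleleft> s) x1 \<in> D" using alg_outer_mult[OF o o12[OF D_one]] by (simp add: D_def)
  moreover have "herm (x \<triangleleft> s) x2 \<odot> e2 \<in> D" using alg_outer_mult[OF o e(4)] by (simp add: D_def)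
  ultimately show ?thesis using that s by blast
qed

definition in_plane :: "qvec \<Rightarrow> bool" where
  "in_plane p \<longleftrightarrow> p = x1 \<triangleleft> herm x2 p + x2 \<triangleleft> herm x1 p"

lemma in_plane_scal: "s \<noteq> 0 \<Longrightarrow> in_plane (p \<triangleleft> s) \<Longrightarrow> in_plane p"
proof -
  assume s: "s \<noteq> 0" and "in_plane (p \<triangleleft> s)"
  then have "p \<triangleleft> s \<triangleleft> qinv s = (x1 \<triangleleft> herm x2 (p \<triangleleft> s) + x2 \<triangleleft> herm x1 (p \<triangleleft> s)) \<triangleleft> qinv s"
    unfolding in_plane_def by metis
  then show ?thesis using s by (simp add: in_plane_def qscal_assoc qscal.add_left qinv_right qmul_assoc)
qed

lemma in_plane_isotropic: "herm p p = 0 \<Longrightarrow> (qcnj (herm x2 p) \<odot> herm x1 p) $ 0 = 0 \<Longrightarrow> in_plane p"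
  unfolding in_plane_def by (rule hyp_plane_isotropic[OF hyp])


text \<open>If D is complex, e1 commutes with it and lies in D, and e2 follows from e1 e2. If D is
  real, e1 e2 and the product of the conjugate of e1 with e2 are real, so e1 is real or imaginary. A
  real e1 lies in D; an imaginary one provides u and confines the limit set to the plane.\<close>

lemma reduction:
  "(\<exists>u. imag_unit u \<and> D \<subseteq> cent u \<and> e1 \<in> cent u \<and> e2 \<in> cent u) \<and>
   ((\<forall>x\<in>limit_vecs. in_plane x) \<or> (D = range qreal \<or> (\<exists>u. imag_unit u \<and> D = cent u)) \<and> e1 \<in> D \<and> e2 \<in> D)"
proof -
  consider "D = range qreal" | u where "imag_unit u" "D = cent u" using D_cases D_not_UNIV by blast
  then show ?thesis
  proof cases
    case 2
    have u0: "u $ 0 = 0" using 2 by (simp add: imag_unit_def)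
    have e1: "e1 \<in> cent u" by (rule e1_cent[OF 2])
    have "e2 = qinv e1 \<odot> (e1 \<odot> e2)" using e(1) by (simp add: qinv_left flip: qmul_assoc)
    moreover have "qinv e1 \<odot> (e1 \<odot> e2) \<in> cent u" using cent_cent[OF cent_inv[OF u0 e1]] e12 2 by blast
    ultimately have e2: "e2 \<in> cent u" by metis
    then show ?thesis using 2 e1 by auto
  next
    case 1
    obtain p where p: "e1 \<odot> e2 = qreal p" using e12 1 by auto
    obtain p' where p': "qcnj e1 \<odot> e2 = qreal p'" using e1cnj 1 by auto
    have p0: "p \<noteq> 0" using p e by (metis qmul_eq_0 qreal_simps(7))
    have e2: "e2 = p *\<^sub>R qinv e1"
    proof -
      have "qinv e1 \<odot> (e1 \<odot> e2) = p *\<^sub>R qinv e1" using p by simp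
      then show ?thesis using e(1) by (simp add: qinv_left flip: qmul_assoc)
    qed
    have e2': "e2 = (p / (norm e1)\<^sup>2) *\<^sub>R qcnj e1" unfolding e2 by (simp add: qinv_def)
    have "qcnj e1 \<odot> e2 = (p / (norm e1)\<^sup>2) *\<^sub>R (qcnj e1 \<odot> qcnj e1)" unfolding e2' by (simp add: qmul_bilin)
    then have A: "(p / (norm e1)\<^sup>2) *\<^sub>R (qcnj e1 \<odot> qcnj e1) = qreal p'" using p' by simp
    have c: "p / (norm e1)\<^sup>2 \<noteq> 0" using p0 e(1) by simp
    have "qcnj e1 \<odot> qcnj e1 = inverse (p / (norm e1)\<^sup>2) *\<^sub>R ((p / (norm e1)\<^sup>2) *\<^sub>R (qcnj e1 \<odot> qcnj e1))"
      using left_inverse[OF c] by (metis scaleR_one scaleR_scaleR)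
    also have "\<dots> = qreal (inverse (p / (norm e1)\<^sup>2) * p')" unfolding A by simp
    finally have "e1$0 * e1$1 = 0" "e1$0 * e1$2 = 0" "e1$0 * e1$3 = 0"
      by (auto simp: quat_eq_iff)
    then consider "e1 = qreal (e1$0)" | "e1 $ 0 = 0" by (auto simp: quat_eq_iff)
    then show ?thesis
    proof cases
      assume r: "e1 = qreal (e1$0)"
      then have "e1 \<in> D" by (metis D_qreal)
      have "qcnj e1 = qreal (e1$0)" using r by (metis qcnj_simps(7))
      then have "e2 = qreal (p / (norm e1)\<^sup>2 * e1$0)" unfolding e2' by simp
      then have "e2 \<in> D" by (metis D_qreal)
      \<comment> \<open>Everything is real here, so any imaginary unit serves as u.\<close>
      have "D \<subseteq> cent qi" by (simp add: 1 image_subset_iff cent_basic)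
      then show ?thesis using 1 \<open>e1 \<in> D\<close> \<open>e2 \<in> D\<close> imag_unit_qi by blast
    next
      assume i: "e1 $ 0 = 0"
      define u where "u = (1 / norm e1) *\<^sub>R e1"
      have u: "imag_unit u" using i e(1) by (simp add: u_def imag_unit_def)
      have e1u: "e1 \<in> cent u" by (simp add: u_def cent_def qmul_bilin)
      have "e2 \<in> cent u" unfolding e2' using u e1u by (simp add: cent_basic cent_cnj imag_unit_def)
      \<comment> \<open>After scaling, one coordinate is real and the other a real multiple of the
        inverse of the imaginary e2; the product is imaginary, as membership in the plane
        requires.\<close>
      have "in_plane x" if xL: "x \<in> limit_vecs" for x
      proof -
        obtain s where s: "s \<noteq> 0" "outer (x \<triangleleft> s) x1 \<in> alg" "herm (x \<triangleleft> s) x1 \<in> D" "herm (x \<triangleleft> s) x2 \<odot> e2 \<in> D"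
          by (rule limit_vecs_normalized[OF xL])
        obtain a where a: "herm (x \<triangleleft> s) x1 = qreal a" using s(3) 1 by auto
        obtain b where b: "herm (x \<triangleleft> s) x2 \<odot> e2 = qreal b" using s(4) 1 by auto
        have "herm (x \<triangleleft> s) x2 \<odot> e2 \<odot> qinv e2 = qreal b \<odot> qinv e2" using b by simp
        then have b': "herm (x \<triangleleft> s) x2 = b *\<^sub>R qinv e2" using e(3) by (simp add: qmul_assoc qinv_right)
        have "qinv e2 $ 0 = 0" unfolding qinv_def e2' using i by simp
        have a': "herm x1 (x \<triangleleft> s) = qreal a" using a by (metis herm_cnj qcnj_simps(7))
        have "qcnj (herm x2 (x \<triangleleft> s)) = b *\<^sub>R qinv e2" using b' by (metis herm_cnj)
        then have "(qcnj (herm x2 (x \<triangleleft> s)) \<odot> herm x1 (x \<triangleleft> s)) $ 0 = 0"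
          unfolding a' using \<open>qinv e2 $ 0 = 0\<close> by simp
        then have "in_plane (x \<triangleleft> s)"
          using limit_vecs_isotropic(2)[OF limit_vecs_scal[OF xL s(1)]] by (intro in_plane_isotropic)
        then show "in_plane x" using in_plane_scal s by blast
      qed
      moreover have "D \<subseteq> cent u" by (simp add: 1 image_subset_iff cent_basic)
      ultimately show ?thesis using u e1u \<open>e2 \<in> cent u\<close> by blast
    qed
  qed
qed

text \<open>G permutes the limit vectors, so g x has only two coordinates. Sandwiching g between
  known operators of the algebra places them in D up to a left factor e1 and a right factor e2,
  which are cancelled inside \<open>cent u\<close>.\<close>

lemma plane_case:
  assumes u: "imag_unit u" "D \<subseteq> cent u" "e1 \<in> cent u" "e2 \<in> cent u" and L: "\<forall>x\<in>limit_vecs. in_plane x"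
    and g: "g \<in> G" and x: "x \<in> {x1, x2}"
  shows "\<exists>a\<in>cent u. \<exists>b\<in>cent u. g \<triangleright> x = x1 \<triangleleft> a + x2 \<triangleleft> b"
proof -
  have u0: "u $ 0 = 0" using u by (simp add: imag_unit_def)
  have gx: "g \<triangleright> x = x1 \<triangleleft> herm x2 (g \<triangleright> x) + x2 \<triangleleft> herm x1 (g \<triangleright> x)"
    using L limit_vecs_G[of x g] xL x g unfolding in_plane_def by blast
  have cl: "h \<in> cent u" if "e1 \<odot> h \<in> cent u" for h
  proof -
    have "qinv e1 \<odot> (e1 \<odot> h) \<in> cent u" by (intro cent_cent cent_inv u u0 that)
    then show ?thesis using e(1) by (simp add: qinv_left flip: qmul_assoc)
  qed
  have cr: "h \<in> cent u" if "h \<odot> e2 \<in> cent u" for h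
  proof -
    have "h \<odot> e2 \<odot> qinv e2 \<in> cent u" by (intro cent_cent cent_inv u u0 that)
    then show ?thesis using e(3) by (simp add: qinv_right qmul_assoc)
  qed
  have o: "outer (x1 \<triangleleft> qreal 1) x2 \<in> alg" by (rule o12[OF D_one])
  have "herm x2 (g \<triangleright> x1) \<in> D" using alg_outer_G[OF o g o] by (simp add: D_def)
  moreover have "e1 \<odot> herm x1 (g \<triangleright> x1) \<in> D" using alg_outer_G[OF e(2) g o] by (simp add: D_def)
  moreover have "herm x2 (g \<triangleright> x2) \<odot> e2 \<in> D" using alg_outer_G[OF o g e(4)] by (simp add: D_def)
  moreover have "e1 \<odot> herm x1 (g \<triangleright> x2) \<odot> e2 \<in> D" using alg_outer_G[OF e(2) g e(4)] by (simp add: D_def)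
  ultimately have "herm x2 (g \<triangleright> x) \<in> cent u" "herm x1 (g \<triangleright> x) \<in> cent u" using x u(2) cl cr by blast+
  then show ?thesis using gx by blast
qed

text \<open>A limit vector outside the plane supplies the third basis vector w as its normalized
  residual. With e1 and e2 in D, all entries of g in this basis lie in D, and a complex D is
  excluded by the conflict between the trace condition and ij = k.\<close>

lemma space_case:
  assumes Dc: "D = range qreal \<or> (\<exists>u. imag_unit u \<and> D = cent u)" and eD: "e1 \<in> D" "e2 \<in> D"
    and x3: "x3 \<in> limit_vecs" "\<not> in_plane x3"
  obtains w where "herm x1 w = 0" "herm x2 w = 0" "herm w w = qreal 1"
    "\<And>g x. g \<in> G \<Longrightarrow> x \<in> {x1, x2, w} \<Longrightarrow> \<exists>a b c. g \<triangleright> x = a *\<^sub>R x1 + b *\<^sub>R x2 + c *\<^sub>R w"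
proof -
  have Dinv: "qinv d \<in> D" if "d \<in> D" for d
  proof -
    have "qinv d = (1 / (norm d)\<^sup>2) *\<^sub>R qcnj d" by (rule qinv_def)
    then show ?thesis using subspace_scale[OF D_subspace D_cnj[OF that]] by simp
  qed
  have o11': "outer (x1 \<triangleleft> d) x1 \<in> alg" if "d \<in> D" for d
    using o11[OF D_mult[OF Dinv[OF eD(1)] that]] e(1) by (simp add: qinv_right flip: qmul_assoc)
  have o22': "outer (x2 \<triangleleft> d) x2 \<in> alg" if "d \<in> D" for d
    using o22[OF D_mult[OF Dinv[OF eD(2)] that]] e(3) by (simp add: qinv_right flip: qmul_assoc)
  obtain s where s: "s \<noteq> 0" "outer (x3 \<triangleleft> s) x1 \<in> alg" "herm (x3 \<triangleleft> s) x1 \<in> D" "herm (x3 \<triangleleft> s) x2 \<odot> e2 \<in> D"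
    by (rule limit_vecs_normalized[OF x3(1)])
  define y where "y = x3 \<triangleleft> s"
  have y: "herm y y = 0" "\<not> in_plane y" "outer y x1 \<in> alg"
    using s x3 in_plane_scal limit_vecs_isotropic(2)[OF limit_vecs_scal[OF x3(1) s(1)]] by (auto simp: y_def)
  define a where "a = herm x2 y"
  define b where "b = herm x1 y"
  have "herm y x2 \<odot> e2 \<odot> qinv e2 \<in> D" using s(4) D_mult Dinv eD unfolding y_def by blast
  then have "herm y x2 \<in> D" using e(3) by (simp add: qmul_assoc qinv_right)
  then have aD: "a \<in> D" using D_cnj herm_cnj unfolding a_def by metis
  have bD: "b \<in> D" using s(3) D_cnj herm_cnj unfolding b_def y_def by metis
  define v where "v = y - x1 \<triangleleft> herm x2 y - x2 \<triangleleft> herm x1 y"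
  have v0: "v \<noteq> 0" using y(2) by (auto simp: v_def in_plane_def algebra_simps)
  have v12: "herm x1 v = 0" "herm x2 v = 0" using hyp_plane_residual[OF hyp, of y] by (auto simp: v_def)
  have vv: "herm v v $ 0 > 0" using hyp_plane_perp[OF hyp v12] v0 by fastforce
  \<comment> \<open>The parts subtracted from y have coordinates a and b in D, so subtracting their
    operators does not leave the algebra.\<close>
  have vA: "outer v x1 \<in> alg"
  proof -
    have "outer v x1 = outer y x1 - outer (x1 \<triangleleft> a) x1 - outer (x2 \<triangleleft> b) x1"
      by (rule qmat_eqI) (simp add: v_def a_def b_def qmat_vec.diff_left qscal.diff_left)
    then show ?thesis using y(3) o11'[OF aD] o21[OF bD] by (simp add: span_diff)
  qed
  define w where "w = (1 / sqrt (herm v v $ 0)) *\<^sub>R v"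
  have w: "herm x1 w = 0" "herm x2 w = 0" using v12 by (simp_all add: w_def herm.scaleR_right)
  have "herm w w $ 0 = (1 / sqrt (herm v v $ 0)) * ((1 / sqrt (herm v v $ 0)) * (herm v v $ 0))"
    by (simp add: w_def herm.scaleR_right herm.scaleR_left)
  also have "\<dots> = 1" using vv by (simp add: field_simps)
  finally have ww: "herm w w = qreal 1" using herm_self_qreal[of w] by simp
  have "outer w x1 = (1 / sqrt (herm v v $ 0)) *\<^sub>R outer v x1"
    by (rule qmat_eqI) (simp add: w_def qmat_vec.scaleR_left qscal.scaleR_left)
  then have wA: "outer w x1 \<in> alg" using vA by (simp add: span_scale)
  have A1: "outer (x \<triangleleft> qreal 1) x1 \<in> alg" if "x \<in> {x1, x2, w}" for x
    using that o11'[OF D_one] o21[OF D_one] wA by auto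
  have A2: "outer (x \<triangleleft> qreal 1) x2 \<in> alg" if "x \<in> {x1, x2, w}" for x
    using alg_outer_mult[OF A1[OF that] o22'[OF D_one]] x12 by simp
  have gD: "herm x (g \<triangleright> y) \<in> D" if "x \<in> {x1, x2, w}" "y \<in> {x1, x2, w}" "g \<in> G" for x y g
  proof -
    have "outer (x1 \<triangleleft> qreal 1) x \<in> alg" using alg_outer_dag[OF A1[OF that(1)]] by simp
    from alg_outer_G[OF this that(3) A2[OF that(2)]] show ?thesis by (simp add: D_def)
  qed
  note cpl = hyp_basis_complete[OF hyp w ww]
  have "D = range qreal"
  proof (rule ccontr)
    assume "D \<noteq> range qreal"
    then obtain u where u: "imag_unit u" "D = cent u" using Dc by blast
    have u0: "u $ 0 = 0" using u by (simp add: imag_unit_def)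
    have h: "herm y (lmul q x) \<in> anti u" if "x \<in> {x1, x2, w}" "y \<in> {x1, x2, w}" "q $ 0 = 0" for x y q
    proof (rule anti_perp[OF u])
      fix d assume d: "d \<in> D"
      have "outer (x2 \<triangleleft> qreal 1) y \<in> alg" using alg_outer_dag[OF A2[OF that(2)]] by simp
      have "outer (x \<triangleleft> d) x1 \<in> alg"
        using alg_outer_mult[OF A1[OF that(1)] alg_outer_mult[OF o12[OF d] o21[OF D_one]]] x12 x21
          alg_outer_mult[OF A2[OF that(1)] o11'[OF d]] by simp
      from alg_outer_mult[OF this \<open>outer (x2 \<triangleleft> qreal 1) y \<in> alg\<close>] have "outer (x \<triangleleft> d) y \<in> alg" by (simp add: x12)
      from trace_perp[OF this that(3)] show "(herm y (lmul q x) \<odot> d) $ 0 = 0" by (simp add: lmul_scal del: qmul_nth)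
    qed
    have k: "herm x (lmul qk x1) = - herm (lmul qi x) (lmul qj x1)" for x
    proof -
      have "lmul qk x1 = lmul qi (lmul qj x1)" by (simp add: lmul_lmul ijk)
      moreover have "lmul (- qi) z = - lmul qi z" for z by (simp add: lmul_def qvec_eq_iff qmul_bilin)
      ultimately show ?thesis by (simp add: herm_lmul qcnj_imag ijk herm.minus_right)
    qed
    \<comment> \<open>In the full basis every product of entries of i and j pairs two anticommuting
      elements and so commutes with u, whereas entries of k anticommute with u.\<close>
    have z: "herm x (lmul qk x1) = 0" if x: "x \<in> {x1, x2, w}" for x
    proof -
      define p where "p = lmul qi x"
      define q where "q = lmul qj x1"
      have pa: "herm x1 p \<in> anti u" "herm x2 p \<in> anti u" "herm w p \<in> anti u"
        and qa: "herm x1 q \<in> anti u" "herm x2 q \<in> anti u" "herm w q \<in> anti u"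
        unfolding p_def q_def using h ijk x by auto
      have "herm p q = herm p x1 \<odot> herm x2 q + herm p x2 \<odot> herm x1 q + herm p w \<odot> herm w q"
        by (subst cpl[of q]) (simp add: herm.add_right)
      also have "\<dots> = qcnj (herm x1 p) \<odot> herm x2 q + qcnj (herm x2 p) \<odot> herm x1 q + qcnj (herm w p) \<odot> herm w q"
        by (simp add: herm_cnj)
      also have "\<dots> \<in> cent u" by (intro cent_basic(1) anti_anti anti_cnj u0 pa qa)
      finally have "herm x (lmul qk x1) \<in> cent u" unfolding k p_def q_def by (simp add: cent_basic)
      moreover have "herm x (lmul qk x1) \<in> anti u" using h x ijk by blast
      ultimately show ?thesis using cent_anti_disjoint imag_unit_nz u by blast
    qed
    have "lmul qk x1 = 0" by (subst cpl) (simp add: z qscal.zero_right)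
    then show False using x1_nz ijk(5) lmul_eq_0 by blast
  qed
  then have R: "\<exists>a. herm x (g \<triangleright> y) = qreal a" if "x \<in> {x1, x2, w}" "y \<in> {x1, x2, w}" "g \<in> G" for x y g
    using gD[OF that] by auto
  have "\<exists>a b c. g \<triangleright> x = a *\<^sub>R x1 + b *\<^sub>R x2 + c *\<^sub>R w" if g: "g \<in> G" and x: "x \<in> {x1, x2, w}" for g x
  proof -
    obtain a b c where "herm x2 (g \<triangleright> x) = qreal a" "herm x1 (g \<triangleright> x) = qreal b" "herm w (g \<triangleright> x) = qreal c"
      using R[OF _ x g] by (metis insertCI)
    then have "g \<triangleright> x = a *\<^sub>R x1 + b *\<^sub>R x2 + c *\<^sub>R w" using cpl[of "g \<triangleright> x"] by simp
    then show ?thesis by blast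
  qed
  then show ?thesis using that w ww by blast
qed

end

context real_trace_group begin

theorem invariant_frame:
  assumes L: "z1 \<in> limit_vecs" "z2 \<in> limit_vecs" "z3 \<in> limit_vecs" "herm z1 z2 \<noteq> 0" "herm z1 z3 \<noteq> 0" "herm z2 z3 \<noteq> 0"
  obtains x1 x2 where "herm x1 x1 = 0" "herm x2 x2 = 0" "herm x1 x2 = qreal 1"
    "(\<exists>u. imag_unit u \<and> (\<forall>g\<in>G. \<forall>x\<in>{x1,x2}. \<exists>a\<in>cent u. \<exists>b\<in>cent u. g \<triangleright> x = x1 \<triangleleft> a + x2 \<triangleleft> b)) \<or>
     (\<exists>w. herm x1 w = 0 \<and> herm x2 w = 0 \<and> herm w w = qreal 1 \<and>
        (\<forall>g\<in>G. \<forall>x\<in>{x1,x2,w}. \<exists>a b c. g \<triangleright> x = a *\<^sub>R x1 + b *\<^sub>R x2 + c *\<^sub>R w))"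
proof -
  define x1 where "x1 = z1"
  define x2 where "x2 = z2 \<triangleleft> qinv (herm z1 z2)"
  have x: "x1 \<in> limit_vecs" "x2 \<in> limit_vecs" "herm x1 x2 = qreal 1"
    using L limit_vecs_scal by (auto simp: x1_def x2_def qinv_right)
  note tr = limit_vecs_transition[OF L]
  obtain e1 where e1: "e1 \<noteq> 0" "outer (x1 \<triangleleft> e1) x1 \<in> alg" using tr[OF x(1,1)] by blast
  obtain e2 where e2: "e2 \<noteq> 0" "outer (x2 \<triangleleft> e2) x2 \<in> alg" using tr[OF x(2,2)] by blast
  interpret frame G x1 x2 e1 e2 by unfold_locales (use x e1 e2 tr in auto)
  have "(\<exists>u. imag_unit u \<and> (\<forall>g\<in>G. \<forall>x\<in>{x1,x2}. \<exists>a\<in>cent u. \<exists>b\<in>cent u. g \<triangleright> x = x1 \<triangleleft> a + x2 \<triangleleft> b)) \<or>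
     (\<exists>w. herm x1 w = 0 \<and> herm x2 w = 0 \<and> herm w w = qreal 1 \<and>
        (\<forall>g\<in>G. \<forall>x\<in>{x1,x2,w}. \<exists>a b c. g \<triangleright> x = a *\<^sub>R x1 + b *\<^sub>R x2 + c *\<^sub>R w))"
  proof (cases "\<forall>x\<in>limit_vecs. in_plane x")
    case True
    obtain u where u: "imag_unit u" "D \<subseteq> cent u" "e1 \<in> cent u" "e2 \<in> cent u" using reduction by blast
    show ?thesis using plane_case[OF u True] u(1) by blast
  next
    case False
    then obtain x3 where x3: "x3 \<in> limit_vecs" "\<not> in_plane x3" by blast
    have r: "D = range qreal \<or> (\<exists>u. imag_unit u \<and> D = cent u)" "e1 \<in> D" "e2 \<in> D" using reduction False by blast+
    obtain w where "herm x1 w = 0" "herm x2 w = 0" "herm w w = qreal 1"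
      "\<And>g x. g \<in> G \<Longrightarrow> x \<in> {x1, x2, w} \<Longrightarrow> \<exists>a b c. g \<triangleright> x = a *\<^sub>R x1 + b *\<^sub>R x2 + c *\<^sub>R w"
      by (rule space_case[OF r x3]) blast
    then show ?thesis by blast
  qed
  then show ?thesis using that hyp by blast
qed

end

section \<open>Totally geodesic subspaces\<close>

lemma rep_qline:
  assumes "x \<noteq> 0" obtains l where "l \<noteq> 0" "rep (qline x) = x \<triangleleft> l"
proof -
  have "x \<triangleleft> qreal 1 \<in> qline x" unfolding qline_def by blast
  then have "x \<in> qline x \<and> x \<noteq> 0" using assms by simp
  then have "rep (qline x) \<in> qline x \<and> rep (qline x) \<noteq> 0" unfolding rep_def by (rule someI)
  then show ?thesis using that unfolding qline_def by fastforce
qed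

lemma herm_scal_self: "herm (x \<triangleleft> l) (x \<triangleleft> l) $ 0 = (norm l)\<^sup>2 * (herm x x $ 0)"
proof -
  have "herm (x \<triangleleft> l) (x \<triangleleft> l) = qcnj l \<odot> (qreal (herm x x $ 0) \<odot> l)"
    using herm_self_qreal[of x] by (simp add: qmul_assoc)
  then show ?thesis by (simp add: qmul_bilin qcnj_mult_self del: qmul_nth)
qed

lemma neg_nz: "herm x x $ 0 < 0 \<Longrightarrow> x \<noteq> 0" by (auto simp: herm.zero_left)

text \<open>The quotient is homogeneous under right scaling, so the representative chosen by
  \<open>rep\<close> does not matter.\<close>

lemma distHH_qline:
  assumes "herm x x $ 0 < 0" "herm y y $ 0 < 0"
  shows "distHH (qline x) (qline y) = hypdist_of ((norm (herm x y))\<^sup>2 / ((herm x x $ 0) * (herm y y $ 0)))"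
proof -
  obtain l where l: "l \<noteq> 0" "rep (qline x) = x \<triangleleft> l" using rep_qline neg_nz assms(1) by metis
  obtain m where m: "m \<noteq> 0" "rep (qline y) = y \<triangleleft> m" using rep_qline neg_nz assms(2) by metis
  have "(norm (herm (x \<triangleleft> l) (y \<triangleleft> m)))\<^sup>2 = (norm l)\<^sup>2 * (norm m)\<^sup>2 * (norm (herm x y))\<^sup>2"
    by (simp add: norm_qmul power_mult_distrib)
  then show ?thesis using l(1) m(1) unfolding distHH_def Let_def l(2) m(2) herm_scal_self
    by (simp del: herm_scal)
qed

lemma distHH_unit:
  assumes "herm x x = qreal (-1)" "herm y y = qreal (-1)"
  shows "distHH (qline x) (qline y) = 2 * arcosh (norm (herm x y))"
  using distHH_qline[of x y] assms by (simp add: hypdist_of_def)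

lemma rev_cauchy_schwarz:
  assumes "herm x x = qreal (-1)" "herm z z = qreal (-1)"
  shows "norm (herm z x) \<ge> 1"
proof -
  define X where "X = x + z \<triangleleft> herm z x"
  have zX: "herm z X = 0" using assms by (simp add: X_def herm.add_right)
  have "herm X X = herm x X" using zX by (simp add: X_def herm.add_left qmul_bilin)
  also have "\<dots> = qreal (-1) + qcnj (herm z x) \<odot> herm z x" using assms by (simp add: X_def herm.add_right herm_cnj)
  also have "\<dots> = qreal ((norm (herm z x))\<^sup>2 - 1)" by (simp add: qcnj_mult_self)
  finally have "herm X X = qreal ((norm (herm z x))\<^sup>2 - 1)" .
  then have "0 \<le> (norm (herm z x))\<^sup>2 - 1" using herm_neg_perp_nonneg(1)[OF _ zX] assms(2) by simp
  then show ?thesis by (simp add: abs_le_square_iff[of 1 "norm (herm z x)", simplified])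
qed

text \<open>Up to scale P is the component of Y orthogonal to X. It is orthogonal to z, where the
  form is positive, and its form value is S times the required difference.\<close>

lemma cauchy_schwarz_perp:
  assumes z: "herm z z $ 0 < 0" and X: "herm z X = 0" and Y: "herm z Y = 0"
  shows "(norm (herm X Y))\<^sup>2 \<le> (herm X X $ 0) * (herm Y Y $ 0)"
proof (cases "herm X X $ 0 = 0")
  case True
  then have "X = 0" using herm_neg_perp_nonneg(2)[OF z X] by simp
  then show ?thesis by (simp add: herm.zero_left)
next
  case False
  define S where "S = herm X X $ 0"
  define T where "T = herm Y Y $ 0"
  define N where "N = (norm (herm X Y))\<^sup>2"
  have S: "S > 0" using herm_neg_perp_nonneg(1)[OF z X] False by (simp add: S_def)
  have XX: "herm X X = qreal S" and YY: "herm Y Y = qreal T" using herm_self_qreal by (auto simp: S_def T_def)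
  define P where "P = X \<triangleleft> herm X Y - S *\<^sub>R Y"
  have zP: "herm z P = 0" using X Y by (simp add: P_def herm.diff_right herm.scaleR_right qmul_bilin)
  have XP: "herm X P = 0" using XX by (simp add: P_def herm.diff_right herm.scaleR_right)
  have YP: "herm Y P = qreal (N - S * T)" 
    using YY qcnj_mult_self(1)[of "herm X Y"] by (simp add: P_def herm.diff_right herm.scaleR_right herm_cnj N_def)
  have "herm P P = - (S *\<^sub>R qreal (N - S * T))"
    using XP YP by (subst P_def) (simp add: herm.diff_left herm.scaleR_left qmul_bilin del: qreal_simps)
  then have "herm P P $ 0 = S * (S * T - N)" by (simp add: algebra_simps)
  then have "S * (S * T - N) \<ge> 0" using herm_neg_perp_nonneg(1)[OF z zP] by simp
  then have "N \<le> S * T" using S by (simp add: zero_le_mult_iff)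
  then show ?thesis by (simp add: N_def S_def T_def)
qed

text \<open>Equality case of the triangle inequality: with $z$-adapted representatives, $x = zA + X$ and
  $y = zB + Y$ where $X, Y \perp z$, equality forces $\langle X, Y\rangle = -|X||Y|$, so $|Y|X + |X|Y = 0$.\<close>

lemma geodesic_between:
  assumes xyz: "herm x x = qreal (-1)" "herm y y = qreal (-1)" "herm z z = qreal (-1)"
    and eq: "arcosh (norm (herm x z)) + arcosh (norm (herm z y)) = arcosh (norm (herm x y))"
  obtains l m s t \<rho> r where "norm l = 1" "norm m = 1" "r \<noteq> 0" "\<rho> \<noteq> 0" "herm (x \<triangleleft> l) (y \<triangleleft> m) = qreal \<rho>"
    "r *\<^sub>R z = s *\<^sub>R (x \<triangleleft> l) + t *\<^sub>R (y \<triangleleft> m)"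
proof -
  \<comment> \<open>A unit right factor aligns v with z so that their pairing is a negative real
    number.\<close>
  have normalize: "\<exists>l. norm l = 1 \<and> herm z (v \<triangleleft> l) = qreal (- norm (herm z v))" if v: "herm v v = qreal (-1)" for v
  proof -
    have h: "herm z v \<noteq> 0" using rev_cauchy_schwarz[OF v xyz(3)] by auto
    define l where "l = (- norm (herm z v)) *\<^sub>R qinv (herm z v)"
    have "norm l = 1" "herm z (v \<triangleleft> l) = qreal (- norm (herm z v))"
      using h by (simp_all add: l_def norm_qinv qmul_bilin qinv_right)
    then show ?thesis by blast
  qed
  obtain l where l: "norm l = 1" "herm z (x \<triangleleft> l) = qreal (- norm (herm z x))" using normalize[OF xyz(1)] by blast
  obtain m where m: "norm m = 1" "herm z (y \<triangleleft> m) = qreal (- norm (herm z y))" using normalize[OF xyz(2)] by blast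
  define A where "A = norm (herm z x)"
  define B where "B = norm (herm z y)"
  define x' where "x' = x \<triangleleft> l"
  define y' where "y' = y \<triangleleft> m"
  have AB: "A \<ge> 1" "B \<ge> 1" using rev_cauchy_schwarz xyz by (auto simp: A_def B_def)
  have x'x': "herm x' x' = qreal (-1)" and y'y': "herm y' y' = qreal (-1)"
    using xyz l m by (simp_all add: x'_def y'_def qmul_bilin qcnj_mult_self)
  have zx: "herm z x' = qreal (- A)" "herm z y' = qreal (- B)" using l m by (auto simp: x'_def y'_def A_def B_def)
  have xz: "herm x' z = qreal (- A)" "herm y' z = qreal (- B)" using zx by (metis herm_cnj qcnj_simps(7))+
  define X where "X = x' - A *\<^sub>R z"
  define Y where "Y = y' - B *\<^sub>R z"
  have zXY: "herm z X = 0" "herm z Y = 0"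
    using zx xyz(3) by (simp_all add: X_def Y_def herm.diff_right herm.scaleR_right)
  have XYz: "herm X z = 0" "herm Y z = 0" using zXY herm_eq_0_commute by blast+
  have XX: "herm X X = qreal (A\<^sup>2 - 1)" and YY: "herm Y Y = qreal (B\<^sup>2 - 1)"
    using x'x' y'y' zx xz xyz(3)
    by (simp_all add: X_def Y_def herm.diff_right herm.diff_left herm.scaleR_right herm.scaleR_left power2_eq_square)
  have zneg: "herm z z $ 0 < 0" using xyz(3) by simp
  define s where "s = sinh (arcosh A)"
  define t where "t = sinh (arcosh B)"
  have st: "s \<ge> 0" "t \<ge> 0" "s\<^sup>2 = A\<^sup>2 - 1" "t\<^sup>2 = B\<^sup>2 - 1"
    using AB by (simp_all add: s_def t_def sinh_square_eq)
  define Q where "Q = herm X Y"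
  have xyQ: "herm x' y' = Q - qreal (A * B)"
  proof -
    have "herm x' y' = herm (X + A *\<^sub>R z) (Y + B *\<^sub>R z)" by (simp add: X_def Y_def)
    also have "\<dots> = Q - qreal (A * B)"
      using zXY XYz xyz(3) by (simp add: herm.add_right herm.add_left herm.scaleR_right herm.scaleR_left Q_def eq_diff_eq add.assoc)
    finally show ?thesis .
  qed
  have nxy: "norm (herm x' y') = norm (herm x y)" using l m by (simp add: x'_def y'_def norm_qmul)
  have "norm (herm x y) \<ge> 1" using rev_cauchy_schwarz xyz by blast
  then have "norm (herm x y) = cosh (arcosh (norm (herm x y)))" by simp
  \<comment> \<open>The addition formula for cosh gives |Q - A B| = A B + s t, while Cauchy-Schwarz
    gives |Q| \<le> s t; together they leave only Q = - s t.\<close>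
  also have "\<dots> = cosh (arcosh A + arcosh B)" using eq norm_herm_commute by (metis A_def B_def)
  also have "\<dots> = A * B + s * t" using AB by (simp add: cosh_add s_def t_def)
  finally have nQ: "norm (Q - qreal (A * B)) = A * B + s * t" using nxy xyQ by simp
  have Q2: "(norm Q)\<^sup>2 \<le> s\<^sup>2 * t\<^sup>2"
    using cauchy_schwarz_perp[OF zneg zXY] XX YY st by (simp add: Q_def)
  have qn: "(norm Q)\<^sup>2 = (Q$0)\<^sup>2 + (Q$1)\<^sup>2 + (Q$2)\<^sup>2 + (Q$3)\<^sup>2" by (rule norm_quat_sq)
  have "(Q$0 - A * B)\<^sup>2 + (Q$1)\<^sup>2 + (Q$2)\<^sup>2 + (Q$3)\<^sup>2 = (A * B + s * t)\<^sup>2"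
    using norm_quat_sq[of "Q - qreal (A * B)"] nQ by simp
  then have "(norm Q)\<^sup>2 - 2 * (A * B) * Q$0 = 2 * (A * B) * (s * t) + s\<^sup>2 * t\<^sup>2"
    unfolding qn by (simp add: power2_eq_square algebra_simps)
  then have "2 * (A * B) * (s * t) \<le> 2 * (A * B) * (- (Q$0))" using Q2 by simp
  moreover have ABp: "A * B > 0" using AB by simp
  ultimately have Q0: "s * t \<le> - (Q$0)"
    by (intro mult_left_le_imp_le[of "2 * (A * B)" "s * t" "- (Q$0)"]) auto
  have "(s * t)\<^sup>2 \<le> (- (Q$0))\<^sup>2" using Q0 st by (intro power_mono) auto
  then have le: "(s * t)\<^sup>2 \<le> (Q$0)\<^sup>2" by simp
  have sq: "(Q$0)\<^sup>2 + (Q$1)\<^sup>2 + (Q$2)\<^sup>2 + (Q$3)\<^sup>2 \<le> (s * t)\<^sup>2"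
    using Q2 unfolding qn power_mult_distrib .
  note nn = zero_le_power2[of "Q$1"] zero_le_power2[of "Q$2"] zero_le_power2[of "Q$3"]
  have "(Q$1)\<^sup>2 = 0" "(Q$2)\<^sup>2 = 0" "(Q$3)\<^sup>2 = 0" using le sq nn by linarith+
  then have Qim: "Q$1 = 0" "Q$2 = 0" "Q$3 = 0" by simp_all
  have "(Q$0)\<^sup>2 \<le> (s * t)\<^sup>2" using sq nn by linarith
  then have "\<bar>Q$0\<bar> \<le> s * t" using st by (simp add: abs_le_square_iff[symmetric])
  then have Q: "Q = qreal (- (s * t))" using Q0 Qim by (simp add: quat_eq_iff)
  have Q': "herm Y X = qreal (- (s * t))" using Q unfolding Q_def by (metis herm_cnj qcnj_simps(7))
  define P where "P = t *\<^sub>R X + s *\<^sub>R Y"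
  have zP: "herm z P = 0" using zXY by (simp add: P_def herm.add_right herm.scaleR_right)
  have "herm P P $ 0 = t * (t * (A\<^sup>2 - 1)) + 2 * (s * t * (- (s * t))) + s * (s * (B\<^sup>2 - 1))"
    using XX YY Q' Q[unfolded Q_def]
    by (simp add: P_def herm.add_right herm.scaleR_right herm.add_left herm.scaleR_left algebra_simps)
  also have "\<dots> = 0" unfolding st(3,4)[symmetric] by (simp add: power2_eq_square)
  finally have "P = 0" using herm_neg_perp_nonneg(2)[OF zneg zP] by blast
  then have lin: "(t * A + s * B) *\<^sub>R z = t *\<^sub>R x' + s *\<^sub>R y'"
    by (simp add: P_def X_def Y_def algebra_simps)
  have rho: "herm x' y' = qreal (- (s * t) - A * B)" "- (s * t) - A * B \<noteq> 0"
    using xyQ Q ABp mult_nonneg_nonneg[OF st(1,2)] by auto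
  show ?thesis
  proof (cases "s = 0 \<and> t = 0")
    \<comment> \<open>When both endpoints coincide with z the linear relation degenerates to 0 = 0,
      and X = 0 replaces it.\<close>
    case True
    then have "X = 0" using herm_neg_perp_nonneg(2)[OF zneg zXY(1)] XX st by simp
    then have "A *\<^sub>R z = 1 *\<^sub>R x' + 0 *\<^sub>R y'" by (simp add: X_def)
    then show ?thesis using that[of l m A "- (s * t) - A * B" 1 0] l m rho AB by (simp add: x'_def y'_def)
  next
    case False
    have "s > 0 \<or> t > 0" using False st by auto
    then have "t * A > 0 \<or> s * B > 0" using AB by auto
    moreover have "t * A \<ge> 0" "s * B \<ge> 0" using st AB by auto
    ultimately have "t * A + s * B > 0" by linarith
    then show ?thesis using that[of l m "t * A + s * B" "- (s * t) - A * B" t s] l m rho lin by (simp add: x'_def y'_def)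
  qed
qed

text \<open>Intended for U a real subspace that is not quaternionic, such as a real or complex form;
  its negative vectors sweep out the submanifold.\<close>

definition lines_of :: "qvec set \<Rightarrow> qvec set set" where
  "lines_of U = {qline x | x. x \<in> U \<and> herm x x $ 0 < 0}"

lemma lines_of_HH2: "lines_of U \<subseteq> HH2"
  by (auto simp: lines_of_def HH2_def)

lemma unit_representative:
  assumes "herm x x $ 0 < 0"
  obtains r where "r > 0" "herm (r *\<^sub>R x) (r *\<^sub>R x) = qreal (-1)" "qline (r *\<^sub>R x) = qline x"
proof -
  define c where "c = - (herm x x $ 0)"
  define r where "r = 1 / sqrt c"
  have c: "c > 0" using assms by (simp add: c_def)
  have "herm (r *\<^sub>R x) (r *\<^sub>R x) $ 0 = r * r * (- c)" by (simp add: herm.scaleR_left herm.scaleR_right c_def)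
  also have "\<dots> = -1" using c by (simp add: r_def)
  finally have "herm (r *\<^sub>R x) (r *\<^sub>R x) = qreal (-1)" using herm_self_qreal[of "r *\<^sub>R x"] by simp
  moreover have "qline (r *\<^sub>R x) = qline x" using qline_scal[of "qreal r" x] c by (simp add: r_def)
  moreover have "r > 0" using c by (simp add: r_def)
  ultimately show ?thesis using that by blast
qed

text \<open>If x l and y m pair to a real number, then m is a real multiple of k^{-1} l with k = <x,
  y>. Pulling out the common right factor l leaves a real combination of x and y k^{-1}, and
  \<open>herm_inv\<close> keeps the latter in U.\<close>

lemma lines_of_totally_geodesic:
  assumes add: "\<And>x y. x \<in> U \<Longrightarrow> y \<in> U \<Longrightarrow> x + y \<in> U"
    and scale: "\<And>x r. x \<in> U \<Longrightarrow> r *\<^sub>R x \<in> U"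
    and herm_inv: "\<And>x y. x \<in> U \<Longrightarrow> y \<in> U \<Longrightarrow> y \<triangleleft> qinv (herm x y) \<in> U"
  shows "totally_geodesic (lines_of U)"
  unfolding totally_geodesic_def
proof (intro conjI ballI impI lines_of_HH2)
  fix a b c assume a: "a \<in> lines_of U" and b: "b \<in> lines_of U" and c: "c \<in> HH2"
    and eq: "distHH a c + distHH c b = distHH a b"
  obtain x where x: "x \<in> U" "herm x x = qreal (-1)" "a = qline x"
    using a unit_representative scale unfolding lines_of_def by (smt (verit) mem_Collect_eq)
  obtain y where y: "y \<in> U" "herm y y = qreal (-1)" "b = qline y"
    using b unit_representative scale unfolding lines_of_def by (smt (verit) mem_Collect_eq)
  obtain z where z: "herm z z = qreal (-1)" "c = qline z"
    using c unit_representative unfolding HH2_def by (smt (verit) mem_Collect_eq)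
  have "arcosh (norm (herm x z)) + arcosh (norm (herm z y)) = arcosh (norm (herm x y))"
    using eq x y z by (simp add: distHH_unit)
  then obtain l m s t \<rho> r where g: "norm l = 1" "norm m = 1" "r \<noteq> 0" "\<rho> \<noteq> 0" "herm (x \<triangleleft> l) (y \<triangleleft> m) = qreal \<rho>"
    "r *\<^sub>R z = s *\<^sub>R (x \<triangleleft> l) + t *\<^sub>R (y \<triangleleft> m)"
    by (rule geodesic_between[OF x(2) y(2) z(1)])
  define k where "k = herm x y"
  have km: "qcnj l \<odot> (k \<odot> m) = qreal \<rho>" using g(5) by (simp add: k_def qmul_assoc)
  have "k \<noteq> 0" using km g(4) by (auto simp: qmul_bilin)
  have "l \<odot> (qcnj l \<odot> (k \<odot> m)) = k \<odot> m" using g(1) by (simp add: qcnj_mult_self flip: qmul_assoc)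
  then have "k \<odot> m = \<rho> *\<^sub>R l" unfolding km by simp
  then have "qinv k \<odot> (k \<odot> m) = qinv k \<odot> (\<rho> *\<^sub>R l)" by simp
  then have m: "m = \<rho> *\<^sub>R (qinv k \<odot> l)" using \<open>k \<noteq> 0\<close> by (simp add: qinv_left qmul_bilin flip: qmul_assoc)
  define p where "p = s *\<^sub>R x + (t * \<rho>) *\<^sub>R (y \<triangleleft> qinv k)"
  have p: "p \<in> U" using x(1) y(1) herm_inv add scale by (simp add: p_def k_def)
  have rz: "r *\<^sub>R z = p \<triangleleft> l"
    unfolding g(6) m by (simp add: p_def qscal.add_left qscal.scaleR_left qscal.scaleR_right qscal_assoc)
  have l0: "l \<noteq> 0" using g(1) by auto
  have c: "c = qline p" using qline_scal[of "qreal r" z] qline_scal[OF l0, of p] rz z(2) g(3) by simp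
  have "herm (r *\<^sub>R z) (r *\<^sub>R z) $ 0 = - (r * r)" using z(1) by (simp add: herm.scaleR_left herm.scaleR_right)
  then have "herm (r *\<^sub>R z) (r *\<^sub>R z) $ 0 < 0" using g(3) by (metis neg_less_0_iff_less not_real_square_gt_zero)
  then have "herm p p $ 0 < 0" unfolding rz herm_scal_self using g(1) by simp
  then show "c \<in> lines_of U" using c p unfolding lines_of_def by blast
qed

lemma (in discrete_group) lines_of_invariant:
  assumes "\<And>g x. g \<in> G \<Longrightarrow> x \<in> U \<Longrightarrow> g \<triangleright> x \<in> U" and g: "g \<in> G"
  shows "qact g ` lines_of U = lines_of U"
proof -
  have sub: "qact h ` lines_of U \<subseteq> lines_of U" if h: "h \<in> G" for h
  proof
    fix L assume "L \<in> qact h ` lines_of U"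
    then obtain x where x: "x \<in> U" "herm x x $ 0 < 0" "L = qact h (qline x)" unfolding lines_of_def by blast
    then have "L = qline (h \<triangleright> x)" "h \<triangleright> x \<in> U" "herm (h \<triangleright> x) (h \<triangleright> x) $ 0 < 0"
      using assms(1)[OF h] h by (simp_all add: qact_qline)
    then show "L \<in> lines_of U" unfolding lines_of_def by blast
  qed
  have "L \<in> qact g ` lines_of U" if L: "L \<in> lines_of U" for L
  proof -
    have "qact (qdag g) L \<in> lines_of U" using sub[OF G_dag[OF g]] L by blast
    moreover have "qact g (qact (qdag g) L) = L" using g by (simp add: qact_def image_image)
    ultimately show ?thesis by (metis imageI)
  qed
  then show ?thesis using sub[OF g] by blast
qed

section \<open>Comparison with projective models\<close>

lemma isometric_to_sym:
  assumes "isometric_to A dA B dB" shows "isometric_to B dB A dA"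
proof -
  obtain f where f: "bij_betw f A B" "\<And>x y. x \<in> A \<Longrightarrow> y \<in> A \<Longrightarrow> dB (f x) (f y) = dA x y"
    using assms unfolding isometric_to_def by blast
  have im: "B = f ` A" using f(1) by (simp add: bij_betw_def)
  have "dA (inv_into A f x) (inv_into A f y) = dB x y" if "x \<in> B" "y \<in> B" for x y
    using f(2)[of "inv_into A f x" "inv_into A f y"] that unfolding im by (simp add: inv_into_into f_inv_into_f)
  then show ?thesis unfolding isometric_to_def using bij_betw_inv_into[OF f(1)] by blast
qed

text \<open>One argument for both models. The isometry is built from the model towards
  \<open>HH2\<close>, since \<open>rep\<close> then selects a model vector to which f applies, and
  it is inverted at the outset.\<close>

lemma projective_model_isometry:
  fixes f :: "'v::zero \<Rightarrow> qvec" and line :: "'v \<Rightarrow> 'v set" and N :: "'v \<Rightarrow> 'v \<Rightarrow> real" and q :: "'v \<Rightarrow> real"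
  assumes f0: "f 0 = 0"
    and N: "\<And>v w. (norm (herm (f v) (f w)))\<^sup>2 = N v w"
    and q: "\<And>v. herm (f v) (f v) $ 0 = q v"
    and self: "\<And>v. v \<in> line v"
    and f_line: "\<And>v w. w \<in> line v \<Longrightarrow> \<exists>l. f w = f v \<triangleleft> l"
    and line_f: "\<And>v w l. q v < 0 \<Longrightarrow> f w = f v \<triangleleft> l \<Longrightarrow> w \<in> line v"
    and line_eq: "\<And>v w. w \<in> line v \<Longrightarrow> w \<noteq> 0 \<Longrightarrow> line w = line v"
    and d: "\<And>L M. d L M = hypdist_of (N (rep L) (rep M) / (q (rep L) * q (rep M)))"
  shows "isometric_to {qline (f v) | v. q v < 0} distHH {line v | v. q v < 0} d"
proof (rule isometric_to_sym)
  have r: "rep (line v) \<in> line v \<and> rep (line v) \<noteq> 0 \<and> line (rep (line v)) = line v \<and> q (rep (line v)) < 0 \<and> f (rep (line v)) \<noteq> 0"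
    if v: "q v < 0" for v
  proof -
    have "f v \<noteq> 0" using v q by (metis neg_nz)
    then have "v \<in> line v \<and> v \<noteq> 0" using self f0 by auto
    then have r: "rep (line v) \<in> line v \<and> rep (line v) \<noteq> 0" unfolding rep_def by (rule someI)
    then have e: "line (rep (line v)) = line v" using line_eq by blast
    then obtain l where l: "f v = f (rep (line v)) \<triangleleft> l" using f_line self by metis
    have "(norm l)\<^sup>2 * q (rep (line v)) < 0" using v by (metis l herm_scal_self q)
    then have "q (rep (line v)) < 0" by (simp add: mult_less_0_iff)
    moreover have "f (rep (line v)) \<noteq> 0" using l \<open>f v \<noteq> 0\<close> by (auto simp: qscal.zero_left)
    ultimately show ?thesis using r e by blast
  qed
  define F where "F L = qline (f (rep L))" for L
  have F: "F (line v) = qline (f v)" if v: "q v < 0" for v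
  proof -
    obtain l where "f (rep (line v)) = f v \<triangleleft> l" using f_line r[OF v] by blast
    then show ?thesis unfolding F_def using qline_eq_iff r[OF v] by metis
  qed
  have "bij_betw F {line v | v. q v < 0} {qline (f v) | v. q v < 0}"
    unfolding bij_betw_def
  proof
    show "inj_on F {line v | v. q v < 0}"
    proof (rule inj_onI, clarify)
      fix v w assume vw: "q v < 0" "q w < 0" "F (line v) = F (line w)"
      have "f w \<noteq> 0" using vw(2) q by (metis neg_nz)
      then obtain l where "f w = f v \<triangleleft> l" using vw F qline_eq_iff by metis
      then have "w \<in> line v" using line_f vw by blast
      moreover have "w \<noteq> 0" using \<open>f w \<noteq> 0\<close> f0 by auto
      ultimately show "line v = line w" using line_eq by metis
    qed
    have "F ` line ` {v. q v < 0} = (\<lambda>v. qline (f v)) ` {v. q v < 0}"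
      unfolding image_image using F by (intro image_cong) auto
    then show "F ` {line v | v. q v < 0} = {qline (f v) | v. q v < 0}"
      by (simp add: setcompr_eq_image)
  qed
  moreover have "distHH (F L) (F M) = d L M" if LM: "L \<in> {line v | v. q v < 0}" "M \<in> {line v | v. q v < 0}" for L M
  proof -
    have "q (rep L) < 0" "q (rep M) < 0" using LM r by auto
    then show ?thesis using distHH_qline[of "f (rep L)" "f (rep M)"] unfolding F_def d q N by blast
  qed
  ultimately show "isometric_to {line v | v. q v < 0} d {qline (f v) | v. q v < 0} distHH"
    unfolding isometric_to_def by blast
qed

section \<open>Models of the real hyperbolic plane and the complex hyperbolic line\<close>

text \<open>The standard basis goes to (x1 + x2) / sqrt 2, w and (x1 - x2) / sqrt 2, whose form
  values are 1, 1 and -1.\<close>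

definition real_embed :: "qvec \<Rightarrow> qvec \<Rightarrow> qvec \<Rightarrow> real^3 \<Rightarrow> qvec" where
  "real_embed x1 x2 w v = ((v$0 + v$2) / sqrt 2) *\<^sub>R x1 + ((v$0 - v$2) / sqrt 2) *\<^sub>R x2 + (v$1) *\<^sub>R w"

lemma real_embed_surj: "a *\<^sub>R x1 + b *\<^sub>R x2 + c *\<^sub>R w = real_embed x1 x2 w (\<chi> i. if i = 0 then (a + b) / sqrt 2 else if i = 1 then c else (a - b) / sqrt 2)"
proof -
  have "((a + b) / sqrt 2 + (a - b) / sqrt 2) / sqrt 2 = a" "((a + b) / sqrt 2 - (a - b) / sqrt 2) / sqrt 2 = b"
    by (simp_all add: field_simps)
  then show ?thesis by (simp add: real_embed_def)
qed

lemma linear_real_embed: "linear (real_embed x1 x2 w)"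
  by (rule linearI) (simp_all add: real_embed_def algebra_simps add_divide_distrib diff_divide_distrib)

lemma herm_real_embed:
  assumes x: "herm x1 x1 = 0" "herm x2 x2 = 0" "herm x1 x2 = qreal 1"
    and w: "herm x1 w = 0" "herm x2 w = 0" "herm w w = qreal 1"
  shows "herm (real_embed x1 x2 w v) (real_embed x1 x2 w v') = qreal (rform v v')"
proof -
  have x21: "herm x2 x1 = qreal 1" using x(3) by (metis herm_cnj qcnj_simps(7))
  have w': "herm w x1 = 0" "herm w x2 = 0" using w by (simp_all add: herm_eq_0_commute)
  have general: "herm (a *\<^sub>R x1 + b *\<^sub>R x2 + c *\<^sub>R w) (a' *\<^sub>R x1 + b' *\<^sub>R x2 + c' *\<^sub>R w) = qreal (a * b' + b * a' + c * c')"
    for a b c a' b' c'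
    using x x21 w w' by (simp add: herm.add_left herm.add_right herm.scaleR_left herm.scaleR_right)
  have e: "(p + r) / sqrt 2 * ((p' - r') / sqrt 2) + (p - r) / sqrt 2 * ((p' + r') / sqrt 2) + c = p * p' + c - r * r'" for p r p' r' c :: real
    by (simp add: field_simps)
  show ?thesis unfolding real_embed_def general e rform_def ..
qed

lemma (in discrete_group) real_plane_conclusion:
  assumes x: "herm x1 x1 = 0" "herm x2 x2 = 0" "herm x1 x2 = qreal 1"
    and w: "herm x1 w = 0" "herm x2 w = 0" "herm w w = qreal 1"
    and inv: "\<And>g x. g \<in> G \<Longrightarrow> x \<in> {x1, x2, w} \<Longrightarrow> \<exists>a b c. g \<triangleright> x = a *\<^sub>R x1 + b *\<^sub>R x2 + c *\<^sub>R w"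
  shows "\<exists>M. M \<subseteq> HH2 \<and> totally_geodesic M \<and> (\<forall>g\<in>G. qact g ` M = M) \<and> isometric_to M distHH HR2 distHR"
proof (intro exI conjI ballI)
  define f where "f = real_embed x1 x2 w"
  define U where "U = range f"
  have lin: "linear f" unfolding f_def by (rule linear_real_embed)
  have U: "subspace U" unfolding U_def by (rule linear_subspace_image[OF lin]) simp
  have mem: "a *\<^sub>R x1 + b *\<^sub>R x2 + c *\<^sub>R w \<in> U" for a b c
    unfolding U_def f_def real_embed_surj by blast
  have hf: "herm (f v) (f v') = qreal (rform v v')" for v v' unfolding f_def by (rule herm_real_embed[OF x w])
  show "lines_of U \<subseteq> HH2" by (rule lines_of_HH2)
  show "totally_geodesic (lines_of U)"
  proof (rule lines_of_totally_geodesic)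
    fix x y assume "x \<in> U" "y \<in> U"
    then obtain r where "herm x y = qreal r" unfolding U_def using hf by blast
    then have "y \<triangleleft> qinv (herm x y) = (r / (norm (qreal r))\<^sup>2) *\<^sub>R y" by (simp add: qinv_def qscal.scaleR_right del: qreal_simps norm_qreal)
    then show "y \<triangleleft> qinv (herm x y) \<in> U" using subspace_scale[OF U \<open>y \<in> U\<close>] by simp
  qed (use U subspace_add subspace_scale in blast)+
  show "qact g ` lines_of U = lines_of U" if "g \<in> G" for g
  proof (rule lines_of_invariant[OF _ that])
    fix g z assume g: "g \<in> G" and "z \<in> U"
    then obtain v where v: "z = f v" unfolding U_def by blast
    have gx: "g \<triangleright> x \<in> U" if "x \<in> {x1, x2, w}" for x using inv[OF g that] mem by metis
    show "g \<triangleright> z \<in> U" unfolding v f_def real_embed_def qmat_vec.add_right qmat_vec.scaleR_right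
      by (intro subspace_add[OF U] subspace_scale[OF U] gx) auto
  qed
  have finj: "v = 0" if "f v = 0" for v
  proof -
    have z: "rform v v' = 0" for v' using hf[of v v'] that by (simp add: herm.zero_left)
    have "v$0 = 0" "v$1 = 0" "v$2 = 0"
      using z[of "axis 0 1"] z[of "axis 1 1"] z[of "axis 2 1"] by (simp_all add: rform_def axis_def)
    then show "v = 0" by (simp add: vec_eq_iff[of v] all3)
  qed
  have "isometric_to {qline (f v) |v. rform v v < 0} distHH {range (\<lambda>c. c *\<^sub>R v) |v. rform v v < 0} distHR"
  proof (rule projective_model_isometry[where N = "\<lambda>v w. (rform v w)\<^sup>2" and q = "\<lambda>v. rform v v"])
    show "f 0 = 0" using linear_0[OF lin] .
    show "(norm (herm (f v) (f v')))\<^sup>2 = (rform v v')\<^sup>2" for v v' by (simp add: hf)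
    show "herm (f v) (f v) $ 0 = rform v v" for v by (simp add: hf)
    show "v \<in> range (\<lambda>c. c *\<^sub>R v)" for v :: "real^3" by (rule range_eqI[of _ _ 1]) simp
    show "\<exists>l. f v' = f v \<triangleleft> l" if v': "v' \<in> range (\<lambda>c. c *\<^sub>R v)" for v v'
    proof -
      obtain c where "v' = c *\<^sub>R v" using v' by blast
      then have "f v' = f v \<triangleleft> qreal c" using linear_cmul[OF lin] by simp
      then show ?thesis by blast
    qed
    show "v' \<in> range (\<lambda>c. c *\<^sub>R v)" if v: "rform v v < 0" "f v' = f v \<triangleleft> l" for v v' l
    proof -
      \<comment> \<open>A priori l is a quaternion; pairing with \<open>f v\<close> shows that it is
        real.\<close>
      have "qreal (rform v v') = rform v v *\<^sub>R l" using hf[of v v'] hf[of v v] v(2) by simp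
      then have "l = qreal (rform v v' / rform v v)" using v(1) by (simp add: quat_eq_iff field_simps)
      then have "f v' = (rform v v' / rform v v) *\<^sub>R f v" using v(2) by simp
      then have "f (v' - (rform v v' / rform v v) *\<^sub>R v) = 0" by (simp add: linear_diff[OF lin] linear_cmul[OF lin])
      then show ?thesis using finj by fastforce
    qed
    show "range (\<lambda>c. c *\<^sub>R v') = range (\<lambda>c. c *\<^sub>R v)" if v': "v' \<in> range (\<lambda>c. c *\<^sub>R v)" "v' \<noteq> 0" for v v' :: "real^3"
    proof -
      obtain c where c: "v' = c *\<^sub>R v" using v' by blast
      then have "c \<noteq> 0" using v' by auto
      then have 1: "d *\<^sub>R v = (d / c) *\<^sub>R v'" for d using c by simp
      have 2: "d *\<^sub>R v' = (d * c) *\<^sub>R v" for d using c by simp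
      show ?thesis
      proof
        show "range (\<lambda>c. c *\<^sub>R v') \<subseteq> range (\<lambda>c. c *\<^sub>R v)" unfolding 2 by blast
        show "range (\<lambda>c. c *\<^sub>R v) \<subseteq> range (\<lambda>c. c *\<^sub>R v')" unfolding 1 by blast
      qed
    qed
  qed (simp add: distHR_def Let_def)
  moreover have "lines_of U = {qline (f v) |v. rform v v < 0}"
    unfolding lines_of_def U_def by (auto simp: hf)
  ultimately show "isometric_to (lines_of U) distHH HR2 distHR" by (simp add: HR2_def)
qed

text \<open>The field embedding of the complex numbers that sends the imaginary unit to u; its image
  is \<open>cent u\<close>.\<close>

definition qcomplex :: "quat \<Rightarrow> complex \<Rightarrow> quat" where
  "qcomplex u z = qreal (Re z) + Im z *\<^sub>R u"

lemma qcomplex_simps: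
  "qcomplex u (a + b) = qcomplex u a + qcomplex u b"
  "qcomplex u (a - b) = qcomplex u a - qcomplex u b"
  "qcomplex u 0 = 0" "qcomplex u 1 = qreal 1" "qcomplex u (r *\<^sub>R a) = r *\<^sub>R qcomplex u a"
  by (simp_all add: qcomplex_def scaleR_add_left scaleR_diff_left scaleR_add_right flip: qreal_simps(3) qreal_simps(6))

lemma qcomplex_mult: "imag_unit u \<Longrightarrow> qcomplex u (a * b) = qcomplex u a \<odot> qcomplex u b"
  by (simp add: qcomplex_def qmul_bilin imag_unit_sq) (simp add: quat_eq_iff algebra_simps)

lemma qcomplex_cnj: "imag_unit u \<Longrightarrow> qcomplex u (cnj a) = qcnj (qcomplex u a)"
  by (simp add: qcomplex_def imag_unit_def qcnj_imag)

lemma norm_qcomplex: "imag_unit u \<Longrightarrow> norm (qcomplex u a) = cmod a"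
proof -
  assume u: "imag_unit u"
  have "qreal ((norm (qcomplex u a))\<^sup>2) = qcomplex u (cnj a * a)"
    by (simp add: qcomplex_mult[OF u] qcomplex_cnj[OF u] qcnj_mult_self)
  also have "cnj a * a = complex_of_real ((cmod a)\<^sup>2)" by (metis complex_norm_square mult.commute)
  also have "qcomplex u (complex_of_real ((cmod a)\<^sup>2)) = qreal ((cmod a)\<^sup>2)" by (simp add: qcomplex_def)
  finally show ?thesis by simp
qed

lemma Re_qcomplex: "imag_unit u \<Longrightarrow> qcomplex u a $ 0 = Re a"
  by (simp add: qcomplex_def imag_unit_def)

lemma cent_qcomplex: "imag_unit u \<Longrightarrow> cent u = range (qcomplex u)"
proof
  assume u: "imag_unit u"
  show "cent u \<subseteq> range (qcomplex u)"
  proof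
    fix x assume "x \<in> cent u"
    then have "x = qcomplex u (Complex (x$0) (- ((x \<odot> u) $ 0)))"
      unfolding qcomplex_def complex.sel by (rule cent_form[OF u])
    then show "x \<in> range (qcomplex u)" by blast
  qed
  show "range (qcomplex u) \<subseteq> cent u" by (auto simp: qcomplex_def intro!: cent_basic)
qed

text \<open>The standard basis goes to (x1 + x2) / sqrt 2 and (x1 - x2) / sqrt 2, of form values 1
  and -1, with coefficients from \<open>cent u\<close> on the right.\<close>

definition complex_embed :: "quat \<Rightarrow> qvec \<Rightarrow> qvec \<Rightarrow> complex^2 \<Rightarrow> qvec" where
  "complex_embed u x1 x2 v = x1 \<triangleleft> qcomplex u ((v$0 + v$1) / complex_of_real (sqrt 2)) + x2 \<triangleleft> qcomplex u ((v$0 - v$1) / complex_of_real (sqrt 2))"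

lemma sqrt2_sq: "complex_of_real (sqrt 2) * complex_of_real (sqrt 2) = 2"
  by (simp flip: of_real_mult)

lemma complex_embed_surj:
  "x1 \<triangleleft> qcomplex u a + x2 \<triangleleft> qcomplex u b = complex_embed u x1 x2 (\<chi> i. if i = 0 then (a + b) / complex_of_real (sqrt 2) else (a - b) / complex_of_real (sqrt 2))"
proof -
  have "((a + b) / complex_of_real (sqrt 2) + (a - b) / complex_of_real (sqrt 2)) / complex_of_real (sqrt 2) = a"
    "((a + b) / complex_of_real (sqrt 2) - (a - b) / complex_of_real (sqrt 2)) / complex_of_real (sqrt 2) = b"
    by (simp_all add: field_simps sqrt2_sq)
  then show ?thesis by (simp add: complex_embed_def)
qed

lemma herm_complex_embed:
  assumes x: "herm x1 x1 = 0" "herm x2 x2 = 0" "herm x1 x2 = qreal 1" and u: "imag_unit u"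
  shows "herm (complex_embed u x1 x2 v) (complex_embed u x1 x2 v') = qcomplex u (cform v v')"
proof -
  have x21: "herm x2 x1 = qreal 1" using x(3) by (metis herm_cnj qcnj_simps(7))
  have general: "herm (x1 \<triangleleft> qcomplex u a + x2 \<triangleleft> qcomplex u b) (x1 \<triangleleft> qcomplex u a' + x2 \<triangleleft> qcomplex u b') = qcomplex u (cnj a * b' + cnj b * a')"
    for a b a' b'
    using x x21 by (simp add: herm.add_left herm.add_right qmul_bilin qcomplex_simps qcomplex_mult[OF u] qcomplex_cnj[OF u])
  have e: "cnj ((p + r) / complex_of_real (sqrt 2)) * ((p' - r') / complex_of_real (sqrt 2))
      + cnj ((p - r) / complex_of_real (sqrt 2)) * ((p' + r') / complex_of_real (sqrt 2)) = cnj p * p' - cnj r * r'" for p r p' r'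
    by (simp add: field_simps sqrt2_sq)
  show ?thesis unfolding complex_embed_def general e cform_def ..
qed

lemma (in discrete_group) complex_line_conclusion:
  assumes x: "herm x1 x1 = 0" "herm x2 x2 = 0" "herm x1 x2 = qreal 1" and u: "imag_unit u"
    and inv: "\<And>g x. g \<in> G \<Longrightarrow> x \<in> {x1, x2} \<Longrightarrow> \<exists>a\<in>cent u. \<exists>b\<in>cent u. g \<triangleright> x = x1 \<triangleleft> a + x2 \<triangleleft> b"
  shows "\<exists>M. M \<subseteq> HH2 \<and> totally_geodesic M \<and> (\<forall>g\<in>G. qact g ` M = M) \<and> isometric_to M distHH HC1 distHC"
proof (intro exI conjI ballI)
  define f where "f = complex_embed u x1 x2"
  define U where "U = range f"
  have hf: "herm (f v) (f v') = qcomplex u (cform v v')" for v v' unfolding f_def by (rule herm_complex_embed[OF x u])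
  have memU: "x1 \<triangleleft> a + x2 \<triangleleft> b \<in> U" if "a \<in> cent u" "b \<in> cent u" for a b
    using that unfolding U_def f_def cent_qcomplex[OF u] using complex_embed_surj by blast
  have formU: "\<exists>a\<in>cent u. \<exists>b\<in>cent u. z = x1 \<triangleleft> a + x2 \<triangleleft> b" if "z \<in> U" for z
    using that unfolding U_def f_def complex_embed_def cent_qcomplex[OF u] by blast
  have add: "y + z \<in> U" if yz: "y \<in> U" "z \<in> U" for y z
  proof -
    obtain a b a' b' where "a \<in> cent u" "b \<in> cent u" "a' \<in> cent u" "b' \<in> cent u"
      "y = x1 \<triangleleft> a + x2 \<triangleleft> b" "z = x1 \<triangleleft> a' + x2 \<triangleleft> b'" using formU yz by meson
    moreover from this have "y + z = x1 \<triangleleft> (a + a') + x2 \<triangleleft> (b + b')" by (simp add: qscal.add_right)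
    ultimately show ?thesis using memU cent_basic(1) by metis
  qed
  have scal: "y \<triangleleft> c \<in> U" if yc: "y \<in> U" "c \<in> cent u" for y c
  proof -
    obtain a b where "a \<in> cent u" "b \<in> cent u" "y = x1 \<triangleleft> a + x2 \<triangleleft> b" using formU yc by meson
    moreover from this have "y \<triangleleft> c = x1 \<triangleleft> (a \<odot> c) + x2 \<triangleleft> (b \<odot> c)" by (simp add: qscal.add_left qscal_assoc)
    ultimately show ?thesis using memU cent_cent yc(2) by metis
  qed
  have u0: "u $ 0 = 0" using u by (simp add: imag_unit_def)
  show "lines_of U \<subseteq> HH2" by (rule lines_of_HH2)
  show "totally_geodesic (lines_of U)"
  proof (rule lines_of_totally_geodesic)
    show "r *\<^sub>R y \<in> U" if "y \<in> U" for y r using scal[OF that cent_basic(5)[of r u]] by simp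
    show "z \<triangleleft> qinv (herm y z) \<in> U" if "y \<in> U" "z \<in> U" for y z
    proof (rule scal[OF that(2)])
      have "herm y z \<in> cent u" using that hf unfolding U_def cent_qcomplex[OF u] by blast
      then show "qinv (herm y z) \<in> cent u" by (rule cent_inv[OF u0])
    qed
  qed (rule add)
  show "qact g ` lines_of U = lines_of U" if "g \<in> G" for g
  proof (rule lines_of_invariant[OF _ that])
    fix g z assume g: "g \<in> G" and z: "z \<in> U"
    obtain a b where ab: "a \<in> cent u" "b \<in> cent u" "z = x1 \<triangleleft> a + x2 \<triangleleft> b" using formU z by meson
    have gx: "g \<triangleright> x \<in> U" if "x \<in> {x1, x2}" for x using inv[OF g that] memU by metis
    show "g \<triangleright> z \<in> U" unfolding ab(3) qmat_vec.add_right qmat_vec_scal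
      by (intro add scal gx ab) auto
  qed
  have f_scal: "f (v * (\<chi> i. c)) = f v \<triangleleft> qcomplex u c" for v c
    unfolding f_def complex_embed_def qscal.add_left qscal_assoc qcomplex_mult[OF u, symmetric]
    by (simp add: field_simps)
  have f_diff: "f (v - v') = f v - f v'" for v v'
    by (simp add: f_def complex_embed_def qcomplex_simps qscal.diff_right algebra_simps diff_divide_distrib add_divide_distrib qscal.add_right)
  have finj: "v = 0" if "f v = 0" for v
  proof -
    have z: "cform v v' = 0" for v'
    proof -
      have "qcomplex u (cform v v') = 0" using hf[of v v'] that by (simp add: herm.zero_left)
      then show ?thesis using norm_qcomplex[OF u] by (metis norm_eq_zero)
    qed
    have "v$0 = 0" "v$1 = 0"
      using z[of "axis 0 1"] z[of "axis 1 1"] by (simp_all add: cform_def axis_def)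
    moreover have "i = 0 \<or> i = 1" for i :: 2 using exhaust_2[of i] by auto
    ultimately have "v$i = 0" for i by metis
    then show "v = 0" by (simp add: vec_eq_iff)
  qed
  have "isometric_to {qline (f v) |v. Re (cform v v) < 0} distHH {range (\<lambda>c. v * (\<chi> i. c)) |v. Re (cform v v) < 0} distHC"
  proof (rule projective_model_isometry[where N = "\<lambda>v w. (cmod (cform v w))\<^sup>2" and q = "\<lambda>v. Re (cform v v)"])
    show "f 0 = 0" using f_diff[of 0 0] by simp
    show "(norm (herm (f v) (f v')))\<^sup>2 = (cmod (cform v v'))\<^sup>2" for v v' by (simp add: hf norm_qcomplex[OF u])
    show "herm (f v) (f v) $ 0 = Re (cform v v)" for v by (simp add: hf Re_qcomplex[OF u])
    show "v \<in> range (\<lambda>c. v * (\<chi> i. c))" for v :: "complex^2"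
      by (rule range_eqI[of _ _ 1]) (simp add: vec_eq_iff)
    show "\<exists>l. f v' = f v \<triangleleft> l" if "v' \<in> range (\<lambda>c. v * (\<chi> i. c))" for v v' using that f_scal by blast
    show "v' \<in> range (\<lambda>c. v * (\<chi> i. c))" if v: "Re (cform v v) < 0" "f v' = f v \<triangleleft> l" for v v' l
    proof -
      have h: "qcomplex u (cform v v') = qcomplex u (cform v v) \<odot> l" using hf[of v v'] hf[of v v] v(2) by simp
      have nz: "qcomplex u (cform v v) \<noteq> 0" using Re_qcomplex[OF u] v(1) by (metis zero_index less_irrefl)
      \<comment> \<open>The quaternion l is a quotient of two form values on U, hence already a
        complex scalar.\<close>
      have "l = qinv (qcomplex u (cform v v)) \<odot> qcomplex u (cform v v')"
        using nz h by (simp add: qinv_left flip: qmul_assoc)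
      also have "\<dots> \<in> cent u"
        by (intro cent_cent cent_inv u0) (simp_all add: cent_qcomplex[OF u])
      finally obtain c where "l = qcomplex u c" unfolding cent_qcomplex[OF u] by blast
      then have "f (v' - v * (\<chi> i. c)) = 0" using v(2) by (simp add: f_diff f_scal)
      then show ?thesis using finj by fastforce
    qed
    show "range (\<lambda>c. v' * (\<chi> i. c)) = range (\<lambda>c. v * (\<chi> i. c))" if v': "v' \<in> range (\<lambda>c. v * (\<chi> i. c))" "v' \<noteq> 0" for v v' :: "complex^2"
    proof -
      obtain c where c: "v' = v * (\<chi> i. c)" using v' by blast
      then have "c \<noteq> 0" using v' by (auto simp: vec_eq_iff)
      then have 1: "v * (\<chi> i. d) = v' * (\<chi> i. d / c)" for d using c by (simp add: vec_eq_iff)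
      have 2: "v' * (\<chi> i. d) = v * (\<chi> i. c * d)" for d using c by (simp add: vec_eq_iff)
      show ?thesis
      proof
        show "range (\<lambda>c. v' * (\<chi> i. c)) \<subseteq> range (\<lambda>c. v * (\<chi> i. c))" unfolding 2 by blast
        show "range (\<lambda>c. v * (\<chi> i. c)) \<subseteq> range (\<lambda>c. v' * (\<chi> i. c))" unfolding 1 by blast
      qed
    qed
  qed (simp add: distHC_def Let_def)
  moreover have "lines_of U = {qline (f v) |v. Re (cform v v) < 0}"
    unfolding lines_of_def U_def by (auto simp: hf Re_qcomplex[OF u])
  ultimately show "isometric_to (lines_of U) distHH HC1 distHC" by (simp add: HC1_def)
qed

theorem theorem4p8:
  fixes \<Gamma> :: "qmat set"
  assumes "discrete_subgroup_Sp21 \<Gamma>"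
    and "nonelementary \<Gamma>"
    and "trace_field \<Gamma> \<subseteq> range qreal"
  shows "\<exists>M. M \<subseteq> HH2 \<and> totally_geodesic M \<and> (\<forall>g\<in>\<Gamma>. qact g ` M = M) \<and>
           (isometric_to M distHH HR2 distHR \<or> isometric_to M distHH HC1 distHC)"
proof -
  have "qmat_trace g \<in> range qreal" if "g \<in> \<Gamma>" for g
  proof -
    have "qmat_trace g \<in> trace_field \<Gamma>" using that unfolding trace_field_def by blast
    then show ?thesis using assms(3) by blast
  qed
  then interpret real_trace_group \<Gamma> using assms(1) by unfold_locales
  obtain a b c where abc: "a \<in> limit_set \<Gamma>" "b \<in> limit_set \<Gamma>" "c \<in> limit_set \<Gamma>" "a \<noteq> b" "a \<noteq> c" "b \<noteq> c"
    using assms(2) unfolding nonelementary_def by blast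
  obtain z1 where z1: "z1 \<in> limit_vecs" "a = qline z1" using limit_set_limit_vecs abc by blast
  obtain z2 where z2: "z2 \<in> limit_vecs" "b = qline z2" using limit_set_limit_vecs abc by blast
  obtain z3 where z3: "z3 \<in> limit_vecs" "c = qline z3" using limit_set_limit_vecs abc by blast
  \<comment> \<open>Orthogonal isotropic vectors span the same line, so distinct limit points have
    nonzero pairing.\<close>
  have nz: "herm x y \<noteq> 0" if xy: "x \<in> limit_vecs" "y \<in> limit_vecs" "qline x \<noteq> qline y" for x y
  proof
    assume "herm x y = 0"
    then obtain l where "y = x \<triangleleft> l" using isotropic_perp_parallel limit_vecs_isotropic xy by metis
    then show False using qline_eq_iff limit_vecs_isotropic(1)[OF xy(2)] xy(3) by blast
  qed
  obtain x1 x2 where x: "herm x1 x1 = 0" "herm x2 x2 = 0" "herm x1 x2 = qreal 1"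
    and cases: "(\<exists>u. imag_unit u \<and> (\<forall>g\<in>\<Gamma>. \<forall>x\<in>{x1,x2}. \<exists>a\<in>cent u. \<exists>b\<in>cent u. g \<triangleright> x = x1 \<triangleleft> a + x2 \<triangleleft> b)) \<or>
     (\<exists>w. herm x1 w = 0 \<and> herm x2 w = 0 \<and> herm w w = qreal 1 \<and>
        (\<forall>g\<in>\<Gamma>. \<forall>x\<in>{x1,x2,w}. \<exists>a b c. g \<triangleright> x = a *\<^sub>R x1 + b *\<^sub>R x2 + c *\<^sub>R w))"
  proof (rule invariant_frame[OF z1(1) z2(1) z3(1)])
    show "herm z1 z2 \<noteq> 0" "herm z1 z3 \<noteq> 0" "herm z2 z3 \<noteq> 0" using nz z1 z2 z3 abc by auto
  qed
  from cases show ?thesis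
  proof (elim disjE exE conjE)
    fix u assume u: "imag_unit u" "\<forall>g\<in>\<Gamma>. \<forall>x\<in>{x1,x2}. \<exists>a\<in>cent u. \<exists>b\<in>cent u. g \<triangleright> x = x1 \<triangleleft> a + x2 \<triangleleft> b"
    have "\<exists>M. M \<subseteq> HH2 \<and> totally_geodesic M \<and> (\<forall>g\<in>\<Gamma>. qact g ` M = M) \<and> isometric_to M distHH HC1 distHC"
      by (rule complex_line_conclusion[OF x u(1)]) (use u(2) in blast)
    then show ?thesis by blast
  next
    fix w assume w: "herm x1 w = 0" "herm x2 w = 0" "herm w w = qreal 1"
      "\<forall>g\<in>\<Gamma>. \<forall>x\<in>{x1,x2,w}. \<exists>a b c. g \<triangleright> x = a *\<^sub>R x1 + b *\<^sub>R x2 + c *\<^sub>R w"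
    have "\<exists>M. M \<subseteq> HH2 \<and> totally_geodesic M \<and> (\<forall>g\<in>\<Gamma>. qact g ` M = M) \<and> isometric_to M distHH HR2 distHR"
      by (rule real_plane_conclusion[OF x w(1-3)]) (use w(4) in blast)
    then show ?thesis by blast
  qed
qed

end
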